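(* The set $\mathrm{HCopies}(S^1) = \{ Y \in \mathrm{TOP} : Y \cong_{\mathrm{homeo}} S^1 \}$ is $\mathbf{\Pi}^0_4$-Wadge-complete (that is, the circle $S^1$ has topological Scott complexity $\mathbf{\Pi}^0_4$).
   Context: A sequence $(x_i)_{i\in\mathbb{N}}$ in a metric space is a fast Cauchy sequence if $d(x_i,x_{i+1})<2^{-i}$ for all $i$. A presentation of a Polish space $X$ is a countable set $M$ of points (identified with $\mathbb{N}$) together with a metric $d$ on $M$ such that $X$ is homeomorphic to the completion $\overline{M}$ of $(M,d)$; the metric is represented by giving, for every two elements $x,y\in M$, a fast Cauchy sequence of rationals $(q(x,y,k))_{k\in\mathbb{N}}$ converging to $d(x,y)$. A presentation is thus a function $q:\mathbb{N}^3\to\mathbb{Q}$, which is identified with an infinite binary string via a fixed computable coding (e.g. of its graph). $\mathrm{TOP}\subseteq 2^{\omega}$ is the space of all presentations of Polish spaces, with the subspace topology; it is a $\Pi^0_2$ subset of $2^\omega$, hence Polish, and is homeomorphic to Baire space $\omega^\omega$. For $Y\in\mathrm{TOP}$, $Y\cong_{\mathrm{homeo}} X$ means that the completion of the metric space presented by $Y$ is homeomorphic to $X$. For $B\subseteq\omega^\omega$ and $A\subseteq\mathrm{TOP}$, $B$ is Wadge reducible to $A$ if there is a continuous $f:\omega^\omega\to\mathrm{TOP}$ with $x\in B \iff f(x)\in A$ for all $x$. For a (boldface) pointclass $\Gamma$, a set $A$ is $\Gamma$-Wadge-complete if $A\in\Gamma$ and every $B\subseteq\omega^\omega$ with $B\in\Gamma$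 is Wadge reducible to $A$. *)

theory Defs
  imports "HOL-Analysis.Analysis" "HOL-Library.Nat_Bijection"
begin

section \<open>The completion of a metric space\<close>

context Metric_space
begin

definition completion_rel :: "((nat \<Rightarrow> 'a) \<times> (nat \<Rightarrow> 'a)) set" where
  "completion_rel =
     {(\<sigma>, \<tau>). MCauchy \<sigma> \<and> MCauchy \<tau> \<and> (\<lambda>n. d (\<sigma> n) (\<tau> n)) \<longlonglongrightarrow> 0}"

definition completion_points :: "(nat \<Rightarrow> 'a) set set" where
  "completion_points = Collect MCauchy // completion_rel"

text \<open>
  The value 0 off the carrier is irrelevant to the topology; it only serves the library's
  locale, which asks a distance to be nonnegative and symmetric on the whole type.
\<close>

definition completion_dist :: "(nat \<Rightarrow> 'a) set \<Rightarrow> (nat \<Rightarrow> 'a) set \<Rightarrow> real" where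
  "completion_dist A B =
     (if A \<in> completion_points \<and> B \<in> completion_points
      then THE r. \<forall>\<sigma>\<in>A. \<forall>\<tau>\<in>B. (\<lambda>n. d (\<sigma> n) (\<tau> n)) \<longlonglongrightarrow> r else 0)"

definition completion_topology :: "(nat \<Rightarrow> 'a) set topology" where
  "completion_topology = Metric_space.mtopology completion_points completion_dist"

definition completion_embed :: "'a \<Rightarrow> (nat \<Rightarrow> 'a) set" where
  "completion_embed x = completion_rel `` {\<lambda>_. x}"

lemma MCauchy_in: "MCauchy \<sigma> \<Longrightarrow> \<sigma> n \<in> M"
  by (auto simp: MCauchy_def)

lemma quadrilateral:
  assumes "a \<in> M" "b \<in> M" "a' \<in> M" "b' \<in> M"
  shows "\<bar>d a b - d a' b'\<bar> \<le> d a a' + d b b'"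
  using assms triangle[of a a' b] triangle[of a' b' b] triangle[of a' a b'] triangle[of a b b']
  by (simp add: commute)

lemma MCauchy_dist_convergent:
  assumes "MCauchy \<sigma>" "MCauchy \<tau>"
  shows "convergent (\<lambda>n. d (\<sigma> n) (\<tau> n))"
proof (rule Cauchy_convergent, rule CauchyI)
  fix e :: real assume "e > 0"
  then have "e/2 > 0" by simp
  then obtain K L where
    K: "\<forall>n n'. K \<le> n \<longrightarrow> K \<le> n' \<longrightarrow> d (\<sigma> n) (\<sigma> n') < e/2" and
    L: "\<forall>n n'. L \<le> n \<longrightarrow> L \<le> n' \<longrightarrow> d (\<tau> n) (\<tau> n') < e/2"
    using assms unfolding MCauchy_def by metis
  have "norm (d (\<sigma> m) (\<tau> m) - d (\<sigma> n) (\<tau> n)) < e" if "m \<ge> max K L" "n \<ge> max K L" for m n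
  proof -
    have "d (\<sigma> m) (\<sigma> n) < e/2" "d (\<tau> m) (\<tau> n) < e/2" using K L that by auto
    with quadrilateral[of "\<sigma> m" "\<tau> m" "\<sigma> n" "\<tau> n"] show ?thesis
      using MCauchy_in[OF assms(1)] MCauchy_in[OF assms(2)] by (simp add: real_norm_def)
  qed
  then show "\<exists>N. \<forall>m\<ge>N. \<forall>n\<ge>N. norm (d (\<sigma> m) (\<tau> m) - d (\<sigma> n) (\<tau> n)) < e" by blast
qed

lemma completion_rel_cong:
  assumes "(\<sigma>, \<sigma>') \<in> completion_rel" "(\<tau>, \<tau>') \<in> completion_rel"
    and "(\<lambda>n. d (\<sigma> n) (\<tau> n)) \<longlonglongrightarrow> r"
  shows "(\<lambda>n. d (\<sigma>' n) (\<tau>' n)) \<longlonglongrightarrow> r"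
proof -
  have C: "MCauchy \<sigma>" "MCauchy \<sigma>'" "MCauchy \<tau>" "MCauchy \<tau>'"
    using assms by (auto simp: completion_rel_def)
  have L: "(\<lambda>n. d (\<sigma> n) (\<sigma>' n) + d (\<tau> n) (\<tau>' n)) \<longlonglongrightarrow> 0 + 0"
    using assms(1,2) by (intro tendsto_add) (auto simp: completion_rel_def)
  have "(\<lambda>n. d (\<sigma> n) (\<tau> n) - d (\<sigma>' n) (\<tau>' n)) \<longlonglongrightarrow> 0"
  proof (rule Lim_null_comparison)
    show "\<forall>\<^sub>F n in sequentially. norm (d (\<sigma> n) (\<tau> n) - d (\<sigma>' n) (\<tau>' n))
            \<le> d (\<sigma> n) (\<sigma>' n) + d (\<tau> n) (\<tau>' n)"
      unfolding real_norm_def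
      by (intro always_eventually allI quadrilateral) (use C MCauchy_in in auto)
  qed (use L in simp)
  from tendsto_diff[OF assms(3) this] show ?thesis by simp
qed

lemma equiv_completion_rel: "equiv (Collect MCauchy) completion_rel"
proof (rule equivI)
  show "completion_rel \<subseteq> Collect MCauchy \<times> Collect MCauchy"
    by (auto simp: completion_rel_def)
  show refl: "refl_on (Collect MCauchy) completion_rel"
    by (auto simp: refl_on_def completion_rel_def MCauchy_in)
  show "sym completion_rel"
    by (auto simp: sym_def completion_rel_def commute)
  show "trans completion_rel"
  proof (rule transI)
    fix a b c assume ab: "(a, b) \<in> completion_rel" and bc: "(b, c) \<in> completion_rel"
    then have "(a, a) \<in> completion_rel"
      using refl by (auto simp: refl_on_def completion_rel_def)
    from completion_rel_cong[OF this bc] ab bc show "(a, c) \<in> completion_rel"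
      by (auto simp: completion_rel_def)
  qed
qed

lemma completion_pointsE:
  assumes "A \<in> completion_points"
  obtains \<sigma> where "MCauchy \<sigma>" "A = completion_rel `` {\<sigma>}"
  using assms by (auto simp: completion_points_def elim!: quotientE)

lemma completion_pointsI: "MCauchy \<sigma> \<Longrightarrow> completion_rel `` {\<sigma>} \<in> completion_points"
  by (auto simp: completion_points_def intro: quotientI)

lemma completion_dist_tendsto:
  assumes "MCauchy \<sigma>" "MCauchy \<tau>"
  shows "(\<lambda>n. d (\<sigma> n) (\<tau> n)) \<longlonglongrightarrow>
           completion_dist (completion_rel `` {\<sigma>}) (completion_rel `` {\<tau>})"
proof -
  obtain r where r: "(\<lambda>n. d (\<sigma> n) (\<tau> n)) \<longlonglongrightarrow> r"
    using MCauchy_dist_convergent[OF assms] by (auto simp: convergent_def)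
  have refl: "(\<sigma>, \<sigma>) \<in> completion_rel" "(\<tau>, \<tau>) \<in> completion_rel"
    using assms equiv_completion_rel by (auto simp: equiv_def refl_on_def)
  have "completion_dist (completion_rel `` {\<sigma>}) (completion_rel `` {\<tau>}) = r"
    unfolding completion_dist_def if_P[OF conjI[OF completion_pointsI[OF assms(1)] completion_pointsI[OF assms(2)]]]
  proof (rule the_equality)
    show "\<forall>\<sigma>'\<in>completion_rel `` {\<sigma>}. \<forall>\<tau>'\<in>completion_rel `` {\<tau>}.
            (\<lambda>n. d (\<sigma>' n) (\<tau>' n)) \<longlonglongrightarrow> r"
      using completion_rel_cong r by blast
    show "s = r" if "\<forall>\<sigma>'\<in>completion_rel `` {\<sigma>}. \<forall>\<tau>'\<in>completion_rel `` {\<tau>}.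
            (\<lambda>n. d (\<sigma>' n) (\<tau>' n)) \<longlonglongrightarrow> s" for s
      using that refl r by (blast intro: LIMSEQ_unique)
  qed
  with r show ?thesis by simp
qed

lemma Metric_space_completion: "Metric_space completion_points completion_dist"
proof -
  have *: "completion_dist A B \<ge> 0 \<and> completion_dist A B = completion_dist B A \<and>
        (completion_dist A B = 0 \<longleftrightarrow> A = B) \<and>
        completion_dist A C \<le> completion_dist A B + completion_dist B C"
    if A: "A \<in> completion_points" and B: "B \<in> completion_points" and C: "C \<in> completion_points"
    for A B C
  proof -
    from A obtain a where a: "MCauchy a" "A = completion_rel `` {a}" by (rule completion_pointsE)
    from B obtain b where b: "MCauchy b" "B = completion_rel `` {b}" by (rule completion_pointsE)
    from C obtain c where c: "MCauchy c" "C = completion_rel `` {c}" by (rule completion_pointsE)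
    have ab: "(\<lambda>n. d (a n) (b n)) \<longlonglongrightarrow> completion_dist A B"
      and ba: "(\<lambda>n. d (b n) (a n)) \<longlonglongrightarrow> completion_dist B A"
      and bc: "(\<lambda>n. d (b n) (c n)) \<longlonglongrightarrow> completion_dist B C"
      and ac: "(\<lambda>n. d (a n) (c n)) \<longlonglongrightarrow> completion_dist A C"
      using a b c by (auto intro: completion_dist_tendsto)
    have 1: "completion_dist A B \<ge> 0"
      using ab by (rule LIMSEQ_le_const) auto
    have 2: "completion_dist A B = completion_dist B A"
      using ab ba by (auto simp: commute intro: LIMSEQ_unique)
    have "A = B \<longleftrightarrow> (a, b) \<in> completion_rel"
      using eq_equiv_class_iff[OF equiv_completion_rel, of a b] a b by simp
    also have "\<dots> \<longleftrightarrow> (\<lambda>n. d (a n) (b n)) \<longlonglongrightarrow> 0"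
      using a b by (simp add: completion_rel_def)
    also have "\<dots> \<longleftrightarrow> completion_dist A B = 0"
      using ab LIMSEQ_unique by auto
    finally have 3: "completion_dist A B = 0 \<longleftrightarrow> A = B" by simp
    have "completion_dist A C \<le> completion_dist A B + completion_dist B C"
      using ac tendsto_add[OF ab bc]
      by (rule LIMSEQ_le) (use triangle MCauchy_in a b c in blast)
    with 1 2 3 show ?thesis by blast
  qed
  show ?thesis
  proof
    show "0 \<le> completion_dist A B" for A B
      using *[of A B A] by (cases "A \<in> completion_points \<and> B \<in> completion_points")
        (auto simp: completion_dist_def)
    show "completion_dist A B = completion_dist B A" for A B
      using *[of A B A] by (cases "A \<in> completion_points \<and> B \<in> completion_points")
        (auto simp: completion_dist_def)
  qed (use * in blast)+
qed

lemma topspace_completion [simp]: "topspace completion_topology = completion_points"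
  by (simp add: completion_topology_def Metric_space.topspace_mtopology[OF Metric_space_completion])

lemma completion_embed_in: "x \<in> M \<Longrightarrow> completion_embed x \<in> completion_points"
  by (simp add: completion_embed_def completion_pointsI)

lemma completion_embed_isometric:
  assumes "x \<in> M" "y \<in> M"
  shows "completion_dist (completion_embed x) (completion_embed y) = d x y"
  using completion_dist_tendsto[of "\<lambda>_. x" "\<lambda>_. y"] assms
  by (simp add: completion_embed_def LIMSEQ_const_iff)

lemma completion_embed_limit:
  assumes "MCauchy \<sigma>"
  shows "(\<lambda>n. completion_dist (completion_embed (\<sigma> n)) (completion_rel `` {\<sigma>})) \<longlonglongrightarrow> 0"
proof (rule LIMSEQ_I)
  fix e :: real assume "e > 0"
  then obtain N where N: "\<And>n n'. N \<le> n \<Longrightarrow> N \<le> n' \<Longrightarrow> d (\<sigma> n) (\<sigma> n') < e/2"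
    using assms half_gt_zero[of e] unfolding MCauchy_def by metis
  have "norm (completion_dist (completion_embed (\<sigma> n)) (completion_rel `` {\<sigma>}) - 0) < e"
    if "n \<ge> N" for n
  proof -
    have "(\<lambda>m. d (\<sigma> n) (\<sigma> m)) \<longlonglongrightarrow>
            completion_dist (completion_embed (\<sigma> n)) (completion_rel `` {\<sigma>})"
      unfolding completion_embed_def
      using assms MCauchy_in by (intro completion_dist_tendsto) auto
    then have "completion_dist (completion_embed (\<sigma> n)) (completion_rel `` {\<sigma>}) \<le> e/2"
      by (rule LIMSEQ_le_const2) (use N that in \<open>blast intro: less_imp_le\<close>)
    moreover have "completion_dist (completion_embed (\<sigma> n)) (completion_rel `` {\<sigma>}) \<ge> 0"
      by (rule Metric_space.nonneg[OF Metric_space_completion])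
    ultimately show ?thesis using \<open>e > 0\<close> by simp
  qed
  then show "\<exists>N. \<forall>n\<ge>N. norm (completion_dist (completion_embed (\<sigma> n)) (completion_rel `` {\<sigma>}) - 0) < e"
    by blast
qed

lemma completion_embed_dense:
  "completion_topology closure_of (completion_embed ` M) = completion_points"
proof -
  interpret C: Metric_space completion_points completion_dist by (rule Metric_space_completion)
  have "A \<in> C.mtopology closure_of (completion_embed ` M)" if "A \<in> completion_points" for A
    unfolding C.metric_closure_of
  proof (clarsimp simp: that)
    fix e :: real assume "e > 0"
    from that obtain \<sigma> where \<sigma>: "MCauchy \<sigma>" "A = completion_rel `` {\<sigma>}"
      by (rule completion_pointsE)
    obtain n where "completion_dist (completion_embed (\<sigma> n)) A < e"
      using LIMSEQ_D[OF completion_embed_limit[OF \<sigma>(1)] \<open>e > 0\<close>] \<sigma>(2) by fastforce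
    then show "\<exists>x\<in>M. completion_embed x \<in> completion_points \<and> completion_dist A (completion_embed x) < e"
      using MCauchy_in[OF \<sigma>(1)] completion_embed_in C.commute by metis
  qed
  then show ?thesis
    using closure_of_subset_topspace[of C.mtopology "completion_embed ` M"]
    unfolding completion_topology_def C.topspace_mtopology by blast
qed

lemma mcomplete_completion: "Metric_space.mcomplete completion_points completion_dist"
proof -
  interpret C: Metric_space completion_points completion_dist by (rule Metric_space_completion)
  show ?thesis unfolding C.mcomplete_def
  proof (intro allI impI)
    fix S assume S: "C.MCauchy S"
    have "\<exists>x\<in>M. completion_dist (S n) (completion_embed x) < inverse (real (Suc n))" for n
    proof -
      have "S n \<in> C.mtopology closure_of (completion_embed ` M)"
        using completion_embed_dense C.MCauchy_def S by (auto simp: completion_topology_def)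
      then show ?thesis unfolding C.metric_closure_of
        by (fastforce dest!: spec[of _ "inverse (real (Suc n))"])
    qed
    then obtain \<sigma> where \<sigma>: "\<And>n. \<sigma> n \<in> M"
      "\<And>n. completion_dist (S n) (completion_embed (\<sigma> n)) < inverse (real (Suc n))"
      by metis
    have SC: "S n \<in> completion_points" for n using S C.MCauchy_def by auto
    have EC: "completion_embed (\<sigma> n) \<in> completion_points" for n by (simp add: completion_embed_in \<sigma>)
    have MC: "MCauchy \<sigma>" unfolding MCauchy_def
    proof (intro conjI allI impI)
      show "range \<sigma> \<subseteq> M" using \<sigma> by auto
      fix e :: real assume "e > 0"
      then obtain K where K: "\<And>n n'. K \<le> n \<Longrightarrow> K \<le> n' \<Longrightarrow> completion_dist (S n) (S n') < e/3"
        using S unfolding C.MCauchy_def by (meson divide_pos_pos zero_less_numeral)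
      obtain L where L: "inverse (real (Suc L)) < e/3"
        using reals_Archimedean[of "e/3"] \<open>e > 0\<close> by auto
      have "d (\<sigma> n) (\<sigma> n') < e" if n: "max K L \<le> n" and n': "max K L \<le> n'" for n n'
      proof -
        have inv: "inverse (real (Suc m)) < e/3" if "L \<le> m" for m
          using L that by (smt (verit) inverse_less_imp_less of_nat_0_less_iff of_nat_mono Suc_le_mono zero_less_Suc)
        have "completion_dist (completion_embed (\<sigma> n)) (completion_embed (\<sigma> n'))
              \<le> completion_dist (completion_embed (\<sigma> n)) (S n) + completion_dist (S n) (completion_embed (\<sigma> n'))"
          using SC EC C.triangle by blast
        also have "completion_dist (S n) (completion_embed (\<sigma> n')) \<le>
              completion_dist (S n) (S n') + completion_dist (S n') (completion_embed (\<sigma> n'))"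
          using SC EC C.triangle by blast
        finally show ?thesis
          using \<sigma>(2)[of n] \<sigma>(2)[of n'] inv[of n] inv[of n'] K[of n n'] n n'
          by (simp add: completion_embed_isometric \<sigma>(1) C.commute[of "completion_embed (\<sigma> n)" "S n"]
              C.commute[of "completion_embed (\<sigma> n')" "S n'"])
      qed
      then show "\<exists>N. \<forall>n n'. N \<le> n \<longrightarrow> N \<le> n' \<longrightarrow> d (\<sigma> n) (\<sigma> n') < e" by blast
    qed
    let ?A = "completion_rel `` {\<sigma>}"
    have A: "?A \<in> completion_points" using MC by (rule completion_pointsI)
    have "(\<lambda>n. completion_dist (S n) ?A) \<longlonglongrightarrow> 0"
    proof (rule tendsto_sandwich[of "\<lambda>_. 0"])
      show "\<forall>\<^sub>F n in sequentially. completion_dist (S n) ?A \<le>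
              inverse (real (Suc n)) + completion_dist (completion_embed (\<sigma> n)) ?A"
        using C.triangle[OF SC EC A] \<sigma>(2) by (intro always_eventually allI) (meson add_mono_thms_linordered_semiring(3) less_imp_le order_trans)
      show "(\<lambda>n. inverse (real (Suc n)) + completion_dist (completion_embed (\<sigma> n)) ?A) \<longlonglongrightarrow> 0"
        using tendsto_add[OF LIMSEQ_inverse_real_of_nat completion_embed_limit[OF MC]] by simp
    qed auto
    then show "\<exists>x. limitin C.mtopology S x sequentially"
      unfolding C.limitin_metric_dist_null
      by (intro exI[of _ ?A] conjI A always_eventually allI SC)
  qed
qed

end


section \<open>Presentations of Polish spaces\<close>

definition fast_Cauchy :: "(nat \<Rightarrow> 'a::metric_space) \<Rightarrow> bool" where
  "fast_Cauchy x \<longleftrightarrow> (\<forall>i. dist (x i) (x (Suc i)) < 1 / 2 ^ i)"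

text \<open>
  A presentation lives on the set of all natural numbers: \<open>q x y\<close> is a fast Cauchy sequence of
  rationals whose real limit is the distance of \<open>x\<close> and \<open>y\<close>. The distance is a genuine metric,
  so distinct natural numbers denote distinct points.
\<close>

definition presented_dist :: "(nat \<Rightarrow> nat \<Rightarrow> nat \<Rightarrow> rat) \<Rightarrow> nat \<Rightarrow> nat \<Rightarrow> real" where
  "presented_dist q x y = lim (\<lambda>k. real_of_rat (q x y k))"

definition presentation :: "(nat \<Rightarrow> nat \<Rightarrow> nat \<Rightarrow> rat) \<Rightarrow> bool" where
  "presentation q \<longleftrightarrow>
     (\<forall>x y. fast_Cauchy (\<lambda>k. real_of_rat (q x y k))) \<and>
     Metric_space UNIV (presented_dist q)"

definition rat_encode :: "rat \<Rightarrow> nat" where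
  "rat_encode r = (case quotient_of r of (a, b) \<Rightarrow> prod_encode (int_encode a, int_encode b))"

text \<open>The characteristic function of the graph of \<open>q\<close>, as an element of Cantor space.\<close>

definition presentation_code :: "(nat \<Rightarrow> nat \<Rightarrow> nat \<Rightarrow> rat) \<Rightarrow> nat \<Rightarrow> bool" where
  "presentation_code q n \<longleftrightarrow> (\<exists>x y k. n = list_encode [x, y, k, rat_encode (q x y k)])"

lemma inj_rat_encode: "inj rat_encode"
  by (rule injI)
     (auto simp: rat_encode_def quotient_of_inject_eq split: prod.splits
       dest!: injD[OF inj_int_encode] intro!: quotient_of_inject)

lemma inj_presentation_code: "inj presentation_code"
proof (rule injI, intro ext)
  fix q q' :: "nat \<Rightarrow> nat \<Rightarrow> nat \<Rightarrow> rat" and x y k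
  assume eq: "presentation_code q = presentation_code q'"
  have "presentation_code q (list_encode [x, y, k, rat_encode (q x y k)])"
    unfolding presentation_code_def by blast
  then have "presentation_code q' (list_encode [x, y, k, rat_encode (q x y k)])"
    by (simp add: eq)
  then show "q x y k = q' x y k"
    unfolding presentation_code_def list_encode_eq by (auto dest: injD[OF inj_rat_encode])
qed

definition TOP :: "(nat \<Rightarrow> bool) set" where
  "TOP = presentation_code ` Collect presentation"

definition presented_space :: "(nat \<Rightarrow> bool) \<Rightarrow> (nat \<Rightarrow> nat) set topology" where
  "presented_space Y =
     Metric_space.completion_topology UNIV (presented_dist (the_inv presentation_code Y))"

definition HCopies :: "'a topology \<Rightarrow> (nat \<Rightarrow> bool) set" where
  "HCopies X = {Y \<in> TOP. presented_space Y homeomorphic_space X}"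


section \<open>The finite boldface Borel hierarchy and Wadge completeness\<close>

text \<open>
  Levels are numbered from 1 (level 0 is a dummy). Taking countable unions over the preceding
  level only is the usual definition for metrizable spaces, where the levels increase.
\<close>

fun bSigma0 :: "nat \<Rightarrow> 'a topology \<Rightarrow> 'a set set" where
  "bSigma0 0 X = {}"
| "bSigma0 (Suc 0) X = {U. openin X U}"
| "bSigma0 (Suc (Suc n)) X =
     {\<Union>i. topspace X - A i | A :: nat \<Rightarrow> 'a set. \<forall>i. A i \<in> bSigma0 (Suc n) X}"

definition bPi0 :: "nat \<Rightarrow> 'a topology \<Rightarrow> 'a set set" where
  "bPi0 n X = {topspace X - A | A. A \<in> bSigma0 n X}"

text \<open>
  The types \<^typ>\<open>nat \<Rightarrow> nat\<close> and \<^typ>\<open>nat \<Rightarrow> bool\<close> carry the product of the discrete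
  topologies, i.e. they are Baire space and Cantor space.
\<close>

definition Wadge_reducible :: "(nat \<Rightarrow> nat) set \<Rightarrow> (nat \<Rightarrow> bool) set \<Rightarrow> bool" where
  "Wadge_reducible B A \<longleftrightarrow>
     (\<exists>f. continuous_map (euclidean :: (nat \<Rightarrow> nat) topology) (top_of_set TOP) f \<and>
          (\<forall>x. x \<in> B \<longleftrightarrow> f x \<in> A))"

definition Pi0_Wadge_complete :: "nat \<Rightarrow> (nat \<Rightarrow> bool) set \<Rightarrow> bool" where
  "Pi0_Wadge_complete n A \<longleftrightarrow>
     A \<in> bPi0 n (top_of_set TOP) \<and>
     (\<forall>B \<in> bPi0 n (euclidean :: (nat \<Rightarrow> nat) topology). Wadge_reducible B A)"

end

theory Submission
  imports Defs
begin

text \<open>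
  Upper bound. A space is a circle iff it carries a good cyclic chain of points and every good chain
  has a good refinement of arbitrarily small mesh. Indeed, nested good chains converge to a
  parametrization of the completion by the circle, since consecutive points get close while
  non-adjacent pieces stay apart. Conversely, in a circle fine chains between two points must pass
  near every point of one of the two arcs joining them, so the points of a good chain are in
  cyclic order and the arcs between them inherit the metric properties of the fine chains.

  Lower bound. A \<open>\<Pi>\<^sup>0\<^sub>4\<close> set is \<open>{x. \<forall>n. lim inf \<kappa> x n < \<infinity>}\<close> for natural sequences \<open>\<kappa> x n\<close> depending continuously on \<open>x\<close>.
  On the circle place countably many spots, converging to a point, and in the \<open>n\<close>th spot
  a path that zigzags over a fixed height. An input \<open>k\<close> destroys all strands of the zigzag to the
  right of strand \<open>k\<close>: only finitely many of their points have been committed, and strand \<open>k\<close> is bent through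
  them, which is a small change as all these strands are close to each other. Then new strands are
  created at a much smaller distance. If the limit inferior is finite, the result is an arc; if it
  is infinite, infinitely many strands accumulate and the space is not locally connected.
\<close>

section \<open>Chains and circles\<close>

text \<open>A presentation fixes distances on a countable dense set only, so arcs have to be seen
  through finite chains of ever smaller mesh. Strict bounds for such chains survive as weak bounds
  for arcs; an extension relaxes \<open>\<delta>\<close> to \<open>\<delta> / 2\<close> and
  \<open>\<epsilon>\<close> to \<open>2 * \<epsilon>\<close>, which makes them strict again. The
  obstacle to hardness is continuity: a point whose distances have been announced cannot be moved
  any more. Hence all heights are distinct and fixed in advance. Any finite set of announced points
  then lies on the graph of a function of the height, and one strand can absorb it. If the limit
  inferior \<open>K\<close> is attained in step \<open>s\<close>, everything to the right of strand
  \<open>K\<close> has width \<open>(1/2) ^ s\<close> afterwards, so strand \<open>K\<close>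
  converges uniformly although it is bent infinitely often. The limit inferior appears because a
  condition "for some \<open>m\<close>, for all \<open>l\<close>" on open sets says that some row is
  confirmed infinitely often, that is, that the least row confirmed at a stage does not tend to
  infinity. Spots of size \<open>(1/2) ^ n\<close> let one circle carry all these conditions, and a
  failure in one spot is enough to destroy it.\<close>

definition cyc :: "nat list \<Rightarrow> nat \<Rightarrow> nat" where
  "cyc p i = p ! (i mod length p)"

definition cyc_near :: "nat \<Rightarrow> nat \<Rightarrow> nat \<Rightarrow> bool" where
  "cyc_near n i k \<longleftrightarrow> i mod n = k mod n \<or> Suc i mod n = k mod n \<or> i mod n = Suc k mod n"

text \<open>
  A chain \<open>q\<close> refines the cyclic chain \<open>p\<close> if it inserts \<open>K - 1\<close> points between any two consecutive
  points of \<open>p\<close>, such that every piece stays \<open>\<epsilon>\<close>-close to its first point and non-adjacent pieces have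
  distance more than \<open>\<delta>\<close>. In a circle, arbitrarily fine refinements force the arcs between consecutive
  points of \<open>p\<close> to have the same two properties, which is what makes a good chain extendable.
  All the inequalities are strict so that being a good chain is a \<open>G\<^sub>\<delta>\<close> condition on the metric.
\<close>

definition refines :: "(nat \<Rightarrow> nat \<Rightarrow> real) \<Rightarrow> nat list \<Rightarrow> real \<Rightarrow> real \<Rightarrow> nat \<Rightarrow> nat list \<Rightarrow> bool" where
  "refines d p \<delta> \<epsilon> K q \<longleftrightarrow>
     length q = K * length p \<and> (\<forall>i<length p. cyc q (K * i) = p ! i) \<and>
     (\<forall>i<length p. \<forall>r\<le>K. d (p ! i) (cyc q (K * i + r)) < \<epsilon>) \<and>
     (\<forall>i<length p. \<forall>k<length p. \<not> cyc_near (length p) i k \<longrightarrow>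
        (\<forall>r\<le>K. \<forall>r'\<le>K. \<delta> < d (cyc q (K * i + r)) (cyc q (K * k + r'))))"

definition good_chain :: "(nat \<Rightarrow> nat \<Rightarrow> real) \<Rightarrow> nat list \<Rightarrow> real \<Rightarrow> real \<Rightarrow> bool" where
  "good_chain d p \<delta> \<epsilon> \<longleftrightarrow>
     4 \<le> length p \<and> distinct p \<and> (\<forall>x. \<exists>i<length p. d x (p ! i) < \<epsilon>) \<and>
     (\<forall>e::nat. \<exists>K q. 1 \<le> K \<and> refines d p \<delta> \<epsilon> K q \<and>
        (\<forall>j<length q. d (cyc q j) (cyc q (Suc j)) < 1 / Suc e))"

text \<open>The factors 2 and 1/2 are slack that makes weak bounds on arcs strict. Halving
  \<open>\<epsilon>\<close> makes the drift of points along nested chains summable, and the constant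
  32 keeps this drift below the separation of non-adjacent pieces. With \<open>2 \<le> K\<close> the
  number of points grows without bound.\<close>

definition good_extension :: "(nat \<Rightarrow> nat \<Rightarrow> real) \<Rightarrow> nat list \<Rightarrow> nat \<Rightarrow> nat \<Rightarrow> nat list \<Rightarrow> nat \<Rightarrow> nat \<Rightarrow> nat \<Rightarrow> bool" where
  "good_extension d p a b q a' b' K \<longleftrightarrow>
     2 \<le> K \<and> refines d p (1 / Suc a / 2) (2 / Suc b) K q \<and>
     good_chain d q (1 / Suc a') (1 / Suc b') \<and>
     1 / real (Suc b') \<le> 1 / Suc b / 2 \<and> 1 / real (Suc b') \<le> 1 / Suc a / 32"

text \<open>
  The implication over good chains replaces the choice of a nested sequence of chains by a single
  step, and it has complexity \<open>\<Pi>\<^sup>0\<^sub>4\<close>: its premise is \<open>G\<^sub>\<delta>\<close> and its conclusion a countable union of \<open>G\<^sub>\<delta>\<close> sets.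
\<close>

definition circular :: "(nat \<Rightarrow> nat \<Rightarrow> real) \<Rightarrow> bool" where
  "circular d \<longleftrightarrow>
     (\<exists>p a b. good_chain d p (1 / Suc a) (1 / Suc b)) \<and>
     (\<forall>p a b. good_chain d p (1 / Suc a) (1 / Suc b) \<longrightarrow>
        (\<exists>q a' b' K. good_extension d p a b q a' b' K))"

section \<open>The circle as the unit interval with its ends identified\<close>

lemma Arg2pi_cis: "t \<in> {0..<1} \<Longrightarrow> Arg2pi (cis (2 * pi * t)) = 2 * pi * t"
  using Arg2pi_unique[of 1 "2 * pi * t" "cis (2 * pi * t)"] by (simp add: cis_conv_exp mult.commute)

lemma cis_Arg2pi: "z \<in> sphere 0 1 \<Longrightarrow> cis (2 * pi * (Arg2pi z / (2 * pi))) = z"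
  using Arg2pi_eq[of z] by (simp add: cis_conv_exp mult.commute)

lemma Arg2pi_frac: "Arg2pi z / (2 * pi) \<in> {0..<1}"
  using Arg2pi_lt_2pi[of z] Arg2pi_ge_0[of z] by simp

lemma cis_image: "(\<lambda>t. cis (2 * pi * t)) ` {0..1} = sphere 0 1"
proof (rule subset_antisym)
  show "sphere 0 1 \<subseteq> (\<lambda>t. cis (2 * pi * t)) ` {0..1}"
  proof
    fix z :: complex assume "z \<in> sphere 0 1"
    then show "z \<in> (\<lambda>t. cis (2 * pi * t)) ` {0..1}"
      using Arg2pi_frac[of z] cis_Arg2pi[of z, symmetric]
      by (intro image_eqI[where x = "Arg2pi z / (2 * pi)"]) (auto simp del: times_divide_eq_right)
  qed
qed auto

lemma quotient_map_cis:
  "quotient_map (top_of_set {0..1}) (top_of_set (sphere 0 1)) (\<lambda>t. cis (2 * pi * t))"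
proof (rule T1_Spaces.continuous_imp_quotient_map)
  show "continuous_map (top_of_set {0..1}) (top_of_set (sphere 0 1)) (\<lambda>t. cis (2 * pi * t))"
    by (auto intro!: continuous_intros)
  show "compact_space (top_of_set {0..1::real})"
    by (simp add: compact_space_subtopology)
  show "Hausdorff_space (top_of_set (sphere (0::complex) 1))"
    by (simp add: Hausdorff_space_subtopology)
qed (simp add: cis_image)
lemma cyc_near_sym: "cyc_near n i k \<longleftrightarrow> cyc_near n k i"
  by (auto simp: cyc_near_def)

lemma refines_end:
  assumes "refines d p \<delta> \<epsilon> K q" "i < length p"
  shows "cyc q (K * i + K) = cyc p (Suc i)"
proof (cases "Suc i < length p")
  case True
  then have "cyc q (K * Suc i) = p ! Suc i" using assms(1) unfolding refines_def by blast
  then show ?thesis using True by (simp add: cyc_def[of p] add.commute)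
next
  case False
  then have e: "Suc i = length p" using assms(2) by simp
  then have "K * i + K = length q" using assms(1) unfolding refines_def by (metis mult_Suc_right add.commute)
  moreover have "cyc q (K * 0) = p ! 0"
    using assms unfolding refines_def by (metis gr_implies_not0 neq0_conv)
  ultimately show ?thesis using e by (simp add: cyc_def)
qed

section \<open>Nested good chains parametrize the completion by a circle\<close>

locale chain_sequence = Metric_space UNIV d
  for d :: "nat \<Rightarrow> nat \<Rightarrow> real" +
  fixes p :: "nat \<Rightarrow> nat list" and \<delta> \<epsilon> :: "nat \<Rightarrow> real" and K :: "nat \<Rightarrow> nat"
  assumes good: "good_chain d (p s) (\<delta> s) (\<epsilon> s)"
    and ref: "refines d (p s) (\<delta> s / 2) (2 * \<epsilon> s) (K s) (p (Suc s))"
    and K2: "2 \<le> K s"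
    and pos: "0 < \<delta> s" "0 < \<epsilon> s"
    and half: "\<epsilon> (Suc s) \<le> \<epsilon> s / 2" and small: "\<epsilon> (Suc s) \<le> \<delta> s / 32"
begin

definition N where "N s = length (p s)"

lemma N_Suc: "N (Suc s) = K s * N s"
  using ref[of s] by (simp add: refines_def N_def)

lemma N4: "4 \<le> N s"
  using good[of s] by (simp add: good_chain_def N_def)

lemma N_ge: "2 ^ s \<le> N s"
proof (induction s)
  case 0 then show ?case using N4[of 0] by simp
next
  case (Suc s)
  have "2 * 2 ^ s \<le> K s * N s" using Suc K2[of s] by (rule mult_le_mono[rotated])
  then show ?case by (simp add: N_Suc)
qed

lemma eps_bound: "\<epsilon> s \<le> \<epsilon> 0 / 2 ^ s"
proof (induction s)
  case (Suc s)
  have "\<epsilon> s / 2 \<le> \<epsilon> 0 / 2 ^ s / 2" using Suc by simp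
  with half[of s] show ?case by simp
qed simp

lemma eps_lim: "\<epsilon> \<longlonglongrightarrow> 0"
proof (rule tendsto_sandwich[of "\<lambda>_. 0" _ _ "\<lambda>s. \<epsilon> 0 / 2 ^ s"])
  show "(\<lambda>s. \<epsilon> 0 / 2 ^ s) \<longlonglongrightarrow> 0"
    using LIMSEQ_divide_realpow_zero[of 2 "\<epsilon> 0"] by simp
qed (auto intro!: always_eventually simp: eps_bound less_imp_le pos)

lemma eps_small: "0 < e \<Longrightarrow> \<exists>s. \<epsilon> s < e"
  using order_tendstoD(2)[OF eps_lim, of e] by (auto simp: eventually_sequentially)

definition idx :: "nat \<Rightarrow> real \<Rightarrow> nat" where "idx s t = nat \<lfloor>t * real (N s)\<rfloor>"

lemma idx_bounds:
  assumes "0 \<le> t" shows "real (idx s t) \<le> t * N s" "t * N s < real (idx s t) + 1"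
proof -
  have "0 \<le> t * N s" using assms by simp
  then show "real (idx s t) \<le> t * N s" "t * N s < real (idx s t) + 1"
    unfolding idx_def by linarith+
qed

lemma idx_less: "0 \<le> t \<Longrightarrow> t < 1 \<Longrightarrow> idx s t < N s"
proof -
  assume t: "0 \<le> t" "t < 1"
  have "t * N s < 1 * real (N s)" using N4[of s] t by (intro mult_strict_right_mono) auto
  with idx_bounds(1)[OF t(1), of s] show ?thesis by linarith
qed

text \<open>The partition of the unit interval into \<open>N (Suc s)\<close> equal parts cuts each
  of the \<open>N s\<close> earlier parts into \<open>K s\<close> parts. This is why a refinement
  inserts equally many points into every piece.\<close>

lemma idx_Suc:
  assumes "0 \<le> t" shows "\<exists>r<K s. idx (Suc s) t = K s * idx s t + r"
proof -
  have e: "t * N (Suc s) = real (K s) * (t * N s)" by (simp add: N_Suc)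
  have k: "0 < real (K s)" using K2[of s] by simp
  have "real (K s) * idx s t \<le> real (K s) * (t * N s)"
    using idx_bounds(1)[OF assms, of s] k by (intro mult_left_mono) auto
  then have "real (K s * idx s t) < real (idx (Suc s) t) + 1"
    using idx_bounds(2)[OF assms, of "Suc s"] e by simp
  then have 1: "K s * idx s t \<le> idx (Suc s) t" by linarith
  have "real (K s) * (t * N s) < real (K s) * (idx s t + 1)"
    using idx_bounds(2)[OF assms, of s] k by (intro mult_strict_left_mono) auto
  then have "real (idx (Suc s) t) < real (K s * (idx s t + 1))"
    using idx_bounds(1)[OF assms, of "Suc s"] unfolding e of_nat_mult by (rule le_less_trans[rotated])
  then have "idx (Suc s) t < K s * (idx s t + 1)" by linarith
  with 1 show ?thesis by (intro exI[of _ "idx (Suc s) t - K s * idx s t"]) auto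
qed

definition pt :: "real \<Rightarrow> nat \<Rightarrow> nat" where "pt t s = p s ! idx s t"

lemma pt_cyc: "0 \<le> t \<Longrightarrow> t < 1 \<Longrightarrow> pt t s = cyc (p s) (idx s t)"
  using idx_less by (simp add: pt_def cyc_def N_def)

lemma pt_step:
  assumes "0 \<le> t" "t < 1" shows "d (pt t s) (pt t (Suc s)) < 2 * \<epsilon> s"
proof -
  obtain r where r: "r < K s" "idx (Suc s) t = K s * idx s t + r" using idx_Suc[OF assms(1)] by blast
  have "d (p s ! idx s t) (cyc (p (Suc s)) (K s * idx s t + r)) < 2 * \<epsilon> s"
    using ref[of s] idx_less[OF assms, of s] r unfolding refines_def N_def by auto
  then show ?thesis using r by (simp add: pt_cyc[OF assms, of "Suc s"]) (simp add: pt_def)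
qed

lemma pt_late:
  assumes "0 \<le> t" "t < 1" "s \<le> s'" shows "d (pt t s) (pt t s') \<le> 4 * \<epsilon> s"
proof -
  \<comment> \<open>The sharper bound telescopes: since \<open>\<epsilon>\<close> is at least
    halved, a step of length \<open>2 * \<epsilon> m\<close> is at most
    \<open>4 * \<epsilon> m - 4 * \<epsilon> (Suc m)\<close>.\<close>
  have "d (pt t s) (pt t s') \<le> 4 * \<epsilon> s - 4 * \<epsilon> s'"
    using assms(3)
  proof (induction rule: dec_induct)
    case (step m)
    have "d (pt t s) (pt t (Suc m)) \<le> d (pt t s) (pt t m) + d (pt t m) (pt t (Suc m))"
      using triangle by blast
    with step pt_step[OF assms(1,2), of m] half[of m] show ?case by linarith
  qed simp
  with pos[of s'] show ?thesis by linarith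
qed

lemma MCauchy_pt:
  assumes "0 \<le> t" "t < 1" shows "MCauchy (pt t)"
  unfolding MCauchy_def
proof (intro conjI allI impI)
  fix e :: real assume "e > 0"
  then obtain s where s: "\<epsilon> s < e / 8" using eps_small[of "e/8"] by auto
  have "d (pt t n) (pt t n') < e" if "s \<le> n" "s \<le> n'" for n n'
    using triangle[of "pt t n" "pt t s" "pt t n'"] commute[of "pt t n" "pt t s"]
      pt_late[OF assms that(1)] pt_late[OF assms that(2)] s by simp
  then show "\<exists>N. \<forall>n n'. N \<le> n \<longrightarrow> N \<le> n' \<longrightarrow> d (pt t n) (pt t n') < e" by blast
qed auto

definition lim_pt :: "real \<Rightarrow> (nat \<Rightarrow> nat) set" where "lim_pt t = completion_rel `` {pt t}"

lemma lim_pt_in: "0 \<le> t \<Longrightarrow> t < 1 \<Longrightarrow> lim_pt t \<in> completion_points"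
  by (simp add: lim_pt_def completion_pointsI MCauchy_pt)

lemma lim_pt_dist:
  assumes "0 \<le> t" "t < 1" "0 \<le> t'" "t' < 1"
  shows "(\<lambda>s. d (pt t s) (pt t' s)) \<longlonglongrightarrow> completion_dist (lim_pt t) (lim_pt t')"
  unfolding lim_pt_def by (intro completion_dist_tendsto MCauchy_pt assms)

text \<open>The next point of the chain is the last point of a piece of any refinement, and a whole
  piece stays within \<open>\<epsilon> s\<close> of its first point.\<close>

lemma step_small:
  assumes "i < N s" shows "d (p s ! i) (cyc (p s) (Suc i)) < \<epsilon> s"
proof -
  obtain k q where q: "1 \<le> k" "refines d (p s) (\<delta> s) (\<epsilon> s) k q"
    using good[of s] unfolding good_chain_def by blast
  have *: "cyc q (k * i + k) = cyc (p s) (Suc i)"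
    using assms by (intro refines_end[OF q(2)]) (simp add: N_def)
  have "d (p s ! i) (cyc q (k * i + k)) < \<epsilon> s"
    using q assms unfolding refines_def N_def by blast
  then show ?thesis using * by simp
qed

text \<open>The factor is 9 = 1 + 4 + 4: one step of the chain and the later drift of both
  points.\<close>

lemma near_close:
  assumes "0 \<le> t" "t < 1" "0 \<le> t'" "t' < 1" "cyc_near (N s) (idx s t) (idx s t')"
  shows "completion_dist (lim_pt t) (lim_pt t') \<le> 9 * \<epsilon> s"
proof -
  have l: "idx s t < N s" "idx s t' < N s" using idx_less assms by auto
  have a: "d (pt t s) (pt t' s) \<le> \<epsilon> s"
    using assms(5) unfolding cyc_near_def
  proof (elim disjE)
    assume "idx s t mod N s = idx s t' mod N s"
    then show ?thesis using l pos[of s] by (simp add: pt_def)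
  next
    assume "Suc (idx s t) mod N s = idx s t' mod N s"
    then show ?thesis using step_small[OF l(1)] l by (simp add: pt_def cyc_def N_def)
  next
    assume "idx s t mod N s = Suc (idx s t') mod N s"
    then show ?thesis using step_small[OF l(2)] l by (simp add: pt_def cyc_def N_def commute)
  qed
  show ?thesis
  proof (rule LIMSEQ_le_const2[OF lim_pt_dist[OF assms(1-4)]], intro exI[of _ s] allI impI)
    fix n assume "s \<le> n"
    then have b: "d (pt t s) (pt t n) \<le> 4 * \<epsilon> s" "d (pt t' s) (pt t' n) \<le> 4 * \<epsilon> s"
      using pt_late assms by auto
    show "d (pt t n) (pt t' n) \<le> 9 * \<epsilon> s"
      using a b quadrilateral[of "pt t s" "pt t' s" "pt t n" "pt t' n"] by simp
  qed
qed

text \<open>At stage \<open>Suc s\<close> the points are more than \<open>\<delta> s / 2\<close>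
  apart. Each of them drifts by at most \<open>4 * \<epsilon> (Suc s)\<close>, which is at most
  \<open>\<delta> s / 8\<close>, so \<open>\<delta> s / 4\<close> remains in the limit.\<close>

lemma not_near_apart:
  assumes "0 \<le> t" "t < 1" "0 \<le> t'" "t' < 1" "\<not> cyc_near (N s) (idx s t) (idx s t')"
  shows "0 < completion_dist (lim_pt t) (lim_pt t')"
proof -
  obtain r where r: "r < K s" "idx (Suc s) t = K s * idx s t + r" using idx_Suc[OF assms(1)] by blast
  obtain r' where r': "r' < K s" "idx (Suc s) t' = K s * idx s t' + r'" using idx_Suc[OF assms(3)] by blast
  have a: "\<delta> s / 2 < d (pt t (Suc s)) (pt t' (Suc s))"
    using ref[of s] idx_less[OF assms(1,2), of s] idx_less[OF assms(3,4), of s] r r' assms(5)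
    unfolding pt_cyc[OF assms(1,2)] pt_cyc[OF assms(3,4)] refines_def N_def by (metis less_imp_le)
  have "\<delta> s / 4 \<le> completion_dist (lim_pt t) (lim_pt t')"
  proof (rule LIMSEQ_le_const[OF lim_pt_dist[OF assms(1-4)]], intro exI[of _ "Suc s"] allI impI)
    fix n assume "Suc s \<le> n"
    then have b: "d (pt t (Suc s)) (pt t n) \<le> 4 * \<epsilon> (Suc s)" "d (pt t' (Suc s)) (pt t' n) \<le> 4 * \<epsilon> (Suc s)"
      using pt_late assms by auto
    show "\<delta> s / 4 \<le> d (pt t n) (pt t' n)"
      using a b small[of s] quadrilateral[of "pt t (Suc s)" "pt t' (Suc s)" "pt t n" "pt t' n"] by simp
  qed
  with pos(1)[of s] show ?thesis by linarith
qed

text \<open>Once \<open>N s\<close> is large, both ways around from \<open>t\<close> to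
  \<open>t'\<close> have length more than 3 in units of \<open>1 / N s\<close>. Rounding down costs
  less than 1, so the indices differ cyclically by more than 2.\<close>

lemma idx_separate:
  assumes "0 \<le> t" "t < t'" "t' < 1" shows "\<exists>s. \<not> cyc_near (N s) (idx s t) (idx s t')"
proof -
  define m where "m = min (t' - t) (1 - (t' - t))"
  have "0 < m" using assms by (simp add: m_def)
  obtain s where s: "3 / m < 2 ^ s" using real_arch_pow[of 2 "3/m"] by auto
  have "3 / m < real (N s)"
    using s N_ge[of s] by (metis of_nat_le_iff of_nat_numeral of_nat_power less_le_trans)
  then have Nm: "3 < m * N s" using \<open>0 < m\<close> by (simp add: field_simps)
  have "m * N s \<le> (t' - t) * N s" by (intro mult_right_mono) (auto simp: m_def)
  moreover have "m * N s \<le> (1 - (t' - t)) * N s" by (intro mult_right_mono) (auto simp: m_def)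
  ultimately have "3 < t' * N s - t * N s" "3 < N s - (t' * N s - t * N s)"
    using Nm by (simp_all add: algebra_simps)
  with idx_bounds[OF assms(1), of s] idx_bounds[of t' s] assms
  have "real (idx s t) + 2 < idx s t'" "real (idx s t') + 2 < N s + idx s t" by auto
  then have c: "idx s t + 2 < idx s t'" "idx s t' + 2 < N s + idx s t" by linarith+
  have l: "idx s t < N s" "idx s t' < N s" using idx_less assms by auto
  have "\<not> cyc_near (N s) (idx s t) (idx s t')"
    using c l by (auto simp: cyc_near_def mod_Suc split: if_splits)
  then show ?thesis by blast
qed

interpretation C: Metric_space completion_points completion_dist
  by (rule Metric_space_completion)

text \<open>For \<open>u = 1\<close> the index \<open>idx s u\<close> would be \<open>N s\<close>,
  just outside of the list; the value at 0 closes the loop.\<close>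

definition loop :: "real \<Rightarrow> (nat \<Rightarrow> nat) set" where "loop u = lim_pt (if u < 1 then u else 0)"

lemma loop_in: "u \<in> {0..1} \<Longrightarrow> loop u \<in> completion_points"
  by (auto simp: loop_def lim_pt_in)

text \<open>An interval shorter than \<open>1 / N s\<close> meets at most two consecutive parts of
  the partition. If it ends in 1, these are the last part and, cyclically, the first one.\<close>

lemma loop_close:
  assumes "u \<in> {0..1}" "v \<in> {0..1}" "u \<le> v" "v - u < 1 / N s"
  shows "completion_dist (loop u) (loop v) \<le> 9 * \<epsilon> s"
proof -
  have N: "0 < real (N s)" using N4[of s] by simp
  consider "v < 1" | "u < 1" "v = 1" | "u = 1" "v = 1" using assms by force
  then show ?thesis
  proof cases
    case 1
    have "v * N s - u * N s < 1" using assms(4) N by (simp add: field_simps)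
    moreover have "u * N s \<le> v * N s" using assms N by simp
    ultimately have "real (idx s v) < idx s u + 2" "real (idx s u) < idx s v + 1"
      using idx_bounds[of u s] idx_bounds[of v s] assms by auto
    then have "idx s v = idx s u \<or> idx s v = Suc (idx s u)" by linarith
    then have "cyc_near (N s) (idx s u) (idx s v)" by (auto simp: cyc_near_def)
    then show ?thesis using near_close[of u v s] 1 assms by (simp add: loop_def)
  next
    case 2
    have "N s - u * N s < 1" using assms(4) N 2 by (simp add: field_simps)
    then have "real (N s) < idx s u + 2" using idx_bounds[of u s] assms by auto
    then have "Suc (idx s u) = N s" using idx_less[of u s] 2 assms by force
    then have "cyc_near (N s) (idx s u) (idx s 0)" by (auto simp: cyc_near_def idx_def)
    then show ?thesis using near_close[of u 0 s] 2 assms by (simp add: loop_def)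
  next
    case 3
    then show ?thesis using near_close[of 0 0 s] by (simp add: loop_def cyc_near_def)
  qed
qed

lemma loop_continuous: "continuous_map (top_of_set {0..1}) C.mtopology loop"
  unfolding C.continuous_map_to_metric
proof (intro ballI allI impI)
  fix u :: real and e :: real assume u: "u \<in> topspace (top_of_set {0..1})" and "0 < e"
  obtain s where s: "\<epsilon> s < e / 9" using eps_small[of "e/9"] \<open>0 < e\<close> by auto
  have N: "0 < 1 / real (N s)" using N4[of s] by simp
  have "loop v \<in> C.mball (loop u) e" if "v \<in> {0..1} \<inter> ball u (1 / N s)" for v
  proof -
    have "completion_dist (loop u) (loop v) \<le> 9 * \<epsilon> s"
    proof (cases "u \<le> v")
      case True then show ?thesis using loop_close[of u v s] that u by (auto simp: dist_real_def)
    next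
      case False then show ?thesis using loop_close[of v u s] that u
        by (auto simp: dist_real_def C.commute)
    qed
    then show ?thesis using s loop_in that u by auto
  qed
  then show "\<exists>U. openin (top_of_set {0..1}) U \<and> u \<in> U \<and> (\<forall>y\<in>U. loop y \<in> C.mball (loop u) e)"
    using u N by (intro exI[of _ "{0..1} \<inter> ball u (1 / N s)"]) (auto simp: openin_open)
qed

lemma compact_loop: "compactin C.mtopology (loop ` {0..1})"
  by (rule image_compactin[OF _ loop_continuous])
     (simp add: compactin_subtopology compact_interval)

text \<open>The image is compact, hence closed, so it suffices to approximate embedded points. Such
  a point has an element of \<open>p s\<close> within \<open>\<epsilon> s\<close>, and the limit
  point starting from this element is at most \<open>4 * \<epsilon> s\<close> further away.\<close>

lemma loop_surj: "loop ` {0..1} = completion_points"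
proof (rule subset_antisym)
  show "loop ` {0..1} \<subseteq> completion_points" using loop_in by blast
  have cl: "closedin C.mtopology (loop ` {0..1})"
    by (rule compactin_imp_closedin[OF C.Hausdorff_space_mtopology compact_loop])
  have "completion_embed x \<in> C.mtopology closure_of (loop ` {0..1})" for x
  proof -
    have "\<exists>y\<in>loop ` {0..1}. y \<in> C.mball (completion_embed x) e" if "0 < e" for e
  proof -
    obtain s where s: "\<epsilon> s < e / 8" using eps_small[of "e/8"] \<open>0 < e\<close> by auto
    obtain i where i: "i < N s" "d x (p s ! i) < \<epsilon> s"
      using good[of s] unfolding good_chain_def N_def by blast
    define t where "t = real i / N s"
    have t: "0 \<le> t" "t < 1" using i by (auto simp: t_def)
    have "idx s t = i" using i by (simp add: idx_def t_def)
    then have x: "d x (pt t s) < \<epsilon> s" using i by (simp add: pt_def)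
    have "(\<lambda>n. d x (pt t n)) \<longlonglongrightarrow> completion_dist (completion_embed x) (lim_pt t)"
      unfolding completion_embed_def lim_pt_def by (intro completion_dist_tendsto MCauchy_pt t) simp
    then have "completion_dist (completion_embed x) (lim_pt t) \<le> 5 * \<epsilon> s"
    proof (rule LIMSEQ_le_const2, intro exI[of _ s] allI impI)
      fix n assume "s \<le> n"
      then show "d x (pt t n) \<le> 5 * \<epsilon> s"
        using pt_late[OF t, of s n] x triangle[of x "pt t s" "pt t n"] by simp
    qed
    then have "completion_dist (completion_embed x) (loop t) < e" using s t \<open>0 < e\<close> pos(2)[of s] by (simp add: loop_def)
    then have "loop t \<in> C.mball (completion_embed x) e"
      using t loop_in[of t] by (simp add: completion_embed_in)
    then show ?thesis using t by (intro bexI[of _ "loop t"]) auto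
  qed
  then show ?thesis unfolding C.metric_closure_of by (auto simp: completion_embed_in)
  qed
  then have "completion_embed ` UNIV \<subseteq> loop ` {0..1}"
    using cl by (auto simp: closure_of_closedin)
  then have "completion_topology closure_of (completion_embed ` UNIV) \<subseteq> loop ` {0..1}"
    using cl by (intro closure_of_minimal) (auto simp: completion_topology_def)
  then show "completion_points \<subseteq> loop ` {0..1}" by (simp add: completion_embed_dense)
qed

lemma loop_inj:
  assumes "u \<in> {0..<1}" "v \<in> {0..<1}" "loop u = loop v" shows "u = v"
proof (rule ccontr)
  have "lim_pt u = lim_pt v" using assms by (simp add: loop_def)
  then have z: "completion_dist (lim_pt u) (lim_pt v) = 0" "completion_dist (lim_pt v) (lim_pt u) = 0"
    using C.zero[of "lim_pt v" "lim_pt v"] lim_pt_in[of v] assms by auto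
  assume "u \<noteq> v"
  then consider "u < v" | "v < u" by linarith
  then show False
  proof cases
    case 1
    then obtain s where "\<not> cyc_near (N s) (idx s u) (idx s v)" using idx_separate[of u v] assms by auto
    then show False using not_near_apart[of u v s] z assms by auto
  next
    case 2
    then obtain s where "\<not> cyc_near (N s) (idx s v) (idx s u)" using idx_separate[of v u] assms by auto
    then show False using not_near_apart[of v u s] z assms by auto
  qed
qed

text \<open>A continuous bijection from a compact space to a Hausdorff space is a homeomorphism. As
  \<open>Arg2pi\<close> jumps at 1, continuity of \<open>g\<close> is obtained through the quotient
  map from the interval, along which \<open>g\<close> becomes \<open>loop\<close>.\<close>

theorem completion_circle: "completion_topology homeomorphic_space top_of_set (sphere (0::complex) 1)"
proof -
  define g where "g = (\<lambda>z. loop (Arg2pi z / (2 * pi)))"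
  let ?S = "sphere (0::complex) 1"
  have ge: "(g \<circ> (\<lambda>t. cis (2 * pi * t))) t = loop t" if "t \<in> {0..1}" for t
  proof (cases "t < 1")
    case True then show ?thesis using Arg2pi_cis[of t] that by (simp add: g_def)
  next
    case False
    then have "t = 1" using that by simp
    then show ?thesis using Arg2pi_cis[of 0] by (simp add: g_def loop_def)
  qed
  have "continuous_map (top_of_set {0..1}) C.mtopology (g \<circ> (\<lambda>t. cis (2 * pi * t)))"
    using loop_continuous by (rule continuous_map_eq) (simp add: ge[unfolded o_def, symmetric])
  then have gc: "continuous_map (top_of_set ?S) C.mtopology g"
    by (rule continuous_compose_quotient_map[OF quotient_map_cis])
  have im: "g ` ?S = loop ` {0..1}"
    unfolding cis_image[symmetric] image_image by (rule image_cong) (simp_all add: ge[unfolded o_def])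
  have "homeomorphic_map (top_of_set ?S) C.mtopology g"
  proof (rule continuous_imp_homeomorphic_map[OF gc])
    show "compact_space (top_of_set ?S)" by (simp add: compact_space_subtopology)
    show "g ` topspace (top_of_set ?S) = topspace C.mtopology" by (simp add: im loop_surj)
    show "inj_on g (topspace (top_of_set ?S))"
    proof (rule inj_onI)
      fix z w assume zw: "z \<in> topspace (top_of_set ?S)" "w \<in> topspace (top_of_set ?S)" "g z = g w"
      then have *: "Arg2pi z / (2 * pi) = Arg2pi w / (2 * pi)"
        using loop_inj[OF Arg2pi_frac[of z] Arg2pi_frac[of w]] by (simp only: g_def)
      have "z = cis (2 * pi * (Arg2pi z / (2 * pi)))" using zw(1) cis_Arg2pi[of z, symmetric] by (simp only: topspace_euclidean_subtopology)
      also have "\<dots> = cis (2 * pi * (Arg2pi w / (2 * pi)))" by (simp only: *)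
      also have "\<dots> = w" using zw(2) cis_Arg2pi[of w] by (simp only: topspace_euclidean_subtopology)
      finally show "z = w" .
    qed
  qed (rule C.Hausdorff_space_mtopology)
  then have "top_of_set ?S homeomorphic_space C.mtopology"
    by (rule homeomorphic_map_imp_homeomorphic_space)
  then show ?thesis unfolding completion_topology_def by (rule homeomorphic_space_sym[THEN iffD1])
qed

end

theorem circular_imp_circle:
  assumes "Metric_space UNIV d" "circular d"
  shows "Metric_space.completion_topology UNIV d homeomorphic_space top_of_set (sphere (0::complex) 1)"
proof -
  \<comment> \<open>The fourth component of a state stores the factor by which its chain refines the
    previous one, so that dependent choice delivers the factors along with the chains.\<close>
  define P where "P = (\<lambda>(p, a, b, k::nat). good_chain d p (1 / Suc a) (1 / Suc b))"
  define Q where "Q = (\<lambda>(p, a, b, k::nat) (q, a', b', k'). good_extension d p a b q a' b' k')"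
  have "\<exists>x. P x" using assms(2) unfolding circular_def P_def by auto
  moreover have "\<exists>y. P y \<and> Q x y" if Px: "P x" for x
  proof -
    obtain p a b k where x: "x = (p, a, b, k)" by (metis prod_cases4)
    then obtain q a' b' k' where "good_extension d p a b q a' b' k'"
      using Px assms(2) unfolding circular_def P_def x prod.case by blast
    then show ?thesis unfolding P_def Q_def x
      by (intro exI[of _ "(q, a', b', k')"]) (simp add: good_extension_def)
  qed
  ultimately obtain f where f: "\<And>n. P (f n)" "\<And>n. Q (f n) (f (Suc n))"
    using dependent_nat_choice[of "\<lambda>_. P" "\<lambda>_. Q"] by metis
  define p where "p = (\<lambda>n. fst (f n))"
  define a where "a = (\<lambda>n. fst (snd (f n)))"
  define b where "b = (\<lambda>n. fst (snd (snd (f n))))"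
  define k where "k = (\<lambda>n. snd (snd (snd (f (Suc n)))))"
  have 1: "good_chain d (p n) (1 / Suc (a n)) (1 / Suc (b n))" for n
    using f(1)[of n] by (simp add: P_def p_def a_def b_def case_prod_unfold)
  have 2: "good_extension d (p n) (a n) (b n) (p (Suc n)) (a (Suc n)) (b (Suc n)) (k n)" for n
    using f(2)[of n] by (simp add: Q_def p_def a_def b_def k_def case_prod_unfold)
  interpret chain_sequence d p "\<lambda>n. 1 / Suc (a n)" "\<lambda>n. 1 / Suc (b n)" k
    by (intro chain_sequence.intro assms chain_sequence_axioms.intro)
       (use 1 2 in \<open>simp_all add: good_extension_def\<close>)
  show ?thesis by (rule completion_circle)
qed

section \<open>Circles as metrics of period one on the line\<close>

lemma compact_pos_lower_bound:
  fixes f :: "'a::topological_space \<Rightarrow> real"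
  assumes "compact A" "continuous_on A f" "\<And>x. x \<in> A \<Longrightarrow> 0 < f x"
  shows "\<exists>e>0. \<forall>x\<in>A. e \<le> f x"
proof (cases "A = {}")
  case False
  then obtain x where "x \<in> A" "\<forall>y\<in>A. f x \<le> f y"
    using continuous_attains_inf[OF assms(1) _ assms(2)] by blast
  then show ?thesis using assms(3) by blast
qed (auto intro: exI[of _ 1])

text \<open>If \<open>p ! k\<close> is the point before \<open>p ! i\<close>, pieces
  \<open>i\<close> and \<open>k\<close> are adjacent and their separation says nothing. But
  \<open>p ! k\<close> is also the end of piece \<open>k - 1\<close>, which is not adjacent to piece
  \<open>i\<close> because the chain has at least four points.\<close>

lemma refines_far:
  assumes ref: "refines d p \<delta> \<epsilon> K q" and n: "4 \<le> length p" and i: "i < length p" "k < length p"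
    and k: "k \<noteq> i" "k \<noteq> Suc i mod length p" and r: "r \<le> K"
  shows "\<delta> < d (cyc q (K * i + r)) (p ! k)"
proof (cases "cyc_near (length p) i k")
  case False
  then have "\<delta> < d (cyc q (K * i + r)) (cyc q (K * k + 0))"
    using ref i r unfolding refines_def by blast
  then show ?thesis using ref i(2) unfolding refines_def by simp
next
  case True
  define n where "n = length p"
  have ki: "Suc k mod n = i" using True i k by (auto simp: cyc_near_def n_def)
  define k' where "k' = (if k = 0 then n - 1 else k - 1)"
  have k': "k' < n" "Suc k' mod n = k" using i n by (auto simp: k'_def n_def)
  have "\<not> cyc_near n i k'"
    using ki i n k' unfolding cyc_near_def n_def[symmetric]
    by (auto simp: k'_def mod_Suc split: if_splits)
  then have "\<delta> < d (cyc q (K * i + r)) (cyc q (K * k' + K))"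
    using ref i r k'(1) unfolding refines_def n_def by blast
  moreover have "cyc q (K * k' + K) = p ! k"
    using refines_end[OF ref, of k'] k' by (simp add: cyc_def n_def)
  ultimately show ?thesis by simp
qed

text \<open>Here \<open>\<rho>\<close> is the metric of the completion pulled back along the
  universal covering of the circle, and \<open>\<alpha> m\<close> is an angle of the point
  \<open>m\<close>, measured in turns. On the line, betweenness on the circle becomes a matter of
  inequalities.\<close>

locale circle_metric =
  fixes d :: "nat \<Rightarrow> nat \<Rightarrow> real" and \<rho> :: "real \<Rightarrow> real \<Rightarrow> real" and \<alpha> :: "nat \<Rightarrow> real"
  assumes rho_sym: "\<rho> s t = \<rho> t s"
    and rho_tri: "\<rho> s u \<le> \<rho> s t + \<rho> t u"
    and rho_zero: "\<rho> s t = 0 \<longleftrightarrow> s - t \<in> \<int>"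
    and rho_small: "0 < e \<Longrightarrow> \<exists>\<eta>>0. \<forall>t. \<bar>t - s\<bar> < \<eta> \<longrightarrow> \<rho> s t < e"
    and d_rho: "d a b = \<rho> (\<alpha> a) (\<alpha> b)"
    and d_zero: "d a b = 0 \<Longrightarrow> a = b"
    and dense: "s < t \<Longrightarrow> \<exists>m k. s < \<alpha> m + of_int k \<and> \<alpha> m + of_int k < t"
begin

lemma rho_refl [simp]: "\<rho> s s = 0"
  by (simp add: rho_zero)

lemma rho_nonneg: "0 \<le> \<rho> s t"
  using rho_tri[of s s t] rho_sym[of s t] by simp

lemma rho_pos: "s - t \<notin> \<int> \<Longrightarrow> 0 < \<rho> s t"
  using rho_nonneg[of s t] rho_zero[of s t] by linarith

lemma rho_cong: 
  assumes "s - s' \<in> \<int>" "t - t' \<in> \<int>" shows "\<rho> s t = \<rho> s' t'"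
proof -
  have "\<rho> s s' = 0" "\<rho> t t' = 0" using assms by (simp_all add: rho_zero)
  then show ?thesis
    using rho_tri[of s t s'] rho_tri[of s' t t'] rho_tri[of s' t' s] rho_tri[of s t' t]
      rho_sym[of s s'] rho_sym[of t t'] by linarith
qed

lemma rho_quad: "\<bar>\<rho> s t - \<rho> s' t'\<bar> \<le> \<rho> s s' + \<rho> t t'"
  using rho_tri[of s t s'] rho_tri[of s' t t'] rho_tri[of s' t' s] rho_tri[of s t' t]
      rho_sym[of s s'] rho_sym[of t t'] by linarith

lemma rho_cont: "continuous_on A (\<lambda>x. \<rho> (fst x) (snd x))"
  unfolding continuous_on_iff
proof (intro ballI allI impI)
  fix x :: "real \<times> real" and e :: real assume "0 < e"
  then obtain \<eta> \<eta>' where h: "0 < \<eta>" "\<forall>t. \<bar>t - fst x\<bar> < \<eta> \<longrightarrow> \<rho> (fst x) t < e/2"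
     "0 < \<eta>'" "\<forall>t. \<bar>t - snd x\<bar> < \<eta>' \<longrightarrow> \<rho> (snd x) t < e/2"
    using rho_small[of "e/2" "fst x"] rho_small[of "e/2" "snd x"] by auto
  have "dist (\<rho> (fst y) (snd y)) (\<rho> (fst x) (snd x)) < e" if "dist y x < min \<eta> \<eta>'" for y
  proof -
    have "\<bar>fst y - fst x\<bar> < \<eta>" "\<bar>snd y - snd x\<bar> < \<eta>'"
      using that dist_fst_le[of y x] dist_snd_le[of y x] by (auto simp: dist_real_def)
    then have "\<rho> (fst x) (fst y) < e/2" "\<rho> (snd x) (snd y) < e/2" using h by auto
    then show ?thesis using rho_quad[of "fst x" "snd x" "fst y" "snd y"] by (simp add: dist_real_def)
  qed
  then show "\<exists>d>0. \<forall>x'\<in>A. dist x' x < d \<longrightarrow> dist (\<rho> (fst x') (snd x')) (\<rho> (fst x) (snd x)) < e"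
    using h(1,3) by (intro exI[of _ "min \<eta> \<eta>'"]) auto
qed

lemma rho_cont_left: "continuous_on A (\<lambda>s. \<rho> s t)"
proof -
  have "continuous_on A (\<lambda>s. (s, t))" by (intro continuous_intros)
  from continuous_on_compose2[OF rho_cont[of UNIV] this] show ?thesis by simp
qed

text \<open>Periodicity reduces this to a compact square: subtracting the integer part of
  \<open>s\<close> from both arguments moves the first one into the unit interval and the second
  one, being within distance 1, into the interval from -1 to 2.\<close>

lemma rho_uniform:
  assumes "0 < e" shows "\<exists>\<mu>>0. \<forall>s t. \<bar>s - t\<bar> < \<mu> \<longrightarrow> \<rho> s t < e"
proof -
  have "uniformly_continuous_on ({-1..2} \<times> {-1..2}) (\<lambda>x. \<rho> (fst x) (snd x))"
    by (intro compact_uniformly_continuous rho_cont compact_Times compact_Icc)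
  then obtain \<mu> where \<mu>: "0 < \<mu>" "\<And>x x'. x \<in> {-1..2} \<times> {-1..2} \<Longrightarrow> x' \<in> {-1..2} \<times> {-1..2} \<Longrightarrow>
     dist x' x < \<mu> \<Longrightarrow> dist (\<rho> (fst x') (snd x')) (\<rho> (fst x) (snd x)) < e"
    using assms unfolding uniformly_continuous_on_def by metis
  have "\<rho> s t < e" if "\<bar>s - t\<bar> < min \<mu> 1" for s t
  proof -
    define s' t' where "s' = s - \<lfloor>s\<rfloor>" and "t' = t - \<lfloor>s\<rfloor>"
    have "0 \<le> s'" "s' < 1" unfolding s'_def by linarith+
    moreover have "\<bar>s' - t'\<bar> < min \<mu> 1" using that by (simp add: s'_def t'_def)
    moreover from calculation have "-1 \<le> t'" "t' \<le> 2" by linarith+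
    moreover have "dist (s', t') (s', s') = \<bar>s' - t'\<bar>" by (simp add: dist_Pair_Pair dist_real_def)
    ultimately have "dist (\<rho> s' t') (\<rho> s' s') < e"
      using \<mu>(2)[of "(s', s')" "(s', t')"] by auto
    then have "\<rho> s' t' < e" by (simp add: dist_real_def)
    then show ?thesis using rho_cong[of s s' t t'] by (simp add: s'_def t'_def)
  qed
  then show ?thesis using \<mu>(1) by (intro exI[of _ "min \<mu> 1"]) auto
qed

definition lift_of :: "nat \<Rightarrow> real \<Rightarrow> bool" where "lift_of m t \<longleftrightarrow> t - \<alpha> m \<in> \<int>"

lemma lift_rho: "lift_of m t \<Longrightarrow> \<rho> t s = \<rho> (\<alpha> m) s"
  by (rule rho_cong) (auto simp: lift_of_def)

lemma lift_d: "lift_of m s \<Longrightarrow> lift_of l t \<Longrightarrow> d m l = \<rho> s t"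
  unfolding d_rho by (rule sym, rule rho_cong) (auto simp: lift_of_def)

lemma lift_diff: "lift_of m s \<Longrightarrow> lift_of m t \<Longrightarrow> s - t \<in> \<int>"
  unfolding lift_of_def by (metis Ints_diff diff_diff_eq2 diff_add_cancel)

lemma lift_unique: "lift_of m t \<Longrightarrow> lift_of l t \<Longrightarrow> m = l"
  using lift_d[of m t l t] d_zero by simp

lemma lift_shift: "lift_of m t \<Longrightarrow> lift_of m (t + of_int k)"
  unfolding lift_of_def by (metis Ints_add Ints_of_int add_diff_eq add.commute)

lemma lift_exists: "\<exists>t. lift_of m t \<and> u \<le> t \<and> t < u + 1"
proof -
  have "lift_of m (\<alpha> m + of_int (- \<lfloor>\<alpha> m - u\<rfloor>))" by (simp add: lift_of_def)
  then show ?thesis by (intro exI[of _ "\<alpha> m + of_int (- \<lfloor>\<alpha> m - u\<rfloor>)"]) (auto, linarith+)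
qed

text \<open>The two points \<open>u\<close> and \<open>v\<close> disconnect the circle, hence no fine chain leads from one side to
  the other without coming close to one of them.\<close>

lemma chain_hits:
  assumes "0 < \<zeta>"
  shows "\<exists>\<eta>>0. \<forall>c K a b. lift_of (c 0) a \<longrightarrow> lift_of (c K) b \<longrightarrow> a \<in> {u..v} \<longrightarrow> b \<in> {v..u + 1} \<longrightarrow>
     (\<forall>r<K. d (c r) (c (Suc r)) < \<eta>) \<longrightarrow> (\<exists>r\<le>K. \<rho> (\<alpha> (c r)) u < \<zeta> \<or> \<rho> (\<alpha> (c r)) v < \<zeta>)"
proof -
  define A where "A = {t. t \<in> {u..v} \<and> \<zeta> \<le> \<rho> t u \<and> \<zeta> \<le> \<rho> t v}"
  define B where "B = {t. t \<in> {v..u + 1} \<and> \<zeta> \<le> \<rho> t u \<and> \<zeta> \<le> \<rho> t v}"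
  have cl: "closed {t. \<zeta> \<le> \<rho> t w}" for w
    using rho_cont_left[of UNIV w] by (intro closed_Collect_le) auto
  have "A = {u..v} \<inter> ({t. \<zeta> \<le> \<rho> t u} \<inter> {t. \<zeta> \<le> \<rho> t v})" by (auto simp: A_def)
  then have cA: "compact A" using cl by (metis compact_Icc compact_Int_closed closed_Int)
  have "B = {v..u + 1} \<inter> ({t. \<zeta> \<le> \<rho> t u} \<inter> {t. \<zeta> \<le> \<rho> t v})" by (auto simp: B_def)
  then have cB: "compact B" using cl by (metis compact_Icc compact_Int_closed closed_Int)
  have ne: "0 < \<rho> s t" if "s \<in> A" "t \<in> B" for s t
  proof -
    have "s \<noteq> u" "s \<noteq> v" "t \<noteq> v" "t \<noteq> u" using that assms by (auto simp: A_def B_def)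
    moreover have "t \<noteq> u + 1" using that assms rho_zero[of t u] by (auto simp: B_def)
    ultimately have "0 < t - s" "t - s < 1" using that by (auto simp: A_def B_def)
    then have "s - t \<notin> \<int>" using Ints_nonzero_abs_ge1[of "s - t"] by auto
    then show ?thesis by (rule rho_pos)
  qed
  obtain \<eta> where \<eta>: "0 < \<eta>" "\<forall>x\<in>A \<times> B. \<eta> \<le> \<rho> (fst x) (snd x)"
    using compact_pos_lower_bound[OF compact_Times[OF cA cB] rho_cont] ne by auto
  have "\<exists>r\<le>K. \<rho> (\<alpha> (c r)) u < \<zeta> \<or> \<rho> (\<alpha> (c r)) v < \<zeta>"
    if a: "lift_of (c 0) a" and b: "lift_of (c K) b" and ab: "a \<in> {u..v}" "b \<in> {v..u + 1}"
      and step: "\<forall>r<K. d (c r) (c (Suc r)) < \<eta>" for c K a b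
  proof (rule ccontr)
    assume "\<not> ?thesis"
    then have far: "\<zeta> \<le> \<rho> t u" "\<zeta> \<le> \<rho> t v" if "r \<le> K" "lift_of (c r) t" for r t
      using that lift_rho[of "c r" t] by (auto simp: not_less)
    \<comment> \<open>A point far from \<open>u\<close> and \<open>v\<close> lies over
      \<open>A\<close> or over \<open>B\<close>, and a step shorter than \<open>\<eta>\<close>
      cannot lead from \<open>A\<close> to \<open>B\<close>. So the chain stays over
      \<open>A\<close>, which its last point, lying over \<open>B\<close>, contradicts.\<close>
    have "\<exists>t\<in>A. lift_of (c r) t" if "r \<le> K" for r
      using that
    proof (induction r)
      case 0 then show ?case using a ab far[of 0 a] by (auto simp: A_def)
    next
      case (Suc r)
      then obtain s where s: "s \<in> A" "lift_of (c r) s" by auto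
      obtain t where t: "lift_of (c (Suc r)) t" "u \<le> t" "t < u + 1" using lift_exists by blast
      show ?case
      proof (cases "t \<le> v")
        case True then show ?thesis using t far[OF Suc.prems t(1)] by (auto simp: A_def)
      next
        case False
        then have "t \<in> B" using t far[OF Suc.prems t(1)] by (auto simp: B_def)
        then have "\<eta> \<le> \<rho> s t" using \<eta>(2) s by force
        also have "\<dots> = d (c r) (c (Suc r))" using lift_d s t by simp
        finally show ?thesis using step Suc.prems by (metis Suc_le_lessD not_le)
      qed
    qed
    then obtain s where s: "s \<in> A" "lift_of (c K) s" by blast
    have "b \<in> B" using ab far[OF _ b] by (auto simp: B_def)
    then have "\<eta> \<le> \<rho> s b" using \<eta>(2) s by force
    also have "\<rho> s b = 0" using lift_diff[OF s(2) b] by (simp add: rho_zero)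
    finally show False using \<eta>(1) by simp
  qed
  then show ?thesis using \<eta>(1) by (intro exI[of _ \<eta>]) blast
qed

text \<open>If \<open>p ! k\<close> and \<open>p ! l\<close> separated two consecutive points, a
  fine piece joining these would by \<open>chain_hits\<close> come \<open>\<delta>\<close>-close to
  one of the former, against \<open>refines_far\<close>.\<close>

lemma not_separated:
  assumes good: "good_chain d p \<delta> \<epsilon>" and "0 < \<delta>" and i: "i < length p" "k < length p" "l < length p"
    and kl: "k \<noteq> i" "k \<noteq> Suc i mod length p" "l \<noteq> i" "l \<noteq> Suc i mod length p"
    and lifts: "lift_of (p ! k) u" "lift_of (p ! l) v" "lift_of (p ! i) a" "lift_of (cyc p (Suc i)) b"
  shows "\<not> (a \<in> {u..v} \<and> b \<in> {v..u + 1})"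
proof
  assume ab: "a \<in> {u..v} \<and> b \<in> {v..u + 1}"
  obtain \<eta> where \<eta>: "0 < \<eta>" "\<And>c K a b. lift_of (c 0) a \<Longrightarrow> lift_of (c K) b \<Longrightarrow> a \<in> {u..v} \<Longrightarrow> b \<in> {v..u + 1} \<Longrightarrow>
     (\<forall>r<K. d (c r) (c (Suc r)) < \<eta>) \<Longrightarrow> (\<exists>r\<le>K. \<rho> (\<alpha> (c r)) u < \<delta> \<or> \<rho> (\<alpha> (c r)) v < \<delta>)"
    using chain_hits[OF \<open>0 < \<delta>\<close>, of u v] by metis
  obtain e where e: "1 / Suc e < \<eta>" using nat_approx_posE[OF \<eta>(1)] by auto
  obtain K q where q: "1 \<le> K" "refines d p \<delta> \<epsilon> K q"
    "\<forall>j<length q. d (cyc q j) (cyc q (Suc j)) < 1 / Suc e"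
    using good unfolding good_chain_def by blast
  have n: "4 \<le> length p" using good by (simp add: good_chain_def)
  let ?c = "\<lambda>r. cyc q (K * i + r)"
  have c0: "?c 0 = p ! i" using q i by (simp add: refines_def)
  have cK: "?c K = cyc p (Suc i)" by (rule refines_end[OF q(2) i(1)])
  have "\<forall>r<K. d (?c r) (?c (Suc r)) < \<eta>"
  proof (intro allI impI)
    fix r assume "r < K"
    then have "K * i + r < K * Suc i" by simp
    also have "\<dots> \<le> length q" using q(2) i(1) unfolding refines_def by (metis Suc_leI mult_le_mono2)
    finally show "d (?c r) (?c (Suc r)) < \<eta>" using q(3) e by fastforce
  qed
  then obtain r where r: "r \<le> K" "\<rho> (\<alpha> (?c r)) u < \<delta> \<or> \<rho> (\<alpha> (?c r)) v < \<delta>"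
    using \<eta>(2)[of ?c a K b] ab lifts c0 cK by auto
  have "\<delta> < d (?c r) (p ! k)" "\<delta> < d (?c r) (p ! l)"
    using refines_far[OF q(2) n i(1) i(2) kl(1,2) r(1)] refines_far[OF q(2) n i(1) i(3) kl(3,4) r(1)] by auto
  then show False using r lifts lift_rho rho_sym d_rho by (metis less_asym)
qed

text \<open>An increasing lift certifies that the chain is in cyclic order; the interval from
  \<open>\<theta> i\<close> to \<open>\<theta> (Suc i)\<close> covers the arc between two
  consecutive points.\<close>

definition lifts :: "nat list \<Rightarrow> (nat \<Rightarrow> real) \<Rightarrow> bool" where
  "lifts p \<theta> \<longleftrightarrow> p \<noteq> [] \<and> strict_mono \<theta> \<and> (\<forall>j. \<theta> (j + length p) = \<theta> j + 1) \<and>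
     (\<forall>j. lift_of (cyc p j) (\<theta> j))"

text \<open>Besides \<open>t\<close>, the second separating point is \<open>p ! k\<close> with
  \<open>k\<close> two places after \<open>i\<close>, lifted to
  \<open>u = \<theta> (i + 2) - 1\<close> just before \<open>\<theta> i\<close>. By
  \<open>refines_far\<close> piece \<open>i\<close> avoids that point, so it has to come close to
  \<open>t\<close>.\<close>

lemma tile_hits:
  assumes l: "lifts p \<theta>" and n: "4 \<le> length p" and i: "i < length p" and t: "t \<in> {\<theta> i..\<theta> (Suc i)}"
    and z: "0 < \<zeta>" "\<zeta> \<le> \<delta>"
  shows "\<exists>\<eta>>0. \<forall>K q. refines d p \<delta> \<epsilon> K q \<longrightarrow> (\<forall>j<length q. d (cyc q j) (cyc q (Suc j)) < \<eta>) \<longrightarrow>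
           (\<exists>r\<le>K. \<rho> (\<alpha> (cyc q (K * i + r))) t < \<zeta>)"
proof -
  have sm: "strict_mono \<theta>" and per: "\<And>j. \<theta> (j + length p) = \<theta> j + 1"
    and lf: "\<And>j. lift_of (cyc p j) (\<theta> j)" using l by (auto simp: lifts_def)
  define u where "u = \<theta> (i + 2) - 1"
  obtain \<eta> where \<eta>: "0 < \<eta>" "\<And>c K a b. lift_of (c 0) a \<Longrightarrow> lift_of (c K) b \<Longrightarrow> a \<in> {u..t} \<Longrightarrow> b \<in> {t..u + 1} \<Longrightarrow>
     (\<forall>r<K. d (c r) (c (Suc r)) < \<eta>) \<Longrightarrow> (\<exists>r\<le>K. \<rho> (\<alpha> (c r)) u < \<zeta> \<or> \<rho> (\<alpha> (c r)) t < \<zeta>)"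
    using chain_hits[OF z(1), of u t] by metis
  have "\<exists>r\<le>K. \<rho> (\<alpha> (cyc q (K * i + r))) t < \<zeta>"
    if q: "refines d p \<delta> \<epsilon> K q" "\<forall>j<length q. d (cyc q j) (cyc q (Suc j)) < \<eta>" for K q
  proof -
    let ?c = "\<lambda>r. cyc q (K * i + r)"
    have c0: "lift_of (?c 0) (\<theta> i)" using q(1) i lf[of i] by (simp add: refines_def cyc_def[of p])
    have cK: "lift_of (?c K) (\<theta> (Suc i))" using lf refines_end[OF q(1) i] by simp
    have "\<theta> (i + 2) < \<theta> (i + length p)" "\<theta> (Suc i) < \<theta> (i + 2)"
      using n by (auto intro!: strict_monoD[OF sm])
    then have "\<theta> i \<in> {u..t}" "\<theta> (Suc i) \<in> {t..u + 1}" using per[of i] t by (auto simp: u_def)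
    moreover have "\<forall>r<K. d (?c r) (?c (Suc r)) < \<eta>"
    proof (intro allI impI)
      fix r assume "r < K"
      then have "K * i + r < K * Suc i" by simp
      also have "\<dots> \<le> length q" using q(1) i unfolding refines_def by (metis Suc_leI mult_le_mono2)
      finally show "d (?c r) (?c (Suc r)) < \<eta>" using q(2) by fastforce
    qed
    ultimately obtain r where r: "r \<le> K" "\<rho> (\<alpha> (?c r)) u < \<zeta> \<or> \<rho> (\<alpha> (?c r)) t < \<zeta>"
      using \<eta>(2)[of ?c "\<theta> i" K "\<theta> (Suc i)"] c0 cK by auto
    define k where "k = (i + 2) mod length p"
    have k: "k < length p" "k \<noteq> i" "k \<noteq> Suc i mod length p"
    proof -
      consider "i + 2 < length p" | "i + 2 = length p" | "Suc i = length p" using i by linarith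
      then have "k < length p \<and> k \<noteq> i \<and> k \<noteq> Suc i mod length p"
      proof cases
        case 3
        then have "k = 1" using n mod_add_self1[of "length p" 1] unfolding k_def by (metis add_2_eq_Suc' Suc_eq_plus1 add_Suc mod_less less_le_trans one_less_numeral_iff semiring_norm(76))
        then show ?thesis using 3 n by auto
      qed (use n in \<open>auto simp: k_def\<close>)
      then show "k < length p" "k \<noteq> i" "k \<noteq> Suc i mod length p" by auto
    qed
    have "lift_of (p ! k) u"
      using lift_shift[OF lf[of "i + 2"], of "-1"] by (simp add: u_def k_def cyc_def)
    then have "d (?c r) (p ! k) = \<rho> (\<alpha> (?c r)) u"
      unfolding d_rho using lift_rho rho_sym by metis
    then have "\<not> \<rho> (\<alpha> (?c r)) u < \<zeta>" using refines_far[OF q(1) n i k r(1)] z by simp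
    then show ?thesis using r by blast
  qed
  then show ?thesis using \<eta>(1) by blast
qed

text \<open>Pieces of fine refinements come arbitrarily close to every point of the arc, so their
  strict bounds hold weakly for arcs. For two arcs a single refinement has to be fine enough for
  both.\<close>

lemma good_arcs:
  assumes l: "lifts p \<theta>" and good: "good_chain d p \<delta> \<epsilon>" and "0 < \<delta>"
    and i: "i < length p" and t: "t \<in> {\<theta> i..\<theta> (Suc i)}"
  shows good_arc_close: "\<rho> (\<theta> i) t \<le> \<epsilon>"
    and good_arc_apart: "\<lbrakk>k < length p; t' \<in> {\<theta> k..\<theta> (Suc k)}; \<not> cyc_near (length p) i k\<rbrakk> \<Longrightarrow> \<delta> \<le> \<rho> t t'"
proof -
  have n: "4 \<le> length p" using good by (simp add: good_chain_def)
  have get: "\<exists>K q. refines d p \<delta> \<epsilon> K q \<and> (\<forall>j<length q. d (cyc q j) (cyc q (Suc j)) < \<eta>)" if "0 < \<eta>" for \<eta>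
  proof -
    obtain e where e: "1 / Suc e < \<eta>" using nat_approx_posE[OF \<open>0 < \<eta>\<close>] by auto
    then show ?thesis using good unfolding good_chain_def by (meson less_trans)
  qed
  show "\<rho> (\<theta> i) t \<le> \<epsilon>"
  proof (rule field_le_epsilon)
    fix e :: real assume "0 < e"
    then have z: "0 < min e \<delta>" "min e \<delta> \<le> \<delta>" using \<open>0 < \<delta>\<close> by auto
    obtain K q r where q: "refines d p \<delta> \<epsilon> K q" "r \<le> K" "\<rho> (\<alpha> (cyc q (K * i + r))) t < min e \<delta>"
      using tile_hits[OF l n i t z, of \<epsilon>] get by metis
    have "d (p ! i) (cyc q (K * i + r)) < \<epsilon>" using q i unfolding refines_def by blast
    moreover have "\<rho> (\<theta> i) t = \<rho> (\<alpha> (p ! i)) t"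
      using l i by (intro lift_rho) (auto simp: lifts_def cyc_def dest!: spec[of _ i])
    ultimately show "\<rho> (\<theta> i) t \<le> \<epsilon> + e"
      using q(3) rho_tri[of "\<alpha> (p ! i)" t "\<alpha> (cyc q (K * i + r))"] unfolding d_rho by simp
  qed
  show "\<delta> \<le> \<rho> t t'" if k: "k < length p" and t': "t' \<in> {\<theta> k..\<theta> (Suc k)}" and nk: "\<not> cyc_near (length p) i k"
  proof (rule field_le_epsilon)
    fix e :: real assume "0 < e"
    then have z: "0 < min (e/2) \<delta>" "min (e/2) \<delta> \<le> \<delta>" using \<open>0 < \<delta>\<close> by auto
    obtain \<eta> where \<eta>: "0 < \<eta>" "\<And>K q. refines d p \<delta> \<epsilon> K q \<Longrightarrow> (\<forall>j<length q. d (cyc q j) (cyc q (Suc j)) < \<eta>) \<Longrightarrow>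
           (\<exists>r\<le>K. \<rho> (\<alpha> (cyc q (K * i + r))) t < min (e/2) \<delta>)"
      using tile_hits[OF l n i t z, of \<epsilon>] by metis
    obtain \<eta>' where \<eta>': "0 < \<eta>'" "\<And>K q. refines d p \<delta> \<epsilon> K q \<Longrightarrow> (\<forall>j<length q. d (cyc q j) (cyc q (Suc j)) < \<eta>') \<Longrightarrow>
           (\<exists>r\<le>K. \<rho> (\<alpha> (cyc q (K * k + r))) t' < min (e/2) \<delta>)"
      using tile_hits[OF l n k t' z, of \<epsilon>] by metis
    obtain K q where q: "refines d p \<delta> \<epsilon> K q" "\<forall>j<length q. d (cyc q j) (cyc q (Suc j)) < min \<eta> \<eta>'"
      using get[of "min \<eta> \<eta>'"] \<eta>(1) \<eta>'(1) by auto
    obtain r r' where r: "r \<le> K" "\<rho> (\<alpha> (cyc q (K * i + r))) t < min (e/2) \<delta>"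
      "r' \<le> K" "\<rho> (\<alpha> (cyc q (K * k + r'))) t' < min (e/2) \<delta>"
      using \<eta>(2)[OF q(1)] \<eta>'(2)[OF q(1)] q(2) by auto
    have "\<delta> < d (cyc q (K * i + r)) (cyc q (K * k + r'))"
      using q(1) r i k nk unfolding refines_def by blast
    moreover have "\<rho> (\<alpha> (cyc q (K * i + r))) t < e / 2" "\<rho> (\<alpha> (cyc q (K * k + r'))) t' < e / 2"
      using r(2,4) by auto
    ultimately show "\<delta> \<le> \<rho> t t' + e"
      using rho_quad[of "\<alpha> (cyc q (K * i + r))" "\<alpha> (cyc q (K * k + r'))" t t'] unfolding d_rho by linarith
  qed
qed

end

section \<open>Good chains obtained by subdividing lifted chains\<close>

context circle_metric
begin

lemma lifts_less: "lifts p \<theta> \<Longrightarrow> i < j \<Longrightarrow> \<theta> i < \<theta> j"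
  by (auto simp: lifts_def strict_mono_def)

lemma lifts_le: "lifts p \<theta> \<Longrightarrow> i \<le> j \<Longrightarrow> \<theta> i \<le> \<theta> j"
  by (auto simp: lifts_def strict_mono_less_eq)

lemma lifts_locate:
  assumes "lifts p \<theta>" "\<theta> 0 \<le> t" "t < \<theta> n"
  shows "\<exists>j<n. \<theta> j \<le> t \<and> t < \<theta> (Suc j)"
  using assms(3)
proof (induction n)
  case (Suc n)
  then show ?case by (cases "t < \<theta> n") (auto simp: less_Suc_eq)
qed (use assms(2) in simp)

text \<open>Every arc is cut into \<open>K\<close> equal steps starting at \<open>W j\<close>, and
  density provides a lifted point in the first half of each step. The order is thereby preserved,
  and a gap is at most two steps, each of length at most \<open>1 / K\<close> because an arc is at
  most one turn long.\<close>

lemma lifts_refine: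
  assumes l: "lifts p \<theta>" and K: "1 \<le> K"
  shows "\<exists>q \<phi>. lifts q \<phi> \<and> length q = K * length p \<and> (\<forall>i. \<phi> (K * i) = \<theta> i) \<and>
           (\<forall>j. \<phi> (Suc j) - \<phi> j \<le> 2 / K)"
proof -
  define n where "n = length p"
  have n: "0 < n" using l by (simp add: n_def lifts_def)
  have per: "\<theta> (j + n) = \<theta> j + 1" for j using l by (simp add: n_def lifts_def)
  define L where "L = (\<lambda>j. \<theta> (Suc (j div K)) - \<theta> (j div K))"
  define W where "W = (\<lambda>j. \<theta> (j div K) + L j * real (j mod K) / K)"
  have K0: "0 < real K" "0 < K" using K by auto
  have L0: "0 < L j" for j unfolding L_def using lifts_less[OF l, of "j div K" "Suc (j div K)"] by simp
  have L1: "L j \<le> 1" for j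
    unfolding L_def using lifts_le[OF l, of "Suc (j div K)" "j div K + n"] n per[of "j div K"] by simp
  have Wper: "W (j + K * n) = W j + 1" "L (j + K * n) = L j" for j
  proof -
    have "(j + K * n) div K = j div K + n" "(j + K * n) mod K = j mod K" using K0 by simp_all
    then show "W (j + K * n) = W j + 1" "L (j + K * n) = L j"
      using per[of "j div K"] per[of "Suc (j div K)"] by (simp_all add: W_def L_def)
  qed
  have WperM: "W (j + c * (K * n)) = W j + c \<and> L (j + c * (K * n)) = L j" for j c
  proof (induction c)
    case (Suc c)
    have "j + Suc c * (K * n) = (j + c * (K * n)) + K * n" by simp
    then show ?case using Wper[of "j + c * (K * n)"] Suc by (simp only:) simp
  qed simp
  have WSuc: "W (Suc j) = W j + L j / K" for j
  proof (cases "Suc (j mod K) = K")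
    case True
    then have e: "Suc j div K = Suc (j div K)" "Suc j mod K = 0" by (simp_all add: div_Suc mod_Suc)
    have r: "real (j mod K) + 1 = K" using True by linarith
    have "W j + L j / K = \<theta> (j div K) + L j * (real (j mod K) + 1) / K"
      by (simp add: W_def add_divide_distrib distrib_left)
    also have "\<dots> = \<theta> (j div K) + L j" using K0 by (simp add: r)
    finally show ?thesis using e K0 unfolding W_def by (simp add: L_def)
  next
    case False
    then have "Suc j div K = j div K" "Suc j mod K = Suc (j mod K)"
      by (simp_all add: div_Suc mod_Suc)
    then show ?thesis by (simp add: W_def L_def add_divide_distrib distrib_left)
  qed
  have "\<exists>b m. W j \<le> b \<and> b < W j + L j / (2 * K) \<and> lift_of m b \<and> (j mod K = 0 \<longrightarrow> b = W j)" for j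
  proof (cases "j mod K = 0")
    case True
    then have "lift_of (cyc p (j div K)) (W j)" using l by (simp add: W_def lifts_def)
    then show ?thesis using L0[of j] K0 by (intro exI[of _ "W j"] exI[of _ "cyc p (j div K)"]) auto
  next
    case False
    have "W j < W j + L j / (2 * K)" using L0[of j] K0 by simp
    from dense[OF this] obtain m k where "W j < \<alpha> m + of_int k" "\<alpha> m + of_int k < W j + L j / (2 * K)" by blast
    then show ?thesis using False
      by (intro exI[of _ "\<alpha> m + of_int k"] exI[of _ m]) (auto simp: lift_of_def)
  qed
  then obtain b m where b: "\<And>j. W j \<le> b j" "\<And>j. b j < W j + L j / (2 * K)" "\<And>j. lift_of (m j) (b j)"
     "\<And>j. j mod K = 0 \<Longrightarrow> b j = W j" by metis
  \<comment> \<open>Points are chosen independently for each \<open>j\<close>; only the choices in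
    one period are kept and continued by integer shifts, so that \<open>\<phi>\<close> fits the
    cyclic list \<open>q\<close>.\<close>
  define \<phi> where "\<phi> = (\<lambda>j. b (j mod (K * n)) + real (j div (K * n)))"
  define q where "q = map m [0..<K * n]"
  have Kn: "0 < K * n" using K0 n by simp
  have dec: "W j = W (j mod (K * n)) + real (j div (K * n))" "L j = L (j mod (K * n))" for j
    using WperM[of "j mod (K * n)" "j div (K * n)"] unfolding mod_div_mult_eq by auto
  have lo: "W j \<le> \<phi> j" and hi: "\<phi> j < W j + L j / (2 * K)" for j
    using b(1)[of "j mod (K * n)"] b(2)[of "j mod (K * n)"] dec[of j] by (simp_all add: \<phi>_def)
  have half: "L j / (2 * K) = L j / K / 2" "0 < L j / K" "L j / K \<le> 1 / K" for j
    using L0[of j] L1[of j] K0 by (auto intro: divide_right_mono)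
  have step: "\<phi> j < \<phi> (Suc j)" for j
    using hi[of j] lo[of "Suc j"] WSuc[of j] half[of j] by linarith
  have gap: "\<phi> (Suc j) - \<phi> j \<le> 2 / K" for j
  proof -
    have "\<phi> (Suc j) - \<phi> j \<le> 1 / K + 1 / K"
      using lo[of j] hi[of "Suc j"] WSuc[of j] half[of j] half[of "Suc j"] by linarith
    then show ?thesis by simp
  qed
  have "lifts q \<phi>" unfolding lifts_def
  proof (intro conjI allI)
    show "q \<noteq> []" using Kn by (auto simp: q_def)
    show "strict_mono \<phi>" using step by (rule strict_monoI_Suc)
    show "\<phi> (j + length q) = \<phi> j + 1" for j using Kn by (simp add: \<phi>_def q_def)
    show "lift_of (cyc q j) (\<phi> j)" for j
    proof -
      have "cyc q j = m (j mod (K * n))" using Kn by (simp add: cyc_def q_def)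
      then show ?thesis
        using lift_shift[OF b(3)[of "j mod (K * n)"], of "int (j div (K * n))"] by (simp add: \<phi>_def)
    qed
  qed
  moreover have "\<phi> (K * i) = \<theta> i" for i
  proof -
    have "(K * i) mod (K * n) mod K = 0" by (simp add: mod_mod_cancel)
    then have "\<phi> (K * i) = W (K * i)" using b(4) dec[of "K * i"] by (simp add: \<phi>_def)
    also have "\<dots> = \<theta> i" using K0 by (simp add: W_def)
    finally show ?thesis .
  qed
  ultimately show ?thesis using gap by (intro exI[of _ q] exI[of _ \<phi>]) (auto simp: q_def n_def)
qed

lemma lifts_distinct:
  assumes "lifts p \<theta>" shows "distinct p"
  unfolding distinct_conv_nth
proof (intro allI impI)
  have *: "p ! i \<noteq> p ! j" if "i < j" "j < length p" for i j
  proof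
    assume e: "p ! i = p ! j"
    have "lift_of (p ! i) (\<theta> i)" "lift_of (p ! j) (\<theta> j)"
      using assms that unfolding lifts_def cyc_def by (metis less_trans mod_less)+
    then have "\<theta> j - \<theta> i \<in> \<int>" using lift_diff e by simp
    moreover have "\<theta> i < \<theta> j" "\<theta> j < \<theta> (i + length p)" using that by (auto intro!: lifts_less[OF assms])
    moreover have "\<theta> (i + length p) = \<theta> i + 1" using assms by (simp add: lifts_def)
    ultimately show False using Ints_nonzero_abs_ge1[of "\<theta> j - \<theta> i"] by auto
  qed
  show "i < length p \<Longrightarrow> j < length p \<Longrightarrow> i \<noteq> j \<Longrightarrow> p ! i \<noteq> p ! j" for i j
    using *[of i j] *[of j i] by (cases i j rule: linorder_cases) auto
qed

lemma arcs_disjoint: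
  assumes l: "lifts p \<theta>" and ik: "i < length p" "k < length p" "\<not> cyc_near (length p) i k"
    and st: "s \<in> {\<theta> i..\<theta> (Suc i)}" "t \<in> {\<theta> k..\<theta> (Suc k)}"
  shows "s - t \<notin> \<int>"
proof -
  have *: "0 < t - s \<and> t - s < 1"
    if "i < k" and ik: "i < length p" "k < length p" "\<not> cyc_near (length p) i k"
     and st: "s \<in> {\<theta> i..\<theta> (Suc i)}" "t \<in> {\<theta> k..\<theta> (Suc k)}" for i k s t
  proof -
    have "Suc i \<noteq> k" "Suc k \<noteq> i + length p"
    proof -
      show "Suc i \<noteq> k" using ik by (auto simp: cyc_near_def)
      show "Suc k \<noteq> i + length p"
      proof
        assume "Suc k = i + length p"
        then have "i mod length p = Suc k mod length p" by simp
        then show False using ik by (simp add: cyc_near_def)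
      qed
    qed
    then have "\<theta> (Suc i) < \<theta> k" "\<theta> (Suc k) < \<theta> (i + length p)"
      using that by (auto intro!: lifts_less[OF l])
    moreover have "\<theta> (i + length p) = \<theta> i + 1" using l by (simp add: lifts_def)
    ultimately show ?thesis using st by auto
  qed
  have "i \<noteq> k" using ik by (auto simp: cyc_near_def)
  then have "0 < \<bar>s - t\<bar> \<and> \<bar>s - t\<bar> < 1"
    using *[OF _ ik st] *[OF _ ik(2,1) _ st(2,1)] ik(3) cyc_near_sym[of "length p" i k]
    by (cases i k rule: linorder_cases) auto
  then show ?thesis using Ints_nonzero_abs_ge1[of "s - t"] by auto
qed

text \<open>Non-adjacent arcs have no common point on the circle, and the finitely many products of
  two such arcs form a compact set on which \<open>\<rho>\<close> is positive.\<close>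

lemma arcs_apart:
  assumes l: "lifts p \<theta>"
  shows "\<exists>e>0. \<forall>i<length p. \<forall>k<length p. \<not> cyc_near (length p) i k \<longrightarrow>
     (\<forall>s\<in>{\<theta> i..\<theta> (Suc i)}. \<forall>t\<in>{\<theta> k..\<theta> (Suc k)}. e \<le> \<rho> s t)"
proof -
  define I where "I = {(i, k). i < length p \<and> k < length p \<and> \<not> cyc_near (length p) i k}"
  have fin: "finite I"
    by (rule finite_subset[of _ "{..<length p} \<times> {..<length p}"]) (auto simp: I_def)
  define A where "A = (\<Union>(i,k)\<in>I. {\<theta> i..\<theta> (Suc i)} \<times> {\<theta> k..\<theta> (Suc k)})"
  have "compact A" unfolding A_def by (intro compact_UN fin) (auto intro: compact_Times)
  moreover have "0 < \<rho> (fst x) (snd x)" if "x \<in> A" for x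
    using that arcs_disjoint[OF l] unfolding A_def I_def by (intro rho_pos) auto
  ultimately obtain e where e: "0 < e" "\<forall>x\<in>A. e \<le> \<rho> (fst x) (snd x)"
    using compact_pos_lower_bound[OF _ rho_cont] by blast
  have "e \<le> \<rho> s t" if "i < length p" "k < length p" "\<not> cyc_near (length p) i k"
     "s \<in> {\<theta> i..\<theta> (Suc i)}" "t \<in> {\<theta> k..\<theta> (Suc k)}" for i k s t
  proof -
    have "(s, t) \<in> A" unfolding A_def I_def using that by auto
    then show ?thesis using e by force
  qed
  then show ?thesis using e(1) by blast
qed

lemma lifts_imp_refines:
  assumes l: "lifts p \<theta>" and lq: "lifts q \<phi>" and len: "length q = K * length p" and K: "1 \<le> K"
    and sub: "\<And>i. \<phi> (K * i) = \<theta> i"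
    and close: "\<And>i t. i < length p \<Longrightarrow> t \<in> {\<theta> i..\<theta> (Suc i)} \<Longrightarrow> \<rho> (\<theta> i) t < \<epsilon>"
    and apart: "\<And>i k s t. i < length p \<Longrightarrow> k < length p \<Longrightarrow> \<not> cyc_near (length p) i k \<Longrightarrow>
       s \<in> {\<theta> i..\<theta> (Suc i)} \<Longrightarrow> t \<in> {\<theta> k..\<theta> (Suc k)} \<Longrightarrow> \<delta> < \<rho> s t"
  shows "refines d p \<delta> \<epsilon> K q"
proof -
  have lf: "lift_of (p ! i) (\<theta> i)" if "i < length p" for i
    using l that unfolding lifts_def cyc_def by (metis mod_less)
  have lg: "lift_of (cyc q j) (\<phi> j)" for j using lq unfolding lifts_def by blast
  have arc: "\<phi> (K * i + r) \<in> {\<theta> i..\<theta> (Suc i)}" if "r \<le> K" for i r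
    using lifts_le[OF lq, of "K * i" "K * i + r"] lifts_le[OF lq, of "K * i + r" "K * Suc i"] that
    by (simp only: sub) auto
  show ?thesis unfolding refines_def
  proof (intro conjI allI impI)
    show "cyc q (K * i) = p ! i" if "i < length p" for i
      using lift_unique[OF lg[of "K * i"]] lf[OF that] sub[of i] by simp
    show "d (p ! i) (cyc q (K * i + r)) < \<epsilon>" if "i < length p" "r \<le> K" for i r
      using close[OF that(1) arc[OF that(2)]] lift_d[OF lf[OF that(1)] lg[of "K * i + r"]] by simp
    show "\<delta> < d (cyc q (K * i + r)) (cyc q (K * k + r'))"
      if "i < length p" "k < length p" "\<not> cyc_near (length p) i k" "r \<le> K" "r' \<le> K" for i k r r'
      using apart[OF that(1-3) arc[OF that(4)] arc[OF that(5)]] lift_d[OF lg lg] by simp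
  qed (rule len)
qed

lemma mesh_exists:
  assumes "0 < e" shows "\<exists>N. \<forall>K\<ge>N. \<forall>s t. \<bar>s - t\<bar> \<le> 2 / real K \<longrightarrow> 1 \<le> K \<longrightarrow> \<rho> s t < e"
proof -
  obtain \<mu> where \<mu>: "0 < \<mu>" "\<And>s t. \<bar>s - t\<bar> < \<mu> \<Longrightarrow> \<rho> s t < e" using rho_uniform[OF assms] by blast
  obtain N where N: "2 / \<mu> < real N" using reals_Archimedean2 by blast
  have "\<rho> s t < e" if "N \<le> K" "1 \<le> K" "\<bar>s - t\<bar> \<le> 2 / real K" for K s t
  proof -
    have "2 / \<mu> < real K" using N that(1) by linarith
    then have "2 / real K < \<mu>" using \<mu>(1) that(2) by (simp add: field_simps)
    then show ?thesis using \<mu>(2)[of s t] that(3) by linarith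
  qed
  then show ?thesis by blast
qed

text \<open>The separation comes from \<open>arcs_apart\<close>, and the refinements of small mesh
  arise by subdividing the lift: they run inside the arcs and inherit all bounds from them.\<close>

lemma fine_good:
  assumes l: "lifts p \<theta>" and n: "4 \<le> length p"
    and fine: "\<And>j s t. s \<in> {\<theta> j..\<theta> (Suc j)} \<Longrightarrow> t \<in> {\<theta> j..\<theta> (Suc j)} \<Longrightarrow> \<rho> s t < \<epsilon>"
  shows "\<exists>a. good_chain d p (1 / real (Suc a)) \<epsilon>"
proof -
  have per: "\<theta> (j + length p) = \<theta> j + 1" and lf: "lift_of (cyc p j) (\<theta> j)" for j
    using l by (auto simp: lifts_def)
  obtain e where e: "0 < e" "\<And>i k s t. i < length p \<Longrightarrow> k < length p \<Longrightarrow> \<not> cyc_near (length p) i k \<Longrightarrow>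
     s \<in> {\<theta> i..\<theta> (Suc i)} \<Longrightarrow> t \<in> {\<theta> k..\<theta> (Suc k)} \<Longrightarrow> e \<le> \<rho> s t"
    using arcs_apart[OF l] by blast
  obtain a where a: "1 / real (Suc a) < e" using nat_approx_posE[OF e(1)] by auto
  have "good_chain d p (1 / real (Suc a)) \<epsilon>"
    unfolding good_chain_def
  proof (intro conjI allI)
    show "distinct p" by (rule lifts_distinct[OF l])
    show "\<exists>i<length p. d x (p ! i) < \<epsilon>" for x
    proof -
      obtain t where t: "lift_of x t" "\<theta> 0 \<le> t" "t < \<theta> 0 + 1" using lift_exists by blast
      then obtain j where j: "j < length p" "\<theta> j \<le> t" "t < \<theta> (Suc j)"
        using lifts_locate[OF l, of t "length p"] per[of 0] by auto
      have "d x (cyc p j) = \<rho> t (\<theta> j)" by (rule lift_d[OF t(1) lf])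
      also have "\<dots> < \<epsilon>" using j by (intro fine[of _ j]) auto
      finally show ?thesis using j by (auto simp: cyc_def)
    qed
    show "\<exists>K q. 1 \<le> K \<and> refines d p (1 / real (Suc a)) \<epsilon> K q \<and>
         (\<forall>j<length q. d (cyc q j) (cyc q (Suc j)) < 1 / real (Suc m))" for m
    proof -
      obtain N where N: "\<forall>K\<ge>N. \<forall>s t. \<bar>s - t\<bar> \<le> 2 / real K \<longrightarrow> 1 \<le> K \<longrightarrow> \<rho> s t < 1 / real (Suc m)"
        using mesh_exists[of "1 / real (Suc m)"] by auto
      define K where "K = Suc N"
      have K: "1 \<le> K" by (simp add: K_def)
      obtain q \<phi> where q: "lifts q \<phi>" "length q = K * length p" "\<And>i. \<phi> (K * i) = \<theta> i"
           "\<And>j. \<phi> (Suc j) - \<phi> j \<le> 2 / K"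
        using lifts_refine[OF l K] by blast
      have "refines d p (1 / real (Suc a)) \<epsilon> K q"
      proof (rule lifts_imp_refines[OF l q(1,2) K q(3)])
        show "\<rho> (\<theta> i) t < \<epsilon>" if "t \<in> {\<theta> i..\<theta> (Suc i)}" for i t
          using that by (intro fine[of _ i]) auto
        show "1 / real (Suc a) < \<rho> s t" if "i < length p" "k < length p" "\<not> cyc_near (length p) i k"
           "s \<in> {\<theta> i..\<theta> (Suc i)}" "t \<in> {\<theta> k..\<theta> (Suc k)}" for i k s t
          using e(2)[OF that] a by linarith
      qed
      moreover have "d (cyc q j) (cyc q (Suc j)) < 1 / real (Suc m)" for j
      proof -
        have "d (cyc q j) (cyc q (Suc j)) = \<rho> (\<phi> j) (\<phi> (Suc j))"
          using q(1) by (intro lift_d) (auto simp: lifts_def)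
        also have "\<bar>\<phi> j - \<phi> (Suc j)\<bar> \<le> 2 / real K"
          using q(4)[of j] lifts_less[OF q(1), of j "Suc j"] by simp
        then have "\<rho> (\<phi> j) (\<phi> (Suc j)) < 1 / real (Suc m)"
          using N K unfolding K_def by (meson le_SucI order_refl)
        finally show ?thesis .
      qed
      ultimately show ?thesis using K by blast
    qed
  qed (rule n)
  then show ?thesis by blast
qed

text \<open>The condition \<open>4 \<le> K\<close> gives \<open>q\<close> four points even if
  \<open>p\<close> has just one. It is met by choosing \<open>N = 4\<close>.\<close>

lemma fine_refinement:
  assumes l: "lifts p \<theta>" and "0 < e"
  shows "\<exists>K q \<phi> a. N \<le> K \<and> 1 \<le> K \<and> lifts q \<phi> \<and> length q = K * length p \<and> (\<forall>i. \<phi> (K * i) = \<theta> i) \<and>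
     (4 \<le> K \<longrightarrow> good_chain d q (1 / real (Suc a)) e)"
proof -
  obtain N' where N': "\<And>K s t. N' \<le> K \<Longrightarrow> \<bar>s - t\<bar> \<le> 2 / real K \<Longrightarrow> 1 \<le> K \<Longrightarrow> \<rho> s t < e"
    using mesh_exists[OF assms(2)] by blast
  define K where "K = N' + N + 1"
  have K: "N' \<le> K" "N \<le> K" "1 \<le> K" by (auto simp: K_def)
  obtain q \<phi> where q: "lifts q \<phi>" "length q = K * length p" "\<And>i. \<phi> (K * i) = \<theta> i"
       "\<And>j. \<phi> (Suc j) - \<phi> j \<le> 2 / K"
    using lifts_refine[OF l K(3)] by blast
  have "\<exists>a. 4 \<le> K \<longrightarrow> good_chain d q (1 / real (Suc a)) e"
  proof (cases "4 \<le> K")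
    case True
    have "0 < length p" using l by (simp add: lifts_def)
    then have "4 \<le> length q" using True q(2) by (metis le_trans mult_le_mono2 Suc_leI mult.right_neutral One_nat_def)
    moreover have "\<rho> s t < e" if "s \<in> {\<phi> j..\<phi> (Suc j)}" "t \<in> {\<phi> j..\<phi> (Suc j)}" for j s t
    proof (rule N'[OF K(1) _ K(3)])
      show "\<bar>s - t\<bar> \<le> 2 / real K" using q(4)[of j] that unfolding atLeastAtMost_iff by linarith
    qed
    ultimately show ?thesis using fine_good[OF q(1)] by blast
  qed simp
  then show ?thesis using q K by blast
qed

lemma good_chain_exists: "\<exists>p a. good_chain d p (1 / Suc a) (1 / Suc 0)"
proof -
  \<comment> \<open>One point together with a full turn is already a lifted chain, and subdividing
    it produces a good one.\<close>
  have "lifts [0] (\<lambda>j. \<alpha> 0 + real j)"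
    by (auto simp: lifts_def cyc_def lift_of_def intro: strict_monoI)
  from fine_refinement[OF this, of "1 / Suc 0" 4] show ?thesis by (auto simp del: of_nat_Suc)
qed

lemma half_less: "0 < x \<Longrightarrow> x / 2 < (x::real)"
  by simp

text \<open>By \<open>good_arcs\<close> the arcs of a good chain obey its bounds weakly, so every
  chain running along these arcs obeys the relaxed bounds strictly. It may therefore be taken as
  fine as desired.\<close>

lemma extension_exists:
  assumes l: "lifts p \<theta>" and good: "good_chain d p (1 / Suc a) (1 / Suc b)"
  shows "\<exists>q a' b' K. good_extension d p a b q a' b' K"
proof -
  define \<mu> where "\<mu> = min (1 / Suc b / 2) (1 / Suc a / 32)"
  have "0 < \<mu>" by (simp add: \<mu>_def)
  then obtain b' where b': "1 / real (Suc b') < \<mu>" using nat_approx_posE by auto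
  have "0 < 1 / real (Suc b')" by simp
  from fine_refinement[OF l this, of 4]
  obtain K q \<phi> a' where q: "4 \<le> K" "1 \<le> K" "lifts q \<phi>" "length q = K * length p" "\<And>i. \<phi> (K * i) = \<theta> i"
     "good_chain d q (1 / real (Suc a')) (1 / real (Suc b'))" by blast
  have "refines d p (1 / Suc a / 2) (2 / Suc b) K q"
  proof (rule lifts_imp_refines[OF l q(3,4,2,5)])
    show "\<rho> (\<theta> i) t < 2 / Suc b" if "i < length p" "t \<in> {\<theta> i..\<theta> (Suc i)}" for i t
    proof -
      have "\<rho> (\<theta> i) t \<le> 1 / Suc b" by (rule good_arc_close[OF l good _ that]) simp
      also have "\<dots> < 2 / Suc b" by (rule divide_strict_right_mono) auto
      finally show ?thesis .
    qed
    show "1 / Suc a / 2 < \<rho> s t" if "i < length p" "k < length p" "\<not> cyc_near (length p) i k"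
           "s \<in> {\<theta> i..\<theta> (Suc i)}" "t \<in> {\<theta> k..\<theta> (Suc k)}" for i k s t
    proof -
      have "0 < 1 / real (Suc a)" by simp
      then have "1 / Suc a / 2 < 1 / real (Suc a)" by (rule half_less)
      also have "1 / Suc a \<le> \<rho> s t" by (rule good_arc_apart[OF l good _ that(1,4,2,5,3)]) simp
      finally show ?thesis .
    qed
  qed
  then show ?thesis unfolding good_extension_def using q b' \<mu>_def
    by (intro exI[of _ q] exI[of _ a'] exI[of _ b'] exI[of _ K]) auto
qed

text \<open>No two points of a good chain separate two consecutive others. Together with the
  orientation of the first three points this determines the cyclic order of all points, by induction
  along the chain.\<close>

lemma sorted_lifts:
  assumes good: "good_chain d p \<delta> \<epsilon>" and "0 < \<delta>"
    and ord: "frac (\<alpha> (p ! 1) - \<alpha> (p ! 0)) < frac (\<alpha> (p ! 2) - \<alpha> (p ! 0))"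
  shows "\<exists>\<theta>. lifts p \<theta>"
proof -
  define n where "n = length p"
  have n: "4 \<le> n" "distinct p" using good by (auto simp: good_chain_def n_def)
  define \<beta> where "\<beta> = (\<lambda>i. frac (\<alpha> (p ! i) - \<alpha> (p ! 0)))"
  have b01: "0 \<le> \<beta> i" "\<beta> i < 1" for i by (auto simp: \<beta>_def frac_lt_1)
  have b0: "\<beta> 0 = 0" by (simp add: \<beta>_def)
  have lf: "lift_of (p ! i) (\<alpha> (p ! 0) + \<beta> i + of_int k)" for i k
  proof -
    have "\<alpha> (p ! 0) + \<beta> i + of_int k - \<alpha> (p ! i) = of_int (k - \<lfloor>\<alpha> (p ! i) - \<alpha> (p ! 0)\<rfloor>)"
      by (simp add: \<beta>_def frac_def)
    then show ?thesis unfolding lift_of_def by (metis Ints_of_int)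
  qed
  have lf0: "lift_of (p ! i) (\<alpha> (p ! 0) + \<beta> i)" and lf1: "lift_of (p ! i) (\<alpha> (p ! 0) + \<beta> i + 1)" for i
    using lf[of i 0] lf[of i 1] by auto
  have ne: "\<beta> i \<noteq> \<beta> j" if "i < n" "j < n" "i \<noteq> j" for i j
  proof
    assume "\<beta> i = \<beta> j"
    then have "p ! i = p ! j" using lift_unique[OF lf0[of i]] lf0[of j] by simp
    then show False using that n(2) by (simp add: nth_eq_iff_index_eq n_def)
  qed
  \<comment> \<open>In each of the four cases exactly one of two consecutive points lies between
    \<open>\<beta> k\<close> and \<open>\<beta> l\<close>. Adding 1 to some angles brings the four
    points into the order required by \<open>not_separated\<close>.\<close>
  have sep: "(\<beta> k < \<beta> i \<and> \<beta> i < \<beta> l) = (\<beta> k < \<beta> (Suc i) \<and> \<beta> (Suc i) < \<beta> l)"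
    if "Suc i < n" "k < n" "l < n" "\<beta> k < \<beta> l" "k \<noteq> i" "k \<noteq> Suc i" "l \<noteq> i" "l \<noteq> Suc i" for i k l
  proof (rule ccontr)
    have kl: "i < length p" "k < length p" "l < length p" "k \<noteq> Suc i mod length p" "l \<noteq> Suc i mod length p"
      using that by (auto simp: n_def)
    have c: "cyc p (Suc i) = p ! Suc i" using that by (simp add: cyc_def n_def)
    let ?A = "\<alpha> (p ! 0)"
    assume "\<not> ?thesis"
    then consider "\<beta> k < \<beta> i" "\<beta> i < \<beta> l" "\<beta> l \<le> \<beta> (Suc i)" | "\<beta> k < \<beta> i" "\<beta> i < \<beta> l" "\<beta> (Suc i) \<le> \<beta> k"
      | "\<beta> k < \<beta> (Suc i)" "\<beta> (Suc i) < \<beta> l" "\<beta> l \<le> \<beta> i" | "\<beta> k < \<beta> (Suc i)" "\<beta> (Suc i) < \<beta> l" "\<beta> i \<le> \<beta> k"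
      by linarith
    then show False
    proof cases
      case 1
      show ?thesis using not_separated[OF good \<open>0 < \<delta>\<close> kl(1-3) that(5) kl(4) that(7) kl(5), of "?A + \<beta> k" "?A + \<beta> l" "?A + \<beta> i" "?A + \<beta> (Suc i)"]
          1 b01(1)[of k] b01(2)[of "Suc i"] c lf0 by auto
    next
      case 2
      show ?thesis using not_separated[OF good \<open>0 < \<delta>\<close> kl(1-3) that(5) kl(4) that(7) kl(5), of "?A + \<beta> k" "?A + \<beta> l" "?A + \<beta> i" "?A + \<beta> (Suc i) + 1"]
          2 b01(2)[of l] b01(1)[of "Suc i"] c lf0 lf1 by auto
    next
      case 3
      show ?thesis using not_separated[OF good \<open>0 < \<delta>\<close> kl(1,3,2) that(7) kl(5) that(5) kl(4), of "?A + \<beta> l" "?A + \<beta> k + 1" "?A + \<beta> i" "?A + \<beta> (Suc i) + 1"]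
          3 b01(2)[of i] b01(1)[of k] c lf0 lf1 by auto
    next
      case 4
      show ?thesis using not_separated[OF good \<open>0 < \<delta>\<close> kl(1,3,2) that(7) kl(5) that(5) kl(4), of "?A + \<beta> l" "?A + \<beta> k + 1" "?A + \<beta> i + 1" "?A + \<beta> (Suc i) + 1"]
          4 b01(2)[of l] b01(1)[of i] c lf0 lf1 by auto
    qed
  qed
  have pos: "0 < \<beta> i" if "0 < i" "i < n" for i
    using ne[of i 0] that b0 b01(1)[of i] by auto
  have inc1: "\<beta> i < \<beta> (Suc i)" if "1 \<le> i" "Suc i < n" for i
    using that
  proof (induction i rule: dec_induct)
    case base
    then show ?case using ord by (simp add: \<beta>_def numeral_2_eq_2)
  next
    case (step i)
    then have IH: "\<beta> i < \<beta> (Suc i)" by simp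
    have i: "1 \<le> i" "Suc (Suc i) < n" using step by auto
    \<comment> \<open>Otherwise points 0 and \<open>i\<close> would separate points
      \<open>Suc i\<close> and \<open>Suc (Suc i)\<close>. Afterwards points 0 and
      \<open>Suc (Suc i)\<close> must not separate \<open>i\<close> and \<open>Suc i\<close>, which
      puts \<open>\<beta> (Suc i)\<close> below \<open>\<beta> (Suc (Suc i))\<close>.\<close>
    have "\<not> \<beta> (Suc (Suc i)) < \<beta> i"
      using sep[of "Suc i" 0 i] i IH pos[of i] pos[of "Suc (Suc i)"] b0 by auto
    then have "\<beta> i < \<beta> (Suc (Suc i))" using ne[of i "Suc (Suc i)"] i by auto
    then show ?case
      using sep[of i 0 "Suc (Suc i)"] i IH pos[of i] pos[of "Suc (Suc i)"] b0 by auto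
  qed
  have inc: "\<beta> i < \<beta> (Suc i)" if "Suc i < n" for i
    using inc1[of i] pos[of 1] b0 that by (cases "i = 0") auto
  define \<theta> where "\<theta> = (\<lambda>j. \<alpha> (p ! 0) + \<beta> (j mod n) + real (j div n))"
  have "lifts p \<theta>" unfolding lifts_def
  proof (intro conjI allI)
    show "p \<noteq> []" using n by (auto simp: n_def)
    show "\<theta> (j + length p) = \<theta> j + 1" for j using n unfolding n_def[symmetric] by (simp add: \<theta>_def)
    show "lift_of (cyc p j) (\<theta> j)" for j
      using lf[of "j mod n" "int (j div n)"] by (simp add: \<theta>_def cyc_def n_def)
    show "strict_mono \<theta>"
    proof (rule strict_monoI_Suc)
      fix j
      show "\<theta> j < \<theta> (Suc j)"
      proof (cases "Suc (j mod n) = n")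
        case True
        then show ?thesis using b01(2)[of "j mod n"] b0 by (simp add: \<theta>_def div_Suc mod_Suc)
      next
        case False
        moreover have "j mod n < n" using n by simp
        ultimately have "Suc (j mod n) < n" by linarith
        then show ?thesis using inc[of "j mod n"] False by (simp add: \<theta>_def div_Suc mod_Suc)
      qed
    qed
  qed
  then show ?thesis by blast
qed

text \<open>A good chain may run around the circle in either direction. Reflection of the line turns
  one orientation into the other, so that \<open>sorted_lifts\<close> covers both.\<close>

lemma reflected: "circle_metric d (\<lambda>s t. \<rho> (- s) (- t)) (\<lambda>m. - \<alpha> m)"
proof
  show "\<rho> (- s) (- t) = \<rho> (- t) (- s)" for s t by (rule rho_sym)
  show "\<rho> (- s) (- u) \<le> \<rho> (- s) (- t) + \<rho> (- t) (- u)" for s t u by (rule rho_tri)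
  show "\<rho> (- s) (- t) = 0 \<longleftrightarrow> s - t \<in> \<int>" for s t
    unfolding rho_zero by (metis Ints_minus minus_diff_eq minus_minus add_uminus_conv_diff diff_minus_eq_add add.commute)
  show "\<exists>\<eta>>0. \<forall>t. \<bar>t - s\<bar> < \<eta> \<longrightarrow> \<rho> (- s) (- t) < e" if e: "0 < e" for e s
  proof -
    obtain \<eta> where "0 < \<eta>" "\<And>t. \<bar>t - - s\<bar> < \<eta> \<Longrightarrow> \<rho> (- s) t < e" using rho_small[OF e, of "- s"] by blast
    then show ?thesis by (intro exI[of _ \<eta>]) (auto simp: abs_minus_commute)
  qed
  show "d a b = \<rho> (- (- \<alpha> a)) (- (- \<alpha> b))" for a b by (simp add: d_rho)
  show "\<exists>m k. s < - \<alpha> m + of_int k \<and> - \<alpha> m + of_int k < t" if st: "s < t" for s t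
  proof -
    obtain m k where "- t < \<alpha> m + of_int k" "\<alpha> m + of_int k < - s" using dense[of "-t" "-s"] st by auto
    then show ?thesis by (intro exI[of _ m] exI[of _ "-k"]) auto
  qed
qed (rule d_zero)

theorem circular: "circular d"
  unfolding circular_def
proof (intro conjI allI impI)
  show "\<exists>p a b. good_chain d p (1 / Suc a) (1 / Suc b)" using good_chain_exists by blast
next
  fix p a b assume good: "good_chain d p (1 / Suc a) (1 / Suc b)"
  interpret R: circle_metric d "\<lambda>s t. \<rho> (- s) (- t)" "\<lambda>m. - \<alpha> m" by (rule reflected)
  have n: "4 \<le> length p" "distinct p" using good by (auto simp: good_chain_def)
  define x y where "x = \<alpha> (p ! 1) - \<alpha> (p ! 0)" and "y = \<alpha> (p ! 2) - \<alpha> (p ! 0)"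
  have zero: "\<alpha> i - \<alpha> j \<in> \<int> \<Longrightarrow> i = j" for i j
    using d_zero[of i j] by (simp add: d_rho rho_zero)
  have ne: "p ! 1 \<noteq> p ! 0" "p ! 2 \<noteq> p ! 0" "p ! 2 \<noteq> p ! 1"
  proof -
    have "0 < length p" "1 < length p" "2 < length p" using n(1) by linarith+
    then show "p ! 1 \<noteq> p ! 0" "p ! 2 \<noteq> p ! 0" "p ! 2 \<noteq> p ! 1"
      using nth_eq_iff_index_eq[OF n(2)] by auto
  qed
  then have xy: "x \<notin> \<int>" "y \<notin> \<int>" using zero by (auto simp: x_def y_def)
  have "frac x \<noteq> frac y"
  proof
    assume "frac x = frac y"
    then have "y - x = of_int (\<lfloor>y\<rfloor> - \<lfloor>x\<rfloor>)" by (simp add: frac_def)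
    then have "y - x \<in> \<int>" by (metis Ints_of_int)
    then show False using zero[of "p ! 2" "p ! 1"] ne by (simp add: x_def y_def)
  qed
  then consider "frac x < frac y" | "frac (- x) < frac (- y)"
    using xy by (cases "frac x < frac y") (auto simp: frac_neg)
  then show "\<exists>q a' b' K. good_extension d p a b q a' b' K"
  proof cases
    case 1
    then obtain \<theta> where "lifts p \<theta>" using sorted_lifts[OF good] by (auto simp: x_def y_def)
    then show ?thesis by (rule extension_exists[OF _ good])
  next
    case 2
    then obtain \<theta> where "R.lifts p \<theta>" using R.sorted_lifts[OF good] by (auto simp: x_def y_def)
    then show ?thesis by (rule R.extension_exists[OF _ good])
  qed
qed

end

text \<open>The homeomorphism composed with the covering of the circle by the line gives
  \<open>\<gamma>\<close>; pulling the distance back along \<open>\<gamma>\<close> yields a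
  \<open>circle_metric\<close>.\<close>

theorem circle_imp_circular:
  assumes "Metric_space UNIV d"
    and hom: "Metric_space.completion_topology UNIV d homeomorphic_space top_of_set (sphere (0::complex) 1)"
  shows "circular d"
proof -
  interpret Metric_space UNIV d by fact
  interpret C: Metric_space completion_points completion_dist by (rule Metric_space_completion)
  let ?S = "top_of_set (sphere (0::complex) 1)"
  obtain f g where fg: "homeomorphic_maps ?S completion_topology f g"
    using hom homeomorphic_space_sym unfolding homeomorphic_space_def by blast
  have f: "continuous_map ?S C.mtopology f" and g: "continuous_map C.mtopology ?S g"
    and gf: "\<And>z. z \<in> sphere 0 1 \<Longrightarrow> g (f z) = z" and fg': "\<And>A. A \<in> completion_points \<Longrightarrow> f (g A) = A"
    using fg by (auto simp: homeomorphic_maps_def completion_topology_def)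
  have gin: "g A \<in> sphere 0 1" if "A \<in> completion_points" for A
    using g that by (auto simp: continuous_map_def Pi_iff)
  define \<gamma> where "\<gamma> = (\<lambda>t::real. f (cis (2 * pi * t)))"
  define \<rho> where "\<rho> = (\<lambda>s t. completion_dist (\<gamma> s) (\<gamma> t))"
  define \<alpha> where "\<alpha> = (\<lambda>m. Arg2pi (g (completion_embed m)) / (2 * pi))"
  have "continuous_map euclidean ?S (\<lambda>t::real. cis (2 * pi * t))"
    by (auto simp: continuous_map_in_subtopology intro!: continuous_intros)
  from continuous_map_compose[OF this f]
  have \<gamma>c: "continuous_map euclidean C.mtopology \<gamma>" by (simp add: o_def \<gamma>_def)
  then have \<gamma>in: "\<gamma> t \<in> completion_points" for t by (auto simp: continuous_map_def)
  have ein: "completion_embed m \<in> completion_points" for m by (simp add: completion_embed_in)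
  have \<gamma>\<alpha>: "\<gamma> (\<alpha> m) = completion_embed m" for m
    unfolding \<gamma>_def \<alpha>_def using cis_Arg2pi[OF gin[OF ein]] fg'[OF ein] by simp
  have inj: "\<gamma> s = \<gamma> t \<longleftrightarrow> s - t \<in> \<int>" for s t
  proof -
    have "\<gamma> s = \<gamma> t \<longleftrightarrow> cis (2 * pi * s) = cis (2 * pi * t)"
      unfolding \<gamma>_def using gf[of "cis (2 * pi * s)"] gf[of "cis (2 * pi * t)"]
      by (metis norm_cis mem_sphere_0)
    also have "\<dots> \<longleftrightarrow> (\<exists>n::int. 2 * pi * s = 2 * pi * t + 2 * pi * n)"
      unfolding sin_cos_eq_iff[symmetric] complex_eq_iff by (simp only: cis.sel conj_commute)
    also have "\<dots> \<longleftrightarrow> (\<exists>n::int. s - t = of_int n)"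
    proof -
      have "2 * pi * s = 2 * pi * t + 2 * pi * n \<longleftrightarrow> s - t = n" for n :: real
      proof -
        have "2 * pi * s = 2 * pi * t + 2 * pi * n \<longleftrightarrow> 2 * pi * s = 2 * pi * (t + n)"
          by (simp only: distrib_left)
        also have "\<dots> \<longleftrightarrow> s = t + n" by simp
        finally show ?thesis by linarith
      qed
      then show ?thesis by simp
    qed
    finally show ?thesis by (auto simp: Ints_def)
  qed
  have "circle_metric d \<rho> \<alpha>"
  proof
    show "\<rho> s t = \<rho> t s" for s t by (simp add: \<rho>_def C.commute)
    show "\<rho> s u \<le> \<rho> s t + \<rho> t u" for s t u unfolding \<rho>_def by (intro C.triangle \<gamma>in)
    show "\<rho> s t = 0 \<longleftrightarrow> s - t \<in> \<int>" for s t using inj C.zero[OF \<gamma>in \<gamma>in] by (simp add: \<rho>_def)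
    show dab: "d a b = \<rho> (\<alpha> a) (\<alpha> b)" for a b
      unfolding \<rho>_def \<gamma>\<alpha> by (simp add: completion_embed_isometric)
    show "d a b = 0 \<Longrightarrow> a = b" for a b using zero[of a b] by simp
    show "\<exists>\<eta>>0. \<forall>t. \<bar>t - s\<bar> < \<eta> \<longrightarrow> \<rho> s t < e" if e: "0 < e" for e s
    proof -
      have "s \<in> topspace euclidean" by simp
      then obtain U where "openin euclidean U" "s \<in> U" "\<forall>t\<in>U. \<gamma> t \<in> C.mball (\<gamma> s) e"
        using iffD1[OF C.continuous_map_to_metric \<gamma>c] e by meson
      then have U: "open U" "s \<in> U" "\<And>t. t \<in> U \<Longrightarrow> \<gamma> t \<in> C.mball (\<gamma> s) e"
        using open_openin[THEN iffD2] by blast+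
      then obtain \<eta> where "0 < \<eta>" "ball s \<eta> \<subseteq> U" using openE by blast
      then show ?thesis using U(3) by (intro exI[of _ \<eta>]) (auto simp: \<rho>_def dist_real_def abs_minus_commute subset_iff)
    qed
    show "\<exists>m k. s < \<alpha> m + of_int k \<and> \<alpha> m + of_int k < t" if "s < t" for s t
    proof -
      define w e where "w = (s + t) / 2" and "e = min ((t - s) / 2) (1/2)"
      \<comment> \<open>\<open>V\<close> is the open arc of radius \<open>e\<close> about
        \<open>w\<close>, written as the complement of a compact arc. Since it is open and nonempty,
        it contains a point of the dense set.\<close>
      define V where "V = completion_points - \<gamma> ` {w + e..w + 1 - e}"
      have e: "0 < e" using that by (auto simp: e_def)
      have e2: "e \<le> 1/2" "e \<le> (t - s) / 2"
        unfolding e_def by (rule min.cobounded2, rule min.cobounded1)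
      have "compactin C.mtopology (\<gamma> ` {w + e..w + 1 - e})"
        by (rule image_compactin[OF _ \<gamma>c]) (simp add: compactin_euclidean_iff)
      then have "closedin C.mtopology (\<gamma> ` {w + e..w + 1 - e})"
        by (rule compactin_imp_closedin[OF C.Hausdorff_space_mtopology])
      then have V: "openin C.mtopology V" using openin_diff[OF openin_topspace] by (auto simp: V_def)
      have "\<gamma> w \<in> V"
      proof -
        have "w - u \<notin> \<int>" if "u \<in> {w + e..w + 1 - e}" for u
          using that e e2 Ints_nonzero_abs_ge1[of "w - u"] by auto
        then show ?thesis using \<gamma>in inj by (auto simp: V_def)
      qed
      then obtain m where m: "completion_embed m \<in> V"
        using completion_embed_dense V \<gamma>in[of w] unfolding completion_topology_def
        by (metis (no_types, lifting) in_closure_of imageE)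
      obtain k where k: "w - e < \<alpha> m + of_int k" "\<alpha> m + of_int k \<le> w - e + 1"
      proof -
        define k where "k = \<lfloor>w - e - \<alpha> m\<rfloor> + 1"
        have "w - e < \<alpha> m + of_int k" "\<alpha> m + of_int k \<le> w - e + 1" unfolding k_def by linarith+
        then show thesis by (rule that)
      qed
      have "\<gamma> (\<alpha> m + of_int k) = completion_embed m" using inj[of "\<alpha> m + of_int k" "\<alpha> m"] \<gamma>\<alpha> by simp
      then have "\<alpha> m + of_int k \<notin> {w + e..w + 1 - e}" using m by (auto simp: V_def)
      then have "\<alpha> m + of_int k < w + e" using k by auto
      then have "s < \<alpha> m + of_int k \<and> \<alpha> m + of_int k < t"
        using k e e2 by (auto simp: w_def field_simps)
      then show ?thesis by blast
    qed
  qed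
  then show ?thesis by (rule circle_metric.circular)
qed

section \<open>Borel complexity of the copies of the circle\<close>

lemma bSigma0_Suc_Suc:
  "T \<in> bSigma0 (Suc (Suc n)) X \<longleftrightarrow>
     (\<exists>A :: nat \<Rightarrow> 'a set. (\<forall>i. A i \<in> bSigma0 (Suc n) X) \<and> T = (\<Union>i. topspace X - A i))"
  by (simp only: bSigma0.simps mem_Collect_eq) (simp only: conj_commute)

lemma bSigma0_family:
  assumes "\<And>i. A i \<in> bSigma0 (Suc (Suc n)) X"
  shows "\<exists>B :: 'i \<Rightarrow> nat \<Rightarrow> 'a set. \<forall>i. (\<forall>j. B i j \<in> bSigma0 (Suc n) X) \<and> A i = (\<Union>j. topspace X - B i j)"
  by (rule choice, rule allI, rule iffD1[OF bSigma0_Suc_Suc assms])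

text \<open>The complements taken at successive levels cancel in pairs, which leaves three
  alternating countable operations applied to open sets.\<close>

lemma bPi0_4_iff:
  "S \<in> bPi0 4 X \<longleftrightarrow> (\<exists>U :: nat \<Rightarrow> nat \<Rightarrow> nat \<Rightarrow> 'a set. (\<forall>n m l. openin X (U n m l)) \<and>
     S = topspace X \<inter> (\<Inter>n. \<Union>m. \<Inter>l. U n m l))"
proof
  have 4: "4 = Suc (Suc (Suc (Suc 0)))" by simp
  assume "S \<in> bPi0 4 X"
  then obtain T where T: "T \<in> bSigma0 (Suc (Suc (Suc (Suc 0)))) X" "S = topspace X - T"
    unfolding bPi0_def 4 by (elim CollectE exE conjE)
  from iffD1[OF bSigma0_Suc_Suc T(1)] obtain A :: "nat \<Rightarrow> 'a set"
    where A0: "(\<forall>n. A n \<in> bSigma0 (Suc (Suc (Suc 0))) X) \<and> T = (\<Union>n. topspace X - A n)" by (rule exE)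
  note A = spec[OF conjunct1[OF A0]] conjunct2[OF A0]
  from bSigma0_family[of A, OF A(1)] obtain B :: "nat \<Rightarrow> nat \<Rightarrow> 'a set"
    where B0: "\<forall>n. (\<forall>m. B n m \<in> bSigma0 (Suc (Suc 0)) X) \<and> A n = (\<Union>m. topspace X - B n m)" by (rule exE)
  note B = spec[OF conjunct1[OF spec[OF B0]]] conjunct2[OF spec[OF B0]]
  from bSigma0_family[of "\<lambda>i. B (fst i) (snd i)", OF B(1)] obtain C :: "nat \<times> nat \<Rightarrow> nat \<Rightarrow> 'a set"
    where C0: "\<forall>i. (\<forall>l. C i l \<in> bSigma0 (Suc 0) X) \<and> B (fst i) (snd i) = (\<Union>l. topspace X - C i l)" by (rule exE)
  note C = spec[OF conjunct1[OF spec[OF C0]]] conjunct2[OF spec[OF C0]]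
  have C2: "B n m = (\<Union>l. topspace X - C (n, m) l)" for n m using C(2)[of "(n, m)"] by simp
  have "S = topspace X \<inter> (\<Inter>n. \<Union>m. \<Inter>l. C (n, m) l)" unfolding T(2) A(2) B(2) C2 by auto
  with C(1) show "\<exists>U :: nat \<Rightarrow> nat \<Rightarrow> nat \<Rightarrow> 'a set. (\<forall>n m l. openin X (U n m l)) \<and> S = topspace X \<inter> (\<Inter>n. \<Union>m. \<Inter>l. U n m l)"
    by (intro exI[of _ "\<lambda>n m. C (n, m)"]) simp
next
  have 4: "4 = Suc (Suc (Suc (Suc 0)))" by simp
  assume "\<exists>U :: nat \<Rightarrow> nat \<Rightarrow> nat \<Rightarrow> 'a set. (\<forall>n m l. openin X (U n m l)) \<and>
     S = topspace X \<inter> (\<Inter>n. \<Union>m. \<Inter>l. U n m l)"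
  then obtain U :: "nat \<Rightarrow> nat \<Rightarrow> nat \<Rightarrow> 'a set" where U: "\<And>n m l. openin X (U n m l)"
    "S = topspace X \<inter> (\<Inter>n. \<Union>m. \<Inter>l. U n m l)" by blast
  define B where "B = (\<lambda>n m. \<Union>l. topspace X - U n m l)"
  define A where "A = (\<lambda>n. \<Union>m. topspace X - B n m)"
  have B: "B n m \<in> bSigma0 (Suc (Suc 0)) X" for n m
    unfolding B_def bSigma0_Suc_Suc[where n = 0] using U(1) by (intro exI[of _ "U n m"]) simp
  have A: "A n \<in> bSigma0 (Suc (Suc (Suc 0))) X" for n
    unfolding A_def bSigma0_Suc_Suc[where n = "Suc 0"] using B by (intro exI[of _ "B n"]) simp
  have "(\<Union>n. topspace X - A n) \<in> bSigma0 4 X"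
    unfolding 4 bSigma0_Suc_Suc[where n = "Suc (Suc 0)"] using A by (intro exI[of _ A]) simp
  moreover have "S = topspace X - (\<Union>n. topspace X - A n)"
    using openin_subset[OF U(1)] unfolding U(2) A_def B_def by auto
  ultimately show "S \<in> bPi0 4 X" unfolding bPi0_def by blast
qed

text \<open>Complexity is stated for predicates rather than sets, so that a bound can follow the
  logical form of a condition, connective by connective.\<close>

definition open_pred :: "'a topology \<Rightarrow> ('a \<Rightarrow> bool) \<Rightarrow> bool" where
  "open_pred X \<phi> \<longleftrightarrow> openin X {x \<in> topspace X. \<phi> x}"

definition gdelta_pred :: "'a topology \<Rightarrow> ('a \<Rightarrow> bool) \<Rightarrow> bool" where
  "gdelta_pred X \<phi> \<longleftrightarrow> (\<exists>G :: nat \<Rightarrow> _. (\<forall>n. open_pred X (G n)) \<and> (\<forall>x\<in>topspace X. \<phi> x \<longleftrightarrow> (\<forall>n. G n x)))"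

definition sigma3_pred :: "'a topology \<Rightarrow> ('a \<Rightarrow> bool) \<Rightarrow> bool" where
  "sigma3_pred X \<phi> \<longleftrightarrow> (\<exists>G :: nat \<Rightarrow> _. (\<forall>n. gdelta_pred X (G n)) \<and> (\<forall>x\<in>topspace X. \<phi> x \<longleftrightarrow> (\<exists>n. G n x)))"

lemma open_pred_const [intro!]: "open_pred X (\<lambda>x. c)"
  by (cases c) (auto simp: open_pred_def)

lemma open_pred_conj [intro!]: "open_pred X \<phi> \<Longrightarrow> open_pred X \<psi> \<Longrightarrow> open_pred X (\<lambda>x. \<phi> x \<and> \<psi> x)"
proof -
  assume "open_pred X \<phi>" "open_pred X \<psi>"
  moreover have "{x \<in> topspace X. \<phi> x \<and> \<psi> x} = {x \<in> topspace X. \<phi> x} \<inter> {x \<in> topspace X. \<psi> x}" by auto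
  ultimately show ?thesis by (auto simp: open_pred_def)
qed

lemma open_pred_imp [intro!]: "(c \<Longrightarrow> open_pred X \<phi>) \<Longrightarrow> open_pred X (\<lambda>x. c \<longrightarrow> \<phi> x)"
  by (cases c) (auto simp: open_pred_const)

lemma open_pred_ex [intro!]: "(\<And>y. open_pred X (\<phi> y)) \<Longrightarrow> open_pred X (\<lambda>x. \<exists>y. \<phi> y x)"
proof -
  assume "\<And>y. open_pred X (\<phi> y)"
  moreover have "{x \<in> topspace X. \<exists>y. \<phi> y x} = (\<Union>y. {x \<in> topspace X. \<phi> y x})" by auto
  ultimately show ?thesis by (auto simp: open_pred_def)
qed

lemma open_pred_all_less [intro!]: "(\<And>i. i < n \<Longrightarrow> open_pred X (\<phi> i)) \<Longrightarrow> open_pred X (\<lambda>x. \<forall>i<n::nat. \<phi> i x)"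
proof (induction n)
  case (Suc n)
  then have "open_pred X (\<lambda>x. (\<forall>i<n. \<phi> i x) \<and> \<phi> n x)" by auto
  moreover have "(\<lambda>x. (\<forall>i<n. \<phi> i x) \<and> \<phi> n x) = (\<lambda>x. \<forall>i<Suc n. \<phi> i x)" by (auto simp: less_Suc_eq)
  ultimately show ?case by simp
qed (simp add: open_pred_const)

lemma open_pred_all_le [intro!]: "(\<And>i. i \<le> n \<Longrightarrow> open_pred X (\<phi> i)) \<Longrightarrow> open_pred X (\<lambda>x. \<forall>i\<le>n::nat. \<phi> i x)"
  using open_pred_all_less[of "Suc n" X \<phi>] by (simp add: less_Suc_eq_le)

lemma gdelta_pred_open: "open_pred X \<phi> \<Longrightarrow> gdelta_pred X \<phi>"
  unfolding gdelta_pred_def by (intro exI[of _ "\<lambda>_. \<phi>"]) auto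

lemma gdelta_pred_closed:
  assumes "metrizable_space X" "open_pred X (\<lambda>x. \<not> \<phi> x)" shows "gdelta_pred X \<phi>"
proof -
  have "{x \<in> topspace X. \<phi> x} = topspace X - {x \<in> topspace X. \<not> \<phi> x}" by auto
  then have "closedin X {x \<in> topspace X. \<phi> x}" using assms(2) unfolding open_pred_def
    by (metis closedin_topspace closedin_diff)
  then have "gdelta_in X {x \<in> topspace X. \<phi> x}" by (rule closed_imp_gdelta_in[OF assms(1)])
  then obtain C :: "nat \<Rightarrow> 'a set" where C: "\<And>n. openin X (C n)" "(\<Inter>n. C n) = {x \<in> topspace X. \<phi> x}"
    unfolding gdelta_in_descending by blast
  have "open_pred X (\<lambda>x. x \<in> C n)" for n
  proof -
    have "{x \<in> topspace X. x \<in> C n} = C n" using openin_subset[OF C(1)[of n]] by blast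
    then show ?thesis using C(1)[of n] by (simp add: open_pred_def)
  qed
  moreover have "\<forall>x\<in>topspace X. \<phi> x \<longleftrightarrow> (\<forall>n. x \<in> C n)" using C(2) by blast
  ultimately show ?thesis unfolding gdelta_pred_def by (intro exI[of _ "\<lambda>n x. x \<in> C n"]) simp
qed

lemma gdelta_pred_all:
  fixes \<phi> :: "nat \<Rightarrow> 'a \<Rightarrow> bool"
  assumes "\<And>n. gdelta_pred X (\<phi> n)" shows "gdelta_pred X (\<lambda>x. \<forall>n. \<phi> n x)"
proof -
  obtain G where G: "\<And>n k. open_pred X (G n k)" "\<And>n x. x \<in> topspace X \<Longrightarrow> \<phi> n x \<longleftrightarrow> (\<forall>k::nat. G n k x)"
    using assms unfolding gdelta_pred_def by metis
  define H where "H = (\<lambda>i. G (fst (prod_decode i)) (snd (prod_decode i)))"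
  have "(\<forall>i. H i x) \<longleftrightarrow> (\<forall>n k. G n k x)" for x
    unfolding H_def by (metis fst_conv prod_encode_inverse snd_conv)
  then show ?thesis unfolding gdelta_pred_def using G
    by (intro exI[of _ H]) (auto simp: H_def)
qed

lemma gdelta_pred_conj:
  assumes "gdelta_pred X \<phi>" "gdelta_pred X \<psi>" shows "gdelta_pred X (\<lambda>x. \<phi> x \<and> \<psi> x)"
proof -
  have "gdelta_pred X (\<lambda>x. \<forall>n::nat. (case n of 0 \<Rightarrow> \<phi> | Suc _ \<Rightarrow> \<psi>) x)"
    by (rule gdelta_pred_all) (auto split: nat.split simp: assms)
  moreover have "(\<forall>n::nat. (case n of 0 \<Rightarrow> \<phi> | Suc _ \<Rightarrow> \<psi>) x) \<longleftrightarrow> \<phi> x \<and> \<psi> x" for x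
    by (auto split: nat.split)
  ultimately show ?thesis by simp
qed

lemma sigma3_pred_gdelta: "gdelta_pred X \<phi> \<Longrightarrow> sigma3_pred X \<phi>"
  unfolding sigma3_pred_def by (intro exI[of _ "\<lambda>_. \<phi>"]) auto

lemma sigma3_pred_ex:
  fixes \<phi> :: "'b::countable \<Rightarrow> 'a \<Rightarrow> bool"
  assumes "\<And>n. sigma3_pred X (\<phi> n)" shows "sigma3_pred X (\<lambda>x. \<exists>n. \<phi> n x)"
proof -
  obtain G where G: "\<And>n k. gdelta_pred X (G n k)" "\<And>n x. x \<in> topspace X \<Longrightarrow> \<phi> n x \<longleftrightarrow> (\<exists>k::nat. G n k x)"
    using assms unfolding sigma3_pred_def by metis
  define H where "H = (\<lambda>i. G (from_nat (fst (prod_decode i))) (snd (prod_decode i)))"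
  have "(\<exists>i. H i x) \<longleftrightarrow> (\<exists>n k. G n k x)" for x
    unfolding H_def by (metis fst_conv prod_encode_inverse snd_conv from_nat_to_nat)
  then show ?thesis unfolding sigma3_pred_def using G
    by (intro exI[of _ H]) (auto simp: H_def)
qed

lemma sigma3_pred_disj:
  assumes "sigma3_pred X \<phi>" "sigma3_pred X \<psi>" shows "sigma3_pred X (\<lambda>x. \<phi> x \<or> \<psi> x)"
proof -
  have "sigma3_pred X (\<lambda>x. \<exists>c. (if c then \<phi> else \<psi>) x)"
    by (rule sigma3_pred_ex) (simp add: assms)
  then show ?thesis by (simp add: ex_bool_eq)
qed

lemma sigma3_all_bPi0_4:
  fixes \<phi> :: "'b::countable \<Rightarrow> 'a \<Rightarrow> bool"
  assumes "\<And>n. sigma3_pred X (\<phi> n)" shows "{x \<in> topspace X. \<forall>n. \<phi> n x} \<in> bPi0 4 X"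
proof -
  obtain G where G: "\<And>n m. gdelta_pred X (G n m)" "\<And>n x. x \<in> topspace X \<Longrightarrow> \<phi> n x \<longleftrightarrow> (\<exists>m::nat. G n m x)"
    using assms unfolding sigma3_pred_def by metis
  obtain H where H: "\<And>n m l. open_pred X (H n m l)" "\<And>n m x. x \<in> topspace X \<Longrightarrow> G n m x \<longleftrightarrow> (\<forall>l::nat. H n m l x)"
    using G(1) unfolding gdelta_pred_def by metis
  define U where "U = (\<lambda>n m l. {x \<in> topspace X. H (from_nat n) m l x})"
  have "openin X (U n m l)" for n m l using H(1) by (simp add: U_def open_pred_def)
  moreover have "{x \<in> topspace X. \<forall>n. \<phi> n x} = topspace X \<inter> (\<Inter>n. \<Union>m. \<Inter>l. U n m l)"
  proof (intro set_eqI iffI)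
    fix x assume "x \<in> {x \<in> topspace X. \<forall>n. \<phi> n x}"
    then have x: "x \<in> topspace X" "\<And>n. \<exists>m. \<forall>l. H n m l x" using G(2) H(2) by auto
    then show "x \<in> topspace X \<inter> (\<Inter>n. \<Union>m. \<Inter>l. U n m l)" by (auto simp: U_def)
  next
    fix x assume a: "x \<in> topspace X \<inter> (\<Inter>n. \<Union>m. \<Inter>l. U n m l)"
    then have x: "x \<in> topspace X" by blast
    have "\<phi> n x" for n
    proof -
      have "\<exists>m. \<forall>l. x \<in> U (to_nat n) m l" using a by simp
      then have "\<exists>m. \<forall>l. H n m l x" by (simp add: U_def)
      then show ?thesis using G(2)[OF x] H(2)[OF x] by simp
    qed
    then show "x \<in> {x \<in> topspace X. \<forall>n. \<phi> n x}" using x by simp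
  qed
  ultimately show ?thesis unfolding bPi0_4_iff by blast
qed

section \<open>Reading distances off a code\<close>

lemma fast_Cauchy_limit:
  fixes x :: "nat \<Rightarrow> real"
  assumes "fast_Cauchy x" shows "x \<longlonglongrightarrow> lim x" "\<bar>x k - lim x\<bar> \<le> 2 / 2 ^ k"
proof -
  have b: "\<bar>x k - x m\<bar> \<le> 2 / 2 ^ k - 2 / 2 ^ m" if "k \<le> m" for k m
    using that
  proof (induction rule: dec_induct)
    case (step m)
    have "\<bar>x m - x (Suc m)\<bar> < 1 / 2 ^ m"
      using assms by (simp add: fast_Cauchy_def dist_real_def)
    then show ?case using step.IH by simp
  qed simp
  have c: "\<bar>x k - x m\<bar> \<le> 2 / 2 ^ k" if "k \<le> m" for k m
    using b[OF that] by (smt (verit) divide_nonneg_nonneg zero_le_power)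
  have "Cauchy x"
  proof (rule CauchyI')
    fix e :: real assume "0 < e"
    obtain M where M: "2 / e < 2 ^ M" using real_arch_pow[of 2 "2/e"] by auto
    then have M2: "2 / 2 ^ M < e" using \<open>0 < e\<close> by (simp add: field_simps)
    show "\<exists>M. \<forall>m\<ge>M. \<forall>n>m. dist (x m) (x n) < e"
    proof (intro exI allI impI)
      fix m n assume mn: "M \<le> m" "m < n"
      have "\<bar>x m - x n\<bar> \<le> 2 / 2 ^ m" using c mn by simp
      also have "\<dots> \<le> 2 / 2 ^ M" using mn(1) by (intro divide_left_mono power_increasing) auto
      finally show "dist (x m) (x n) < e" using M2 by (simp add: dist_real_def)
    qed
  qed
  then show l: "x \<longlonglongrightarrow> lim x" by (simp add: Cauchy_convergent_iff convergent_LIMSEQ_iff)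
  have "(\<lambda>m. \<bar>x k - x m\<bar>) \<longlonglongrightarrow> \<bar>x k - lim x\<bar>" by (intro tendsto_intros l)
  then show "\<bar>x k - lim x\<bar> \<le> 2 / 2 ^ k" by (rule LIMSEQ_le_const2) (use c in blast)
qed

definition code_dist :: "(nat \<Rightarrow> bool) \<Rightarrow> nat \<Rightarrow> nat \<Rightarrow> real" where
  "code_dist Y = presented_dist (the_inv presentation_code Y)"

lemma TOP_E:
  assumes "Y \<in> TOP" obtains q where "presentation q" "Y = presentation_code q" "code_dist Y = presented_dist q"
  using assms inj_presentation_code unfolding TOP_def code_dist_def by (auto simp: the_inv_f_f)

lemma presentation_code_iff:
  "presentation_code q (list_encode [a, b, k, rat_encode c]) \<longleftrightarrow> c = q a b k"
  unfolding presentation_code_def list_encode_eq by (auto dest: injD[OF inj_rat_encode])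

lemma code_dist_Metric_space: "Y \<in> TOP \<Longrightarrow> Metric_space UNIV (code_dist Y)"
  by (erule TOP_E) (simp add: presentation_def)

text \<open>One positive bit of the code bounds a distance from both sides. Since arbitrarily
  precise bits exist, both strict comparisons with a real number are unions of conditions on
  positive bits, hence open.\<close>

lemma code_dist_approx:
  assumes "Y \<in> TOP" "Y (list_encode [a, b, k, rat_encode c])"
  shows "\<bar>of_rat c - code_dist Y a b\<bar> \<le> 2 / 2 ^ k"
proof -
  obtain q where q: "presentation q" "Y = presentation_code q" "code_dist Y = presented_dist q"
    using assms(1) by (rule TOP_E)
  then have "c = q a b k" using assms(2) presentation_code_iff by simp
  then show ?thesis using fast_Cauchy_limit(2)[of "\<lambda>k. real_of_rat (q a b k)" k] q
    by (simp add: presentation_def presented_dist_def)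
qed

lemma code_dist_dense:
  assumes "Y \<in> TOP" "0 < e"
  shows "\<exists>k c. Y (list_encode [a, b, k, rat_encode c]) \<and> 2 / 2 ^ k < e \<and> \<bar>of_rat c - code_dist Y a b\<bar> < e"
proof -
  obtain q where q: "presentation q" "Y = presentation_code q" "code_dist Y = presented_dist q"
    using assms(1) by (rule TOP_E)
  obtain k where k: "2 / e < 2 ^ k" using real_arch_pow[of 2 "2/e"] by auto
  then have k2: "2 / 2 ^ k < e" using \<open>0 < e\<close> by (simp add: field_simps)
  have Y: "Y (list_encode [a, b, k, rat_encode (q a b k)])" by (simp only: q(2) presentation_code_iff)
  then show ?thesis using code_dist_approx[OF assms(1) Y] k2
    by (intro exI[of _ k] exI[of _ "q a b k"]) linarith
qed

lemma open_pred_bit: "open_pred (top_of_set TOP) (\<lambda>Y. Y n)"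
proof -
  have "open ((\<lambda>Y::nat \<Rightarrow> bool. Y n) -` {True})"
    by (intro open_vimage continuous_on_product_coordinates) (simp add: open_discrete)
  then have "open {Y::nat \<Rightarrow> bool. Y n}" by (simp add: vimage_def)
  then show ?thesis unfolding open_pred_def by (auto simp: openin_open)
qed

lemma open_pred_dist_less: "open_pred (top_of_set TOP) (\<lambda>Y. code_dist Y a b < r)"
proof -
  have e: "code_dist Y a b < r \<longleftrightarrow> (\<exists>k c. of_rat c + 2 / 2 ^ k < r \<and> Y (list_encode [a, b, k, rat_encode c]))"
    if Y: "Y \<in> TOP" for Y
  proof
    assume "code_dist Y a b < r"
    then have "0 < (r - code_dist Y a b) / 2" by simp
    then show "\<exists>k c. of_rat c + 2 / 2 ^ k < r \<and> Y (list_encode [a, b, k, rat_encode c])"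
      using code_dist_dense[OF Y, of "(r - code_dist Y a b) / 2" a b] by (smt (verit) field_sum_of_halves)
  next
    assume "\<exists>k c. of_rat c + 2 / 2 ^ k < r \<and> Y (list_encode [a, b, k, rat_encode c])"
    then show "code_dist Y a b < r" using code_dist_approx[OF Y] by (smt (verit))
  qed
  have "open_pred (top_of_set TOP) (\<lambda>Y. \<exists>k c. of_rat c + 2 / 2 ^ k < r \<and> Y (list_encode [a, b, k, rat_encode c]))"
    by (intro open_pred_ex open_pred_conj open_pred_const open_pred_bit)
  then show ?thesis unfolding open_pred_def using e by (simp cong: conj_cong)
qed

lemma open_pred_dist_greater: "open_pred (top_of_set TOP) (\<lambda>Y. r < code_dist Y a b)"
proof -
  have e: "r < code_dist Y a b \<longleftrightarrow> (\<exists>k c. r < of_rat c - 2 / 2 ^ k \<and> Y (list_encode [a, b, k, rat_encode c]))"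
    if Y: "Y \<in> TOP" for Y
  proof
    assume "r < code_dist Y a b"
    then have "0 < (code_dist Y a b - r) / 2" by simp
    then show "\<exists>k c. r < of_rat c - 2 / 2 ^ k \<and> Y (list_encode [a, b, k, rat_encode c])"
      using code_dist_dense[OF Y, of "(code_dist Y a b - r) / 2" a b] by (smt (verit) field_sum_of_halves)
  next
    assume "\<exists>k c. r < of_rat c - 2 / 2 ^ k \<and> Y (list_encode [a, b, k, rat_encode c])"
    then show "r < code_dist Y a b" using code_dist_approx[OF Y] by (smt (verit))
  qed
  have "open_pred (top_of_set TOP) (\<lambda>Y. \<exists>k c. r < of_rat c - 2 / 2 ^ k \<and> Y (list_encode [a, b, k, rat_encode c]))"
    by (intro open_pred_ex open_pred_conj open_pred_const open_pred_bit)
  then show ?thesis unfolding open_pred_def using e by (simp cong: conj_cong)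
qed

lemma open_pred_refines: "open_pred (top_of_set TOP) (\<lambda>Y. refines (code_dist Y) p \<delta> \<epsilon> K q)"
  unfolding refines_def
  by (intro open_pred_conj open_pred_const open_pred_all_less open_pred_all_le open_pred_imp
      open_pred_dist_less open_pred_dist_greater)

lemma open_pred_near: "open_pred (top_of_set TOP) (\<lambda>Y. \<exists>i<length p. code_dist Y x (p ! i) < \<epsilon>)"
  by (intro open_pred_ex open_pred_conj open_pred_const open_pred_dist_less)

lemma open_pred_refinement:
  "open_pred (top_of_set TOP) (\<lambda>Y. \<exists>K q. 1 \<le> K \<and> refines (code_dist Y) p \<delta> \<epsilon> K q \<and>
        (\<forall>j<length q. code_dist Y (cyc q j) (cyc q (Suc j)) < e))"
  by (intro open_pred_ex open_pred_conj open_pred_const open_pred_all_less open_pred_refines open_pred_dist_less)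

lemma gdelta_pred_good_chain: "gdelta_pred (top_of_set TOP) (\<lambda>Y. good_chain (code_dist Y) p \<delta> \<epsilon>)"
  unfolding good_chain_def
  by (intro gdelta_pred_conj gdelta_pred_all gdelta_pred_open open_pred_const open_pred_near open_pred_refinement)

text \<open>The negation is a countable disjunction of closed conditions, and closed sets are
  \<open>G\<^sub>\<delta>\<close> because the space of codes is metrizable. So the implication in
  \<open>circular\<close> does not raise the complexity.\<close>

lemma sigma3_pred_not_good_chain: "sigma3_pred (top_of_set TOP) (\<lambda>Y. \<not> good_chain (code_dist Y) p \<delta> \<epsilon>)"
proof -
  have m: "metrizable_space (top_of_set TOP)"
  proof (intro metrizable_space_subtopology)
    have "(euclidean :: bool topology) = discrete_topology UNIV"
      unfolding topology_eq by (simp add: open_discrete flip: open_openin)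
    then have "metrizable_space (euclidean :: bool topology)"
      by (simp add: metrizable_space_discrete_topology)
    then show "metrizable_space (euclidean :: (nat \<Rightarrow> bool) topology)"
      unfolding euclidean_product_topology[symmetric]
      by (subst metrizable_space_product_topology) auto
  qed
  show ?thesis
    unfolding good_chain_def de_Morgan_conj not_all
    by (intro sigma3_pred_disj sigma3_pred_ex)
       (intro sigma3_pred_gdelta gdelta_pred_closed m, simp only: not_not,
        intro open_pred_const open_pred_near open_pred_refinement)+
qed

lemma sigma3_pred_good_extension:
  "sigma3_pred (top_of_set TOP) (\<lambda>Y. good_extension (code_dist Y) p a b q a' b' K)"
  unfolding good_extension_def
  by (intro sigma3_pred_gdelta gdelta_pred_conj gdelta_pred_good_chain)
     (intro gdelta_pred_open open_pred_const open_pred_refines)+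

theorem HCopies_circle_bPi0: "HCopies (top_of_set (sphere (0::complex) 1)) \<in> bPi0 4 (top_of_set TOP)"
proof -
  \<comment> \<open>The flag \<open>c\<close> merges the two clauses of \<open>circular\<close> into
    one family over a countable type, as required by \<open>sigma3_all_bPi0_4\<close>.\<close>
  define \<phi> where "\<phi> = (\<lambda>(c::bool, p, a::nat, b::nat) Y.
    if c then (\<exists>p a b. good_chain (code_dist Y) p (1 / Suc a) (1 / Suc b))
    else \<not> good_chain (code_dist Y) p (1 / Suc a) (1 / Suc b) \<or>
       (\<exists>q a' b' K. good_extension (code_dist Y) p a b q a' b' K))"
  have s: "sigma3_pred (top_of_set TOP) (\<phi> x)" for x
  proof -
    obtain c p a b where x: "x = (c, p, a, b)" by (metis prod_cases4)
    have "sigma3_pred (top_of_set TOP) (\<lambda>Y. \<exists>p a b. good_chain (code_dist Y) p (1 / Suc a) (1 / Suc b))"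
      by (intro sigma3_pred_ex sigma3_pred_gdelta gdelta_pred_good_chain)
    moreover have "sigma3_pred (top_of_set TOP) (\<lambda>Y. \<not> good_chain (code_dist Y) p (1 / Suc a) (1 / Suc b) \<or>
       (\<exists>q a' b' K. good_extension (code_dist Y) p a b q a' b' K))"
      by (intro sigma3_pred_disj sigma3_pred_ex sigma3_pred_not_good_chain sigma3_pred_good_extension)
    ultimately show ?thesis by (cases c) (simp_all add: x \<phi>_def)
  qed
  have c: "circular (code_dist Y) \<longleftrightarrow> (\<forall>x. \<phi> x Y)" for Y
  proof
    assume "circular (code_dist Y)"
    then show "\<forall>x. \<phi> x Y" unfolding circular_def \<phi>_def by (auto split: prod.split)
  next
    assume a: "\<forall>x. \<phi> x Y"
    show "circular (code_dist Y)" unfolding circular_def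
    proof (intro conjI allI impI)
      show "\<exists>p a b. good_chain (code_dist Y) p (1 / Suc a) (1 / Suc b)"
        using spec[OF a, of "(True, undefined)"] by (simp add: \<phi>_def split: prod.splits)
      show "\<exists>q a' b' K. good_extension (code_dist Y) p a b q a' b' K"
        if "good_chain (code_dist Y) p (1 / Suc a) (1 / Suc b)" for p a b
        using spec[OF a, of "(False, p, a, b)"] that by (simp add: \<phi>_def)
    qed
  qed
  have "HCopies (top_of_set (sphere (0::complex) 1)) = {Y \<in> TOP. circular (code_dist Y)}"
    unfolding HCopies_def presented_space_def code_dist_def[symmetric]
    using circular_imp_circle circle_imp_circular code_dist_Metric_space by blast
  also have "\<dots> = {Y \<in> topspace (top_of_set TOP). \<forall>x. \<phi> x Y}" using c by simp
  also have "\<dots> \<in> bPi0 4 (top_of_set TOP)" by (rule sigma3_all_bPi0_4[OF s])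
  finally show ?thesis .
qed

section \<open>A single spot\<close>

definition bump :: "real \<Rightarrow> real \<Rightarrow> real \<Rightarrow> real" where
  "bump c w y = max 0 (1 - \<bar>y - c\<bar> / w)"

text \<open>Added to a strand, a ramp creates a copy that is separate up to height 1 and rejoins the
  strand at height \<open>1 + w\<close>.\<close>

definition ramp :: "real \<Rightarrow> real \<Rightarrow> real" where
  "ramp w y = max 0 (min 1 (1 - (y - 1) / w))"

lemma bump_bounds: "0 < w \<Longrightarrow> 0 \<le> bump c w y" "0 < w \<Longrightarrow> bump c w y \<le> 1"
  by (auto simp: bump_def)

lemma bump_centre [simp]: "bump c w c = 1"
  by (simp add: bump_def)

lemma bump_zero: "0 < w \<Longrightarrow> w \<le> \<bar>y - c\<bar> \<Longrightarrow> bump c w y = 0"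
  by (simp add: bump_def field_simps)

lemma bump_cont: "continuous_on A (bump c w)"
  unfolding bump_def[abs_def] divide_inverse by (intro continuous_intros)

lemma ramp_bounds: "0 \<le> ramp w y" "ramp w y \<le> 1"
  by (auto simp: ramp_def)

lemma ramp_one: "0 < w \<Longrightarrow> y \<le> 1 \<Longrightarrow> ramp w y = 1"
  by (simp add: ramp_def divide_nonpos_pos min_def max_def)

lemma ramp_zero: "0 < w \<Longrightarrow> 1 + w \<le> y \<Longrightarrow> ramp w y = 0"
  by (simp add: ramp_def field_simps)

lemma ramp_cont: "continuous_on A (ramp w)"
  unfolding ramp_def[abs_def] divide_inverse by (intro continuous_intros)

lemma infinite_sets_choice:
  fixes I :: "nat \<Rightarrow> 'a set"
  assumes "\<And>r. infinite (I r)"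
  shows "\<exists>h. inj h \<and> (\<forall>r. h r \<in> I r)"
proof -
  have "\<exists>h. \<forall>r. h r \<in> I r \<and> h r \<notin> h ` {..<r}"
  proof (rule dependent_wellorder_choice)
    show "\<exists>y. y \<in> I r \<and> y \<notin> h ` {..<r}" for r and h :: "nat \<Rightarrow> 'a"
      using infinite_imp_nonempty[OF Diff_infinite_finite[OF finite_imageI[OF finite_lessThan] assms[of r]]] by blast
    show "(y \<in> I r \<and> y \<notin> f ` {..<r}) = (y \<in> I r \<and> y \<notin> g ` {..<r})"
      if "\<And>s. s < r \<Longrightarrow> f s = g s" for y f g r
      using that by (metis (no_types, lifting) image_cong lessThan_iff)
  qed
  then obtain h where h: "\<And>r. h r \<in> I r" "\<And>r. h r \<notin> h ` {..<r}" by blast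
  have "inj h"
  proof (rule injI)
    fix a b assume "h a = h b"
    then show "a = b" using h(2)[of a] h(2)[of b] imageI[of a "{..<b}" h] imageI[of b "{..<a}" h]
      by (cases a b rule: linorder_cases) auto
  qed
  then show ?thesis using h(1) by blast
qed

text \<open>Every point \<open>r\<close> of the construction has a height \<open>h r\<close> that does not depend on the input;
  \<open>J r\<close> says on which strand it is placed.\<close>

locale heights =
  fixes h :: "nat \<Rightarrow> real" and J :: "nat \<Rightarrow> nat"
  assumes h_inj: "inj h" and h_range: "0 < h r" "h r < 2" "h r \<noteq> 1"
    and h_dense: "\<lbrakk>0 \<le> a; a < b; b \<le> 2\<rbrakk> \<Longrightarrow> \<exists>r\<ge>N. J r = j \<and> a < h r \<and> h r < b"

text \<open>The indices enumerate quadruples of two rational end points, a strand number and a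
  counter; the counter makes every demand recur beyond any \<open>N\<close>. Intervals are infinite,
  so distinct heights can be chosen in them.\<close>

lemma heights_exist: "\<exists>h J. heights h J"
proof -
  define e :: "nat \<Rightarrow> rat \<times> rat \<times> nat \<times> nat" where "e = from_nat"
  define I where "I = (\<lambda>r. case e r of (a, b, j, n) \<Rightarrow>
    (if 0 \<le> a \<and> a < b \<and> b \<le> 2 then {real_of_rat a<..<of_rat b} else {0<..<2}) - {1})"
  have infI: "infinite (I r)" for r
    by (auto simp: I_def infinite_Ioo of_rat_less split: prod.split)
  then obtain h where h: "inj h" "\<And>r. h r \<in> I r" using infinite_sets_choice[of I] by blast
  have r02: "real_of_rat b \<le> 2" "0 \<le> real_of_rat a" if "0 \<le> a" "b \<le> 2" for a b :: rat
    using that of_rat_less_eq[of b 2] of_rat_less_eq[of 0 a] by simp_all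
  have hI: "0 < h r \<and> h r < 2 \<and> h r \<noteq> 1" for r
  proof -
    obtain a b j n where "e r = (a, b, j, n)" by (metis prod_cases4)
    then have hr: "h r \<in> (if 0 \<le> a \<and> a < b \<and> b \<le> 2 then {real_of_rat a<..<of_rat b} else {0<..<2}) - {1}"
      using h(2)[of r] by (simp add: I_def)
    show ?thesis
    proof (cases "0 \<le> a \<and> a < b \<and> b \<le> 2")
      case True
      then have "real_of_rat b \<le> 2" "0 \<le> real_of_rat a" using r02 by blast+
      moreover have "real_of_rat a < h r" "h r < of_rat b" "h r \<noteq> 1" using hr True by auto
      ultimately show ?thesis by linarith
    qed (use hr in auto)
  qed
  define J where "J = (\<lambda>r. fst (snd (snd (e r))))"
  have "heights h J"
  proof
    show "inj h" by (rule h(1))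
    show "0 < h r" "h r < 2" "h r \<noteq> 1" for r using hI by auto
    show "\<exists>r\<ge>N. J r = j \<and> a < h r \<and> h r < b" if ab: "0 \<le> a" "a < b" "b \<le> 2" for a b N j
    proof -
      obtain a' where a': "a < of_rat a'" "of_rat a' < b" using of_rat_dense[OF ab(2)] by blast
      obtain b' where b': "of_rat a' < real_of_rat b'" "of_rat b' < b" using of_rat_dense[OF a'(2)] by blast
      have "0 < real_of_rat a'" using ab(1) a'(1) by linarith
      then have "0 \<le> a'" by simp
      then have q: "0 \<le> a'" "a' < b'" "b' \<le> 2"
        using ab a' b' of_rat_less[of a' b', where 'a = real] of_rat_less_eq[of b' 2, where 'a = real]
          of_rat_less_eq[of 0 a', where 'a = real] by auto
      define f where "f = (\<lambda>n::nat. to_nat (a', b', j, n))"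
      have "inj f" by (auto simp: f_def inj_def)
      then have "infinite (range f)" by (simp add: finite_image_iff)
      then obtain n where n: "N \<le> f n" using finite_nat_set_iff_bounded[of "range f"]
        by (metis not_le rangeE)
      have "e (f n) = (a', b', j, n)" by (simp add: e_def f_def)
      then have "J (f n) = j" "a < h (f n)" "h (f n) < b"
        using h(2)[of "f n"] q a' b' by (auto simp: J_def I_def)
      then show ?thesis using n by blast
    qed
  qed
  then show ?thesis by blast
qed

context heights
begin

lemma width_exists:
  "\<exists>w. 0 < w \<and> w \<le> 1 \<and> (\<forall>r<s. w \<le> h r \<and> w \<le> 2 - h r \<and> w \<le> \<bar>h r - 1\<bar> \<and> (\<forall>r'<s. r \<noteq> r' \<longrightarrow> 2 * w \<le> \<bar>h r - h r'\<bar>))"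
proof -
  define F where "F = {1} \<union> h ` {..<s} \<union> (\<lambda>r. 2 - h r) ` {..<s} \<union> (\<lambda>r. \<bar>h r - 1\<bar>) ` {..<s} \<union>
     (\<lambda>(r, r'). \<bar>h r - h r'\<bar> / 2) ` {(r, r') \<in> {..<s} \<times> {..<s}. r \<noteq> r'}"
  have fin: "finite F" unfolding F_def
    by (intro finite_UnI finite_imageI finite_lessThan finite_subset[of "{(r, r') \<in> {..<s} \<times> {..<s}. r \<noteq> r'}" "{..<s} \<times> {..<s}"]) auto
  have pos: "0 < x" if "x \<in> F" for x
  proof -
    have "h r \<noteq> h r'" if "r \<noteq> r'" for r r' using that h_inj by (auto dest: injD)
    then show ?thesis using that h_range by (auto simp: F_def)
  qed
  have m: "0 < Min F" "\<And>x. x \<in> F \<Longrightarrow> Min F \<le> x"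
    using Min_in[OF fin] pos fin by (auto simp: F_def)
  have "2 * Min F \<le> \<bar>h r - h r'\<bar>" if "r < s" "r' < s" "r \<noteq> r'" for r r'
    using m(2)[of "\<bar>h r - h r'\<bar> / 2"] that by (force simp: F_def)
  moreover have "Min F \<le> h r \<and> Min F \<le> 2 - h r \<and> Min F \<le> \<bar>h r - 1\<bar>" if "r < s" for r
    using m(2) that by (auto simp: F_def)
  moreover have "Min F \<le> 1" using m(2) by (auto simp: F_def)
  ultimately show ?thesis using m(1) by blast
qed

text \<open>Tents of this half-width at the first \<open>s\<close> heights have disjoint interiors
  and vanish at 0, 1 and 2, so bending a strand at these heights leaves its ends alone.\<close>

definition width :: "nat \<Rightarrow> real" where
  "width s = (SOME w. 0 < w \<and> w \<le> 1 \<and> (\<forall>r<s. w \<le> h r \<and> w \<le> 2 - h r \<and> w \<le> \<bar>h r - 1\<bar> \<and> (\<forall>r'<s. r \<noteq> r' \<longrightarrow> 2 * w \<le> \<bar>h r - h r'\<bar>)))"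

lemma width:
  "0 < width s" "width s \<le> 1"
  "r < s \<Longrightarrow> width s \<le> h r" "r < s \<Longrightarrow> width s \<le> 2 - h r" "r < s \<Longrightarrow> width s \<le> \<bar>h r - 1\<bar>"
  "r < s \<Longrightarrow> r' < s \<Longrightarrow> r \<noteq> r' \<Longrightarrow> 2 * width s \<le> \<bar>h r - h r'\<bar>"
  using someI_ex[OF width_exists[of s]] unfolding width_def[symmetric] by auto

definition lift_sum :: "nat \<Rightarrow> (nat \<Rightarrow> real) \<Rightarrow> real \<Rightarrow> real" where
  "lift_sum s c y = (\<Sum>r<s. c r * bump (h r) (width s) y)"

lemma lift_sum_at:
  assumes "r < s" shows "lift_sum s c (h r) = c r"
proof -
  have "c r' * bump (h r') (width s) (h r) = (if r' = r then c r else 0)" if "r' < s" for r'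
  proof (cases "r' = r")
    case False
    have "bump (h r') (width s) (h r) = 0"
      using width(1)[of s] width(6)[OF assms that] False by (intro bump_zero) auto
    then show ?thesis using False by simp
  qed simp
  then have "lift_sum s c (h r) = (\<Sum>r'<s. if r' = r then c r else 0)"
    unfolding lift_sum_def by (intro sum.cong) auto
  then show ?thesis using assms by (simp add: sum.delta)
qed

lemma lift_sum_nonneg: "(\<And>r. r < s \<Longrightarrow> 0 \<le> c r) \<Longrightarrow> 0 \<le> lift_sum s c y"
  unfolding lift_sum_def by (intro sum_nonneg mult_nonneg_nonneg) (auto simp: bump_bounds width)

text \<open>At most one tent is nonzero at any given \<open>y\<close>, so the sum obeys the bound of
  a single coefficient, however many points there are.\<close>

lemma lift_sum_le:
  assumes "\<And>r. r < s \<Longrightarrow> 0 \<le> c r" "\<And>r. r < s \<Longrightarrow> c r \<le> C" "0 \<le> C"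
  shows "lift_sum s c y \<le> C"
proof (cases "\<exists>r<s. \<bar>y - h r\<bar> < width s")
  case True
  then obtain r where r: "r < s" "\<bar>y - h r\<bar> < width s" by blast
  have "c r' * bump (h r') (width s) y = (if r' = r then c r * bump (h r) (width s) y else 0)" if "r' < s" for r'
  proof (cases "r' = r")
    case False
    have "width s \<le> \<bar>y - h r'\<bar>" using width(6)[OF r(1) that] False r(2) by linarith
    then show ?thesis using False bump_zero[OF width(1)] by simp
  qed simp
  then have "lift_sum s c y = (\<Sum>r'<s. if r' = r then c r * bump (h r) (width s) y else 0)"
    unfolding lift_sum_def by (intro sum.cong) auto
  also have "\<dots> = c r * bump (h r) (width s) y" using r(1) by (simp add: sum.delta)
  also have "\<dots> \<le> c r * 1" using assms(1)[OF r(1)] bump_bounds[OF width(1)] by (intro mult_left_mono) auto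
  finally show ?thesis using assms(2)[OF r(1)] by simp
next
  case False
  then have "lift_sum s c y = 0" unfolding lift_sum_def
  proof (intro sum.neutral ballI)
    fix r assume "r \<in> {..<s}"
    then have "width s \<le> \<bar>y - h r\<bar>" using False by (meson lessThan_iff not_less)
    then show "c r * bump (h r) (width s) y = 0" by (simp add: bump_zero[OF width(1)])
  qed
  then show ?thesis using assms(3) by simp
qed

lemma lift_sum_ends: "lift_sum s c 0 = 0" "lift_sum s c 2 = 0"
proof -
  have "bump (h r) (width s) 0 = 0 \<and> bump (h r) (width s) 2 = 0" if "r < s" for r
    using width(3,4)[OF that] width(1)[of s] h_range[of r] by (auto intro!: bump_zero)
  then show "lift_sum s c 0 = 0" "lift_sum s c 2 = 0"
    unfolding lift_sum_def by (auto intro!: sum.neutral)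
qed

lemma lift_sum_cont: "continuous_on A (lift_sum s c)"
  unfolding lift_sum_def[abs_def]
  by (intro continuous_on_sum continuous_on_mult continuous_on_const bump_cont)

text \<open>A state consists of the strands \<open>\<psi> i\<close>, the gaps \<open>\<gamma> i\<close> between \<open>\<psi> i\<close> and its successor (the
  descending strand in between is \<open>\<psi> i y + \<gamma> i * (1 - y)\<close>), bounds \<open>S i\<close> on the width of everything to
  the right of \<open>\<psi> i\<close>, and the abscissas of the points placed so far. A step with input \<open>k\<close> bends strand
  \<open>k\<close> through all points to its right and then creates two new strands next to it.\<close>

type_synonym spot_state = "(nat \<Rightarrow> real \<Rightarrow> real) \<times> (nat \<Rightarrow> real) \<times> (nat \<Rightarrow> real) \<times> (nat \<Rightarrow> real)"

text \<open>The maximum with 0 leaves out the points to the left of strand \<open>k\<close>; these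
  lie on earlier strands, which are kept.\<close>

definition merged :: "nat \<Rightarrow> nat \<Rightarrow> spot_state \<Rightarrow> real \<Rightarrow> real" where
  "merged s k = (\<lambda>(\<psi>, \<gamma>, S, x) y. \<psi> k y + lift_sum s (\<lambda>r. max 0 (x r - \<psi> k (h r))) y)"

text \<open>All strands after \<open>Suc k\<close> are copies of it. This default keeps the order of
  strands valid for all indices.\<close>

definition new_strands :: "nat \<Rightarrow> nat \<Rightarrow> spot_state \<Rightarrow> nat \<Rightarrow> real \<Rightarrow> real" where
  "new_strands s k st i y = (if i < k then fst st i y else
     merged s k st y + (if i = k then 0 else (1/2) ^ s * ramp (width s) y))"

text \<open>An even \<open>J s\<close> asks for a point on the ascending strand
  \<open>J s div 2\<close>, an odd one for a point on the descending strand after it; a request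
  beyond the last strand ends up on the last one. Above height 1 only the last strand
  continues.\<close>

definition new_point :: "nat \<Rightarrow> nat \<Rightarrow> (nat \<Rightarrow> real \<Rightarrow> real) \<Rightarrow> (nat \<Rightarrow> real) \<Rightarrow> real" where
  "new_point s k \<psi> \<gamma> = (if 1 < h s then \<psi> (Suc k) (h s)
     else \<psi> (J s div 2) (h s) + (if odd (J s) \<and> J s div 2 \<le> k then \<gamma> (J s div 2) * (1 - h s) else 0))"

definition spot_step :: "nat \<Rightarrow> nat \<Rightarrow> spot_state \<Rightarrow> spot_state" where
  "spot_step s k st = (case st of (\<psi>, \<gamma>, S, x) \<Rightarrow>
     let \<psi>' = new_strands s k st; \<gamma>' = \<gamma>(k := (1/2) ^ s) in
     (\<psi>', \<gamma>', (\<lambda>i. if i < k then S i + (1/2) ^ s else if i = k then (1/2) ^ s else 0),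
      x(s := new_point s k \<psi>' \<gamma>')))"

primrec spot_state :: "(nat \<Rightarrow> nat) \<Rightarrow> nat \<Rightarrow> spot_state" where
  "spot_state \<kappa> 0 = (\<lambda>_ _. 0, \<lambda>_. 0, \<lambda>_. 0, \<lambda>_. 0)"
| "spot_state \<kappa> (Suc s) = spot_step s (\<kappa> s) (spot_state \<kappa> s)"

definition spot_x :: "(nat \<Rightarrow> nat) \<Rightarrow> nat \<Rightarrow> real" where
  "spot_x \<kappa> r = snd (snd (snd (spot_state \<kappa> (Suc r)))) r"

lemma spot_state_cong: "(\<And>t. t < s \<Longrightarrow> \<kappa> t = \<kappa>' t) \<Longrightarrow> spot_state \<kappa> s = spot_state \<kappa>' s"
  by (induction s) auto

lemma spot_x_cong: "(\<And>t. t \<le> r \<Longrightarrow> \<kappa> t = \<kappa>' t) \<Longrightarrow> spot_x \<kappa> r = spot_x \<kappa>' r"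
  unfolding spot_x_def using spot_state_cong[of "Suc r" \<kappa> \<kappa>'] by simp

end

section \<open>The invariant of a spot and its behaviour if the input tends to infinity\<close>

definition strands :: "nat \<Rightarrow> (nat \<Rightarrow> real \<Rightarrow> real) \<Rightarrow> (nat \<Rightarrow> real) \<Rightarrow> (real \<times> real) set" where
  "strands K \<psi> \<gamma> = (\<Union>i<K. (\<lambda>y. (y, \<psi> i y)) ` {0..1} \<union> (\<lambda>y. (y, \<psi> i y + \<gamma> i * (1 - y))) ` {0..1}) \<union>
     (\<lambda>y. (y, \<psi> K y)) ` {0..2}"

text \<open>The bound \<open>\<kappa> (Suc s) \<le> Suc (\<kappa> s)\<close> means that an input
  names an existing strand. After step 0 the input is positive, so that strand 0 is never
  bent.\<close>

locale spot = heights +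
  fixes \<kappa> :: "nat \<Rightarrow> nat"
  assumes k0: "\<kappa> 0 = 0" and kpos: "1 \<le> \<kappa> (Suc s)" and kSuc: "\<kappa> (Suc s) \<le> Suc (\<kappa> s)"
begin

definition "\<psi> s = fst (spot_state \<kappa> s)"
definition "\<gamma> s = fst (snd (spot_state \<kappa> s))"
definition "S s = fst (snd (snd (spot_state \<kappa> s)))"
definition "x = spot_x \<kappa>"
text \<open>This is the number of the last strand before step \<open>s\<close>: a step with input
  \<open>k\<close> ends with the strands up to \<open>Suc k\<close>.\<close>

definition lvl :: "nat \<Rightarrow> nat" where "lvl s = (case s of 0 \<Rightarrow> 0 | Suc t \<Rightarrow> Suc (\<kappa> t))"
definition M :: "nat \<Rightarrow> real \<Rightarrow> real" where "M s y = \<psi> s (\<kappa> s) y + lift_sum s (\<lambda>r. max 0 (x r - \<psi> s (\<kappa> s) (h r))) y"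

lemma state_x: "r < s \<Longrightarrow> snd (snd (snd (spot_state \<kappa> s))) r = x r"
proof (induction s)
  case (Suc s)
  then show ?case by (cases "r = s") (auto simp: x_def spot_x_def spot_step_def Let_def split: prod.splits)
qed simp

lemma state_eq: "spot_state \<kappa> s = (\<psi> s, \<gamma> s, S s, snd (snd (snd (spot_state \<kappa> s))))"
  by (simp add: \<psi>_def \<gamma>_def S_def)

lemma merged_eq: "merged s (\<kappa> s) (spot_state \<kappa> s) = M s"
proof -
  have "lift_sum s (\<lambda>r. max 0 (snd (snd (snd (spot_state \<kappa> s))) r - \<psi> s (\<kappa> s) (h r))) y =
        lift_sum s (\<lambda>r. max 0 (x r - \<psi> s (\<kappa> s) (h r))) y" for y
    unfolding lift_sum_def by (rule sum.cong) (simp_all add: state_x)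
  then show ?thesis by (subst state_eq) (simp add: merged_def M_def fun_eq_iff)
qed

lemma psi_Suc: "\<psi> (Suc s) i y = (if i < \<kappa> s then \<psi> s i y else
     M s y + (if i = \<kappa> s then 0 else (1/2) ^ s * ramp (width s) y))"
proof -
  have "\<psi> (Suc s) = new_strands s (\<kappa> s) (spot_state \<kappa> s)"
    by (simp add: \<psi>_def spot_step_def Let_def split: prod.split)
  then show ?thesis by (simp add: new_strands_def merged_eq \<psi>_def)
qed

lemma gamma_Suc: "\<gamma> (Suc s) = (\<gamma> s)(\<kappa> s := (1/2) ^ s)"
  by (simp add: \<gamma>_def spot_step_def Let_def split: prod.split)

lemma S_Suc: "S (Suc s) i = (if i < \<kappa> s then S s i + (1/2) ^ s else if i = \<kappa> s then (1/2) ^ s else 0)"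
  by (simp add: S_def spot_step_def Let_def split: prod.split)

lemma x_eq: "x s = new_point s (\<kappa> s) (\<psi> (Suc s)) (\<gamma> (Suc s))"
  by (simp add: x_def spot_x_def \<psi>_def \<gamma>_def spot_step_def Let_def split: prod.split)

lemma zero_state: "\<psi> 0 i y = 0" "S 0 i = 0"
  by (simp_all add: \<psi>_def S_def)

lemma lvl_Suc [simp]: "lvl (Suc s) = Suc (\<kappa> s)" and lvl_0 [simp]: "lvl 0 = 0"
  by (simp_all add: lvl_def)

lemma k_le_lvl: "\<kappa> s \<le> lvl s"
  using k0 kSuc by (cases s) auto

definition on :: "nat \<Rightarrow> nat \<Rightarrow> nat \<Rightarrow> bool" where
  "on s L r \<longleftrightarrow> (if h r < 1 then (\<exists>i\<le>L. x r = \<psi> s i (h r)) \<or> (\<exists>i<L. x r = \<psi> s i (h r) + \<gamma> s i * (1 - h r))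
      else x r = \<psi> s L (h r))"

text \<open>Bounding the distance of strands \<open>j\<close> and \<open>i\<close> by a difference
  of values of \<open>S\<close> leaves the room \<open>S s i\<close> to the right of strand
  \<open>i\<close>. A merge into strand \<open>i\<close> may use up exactly this room.\<close>

definition ok :: "nat \<Rightarrow> bool" where
  "ok s \<longleftrightarrow> (\<forall>i. continuous_on UNIV (\<psi> s i)) \<and>
     (\<forall>i j y. j \<le> i \<longrightarrow> \<psi> s j y \<le> \<psi> s i y \<and> \<psi> s i y \<le> \<psi> s j y + (S s j - S s i)) \<and>
     (\<forall>i<lvl s. 0 < \<gamma> s i \<and> \<psi> s (Suc i) 0 = \<psi> s i 0 + \<gamma> s i \<and> (\<forall>y. 0 \<le> y \<and> y \<le> 1 \<longrightarrow> \<psi> s i y + \<gamma> s i \<le> \<psi> s (Suc i) y)) \<and>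
     (\<forall>i. \<psi> s i 2 = 0) \<and> (\<forall>i\<ge>lvl s. S s i = 0) \<and> (\<forall>r<s. on s (lvl s) r)"

lemma ok_below:
  assumes "ok s" "r < s" shows "x r \<le> \<psi> s (lvl s) (h r)"
proof -
  have le: "\<psi> s i (h r) \<le> \<psi> s (lvl s) (h r)" if "i \<le> lvl s" for i using assms(1) that by (simp add: ok_def)
  have on: "on s (lvl s) r" using assms by (simp add: ok_def)
  show ?thesis
  proof (cases "h r < 1")
    case True
    then consider i where "i \<le> lvl s" "x r = \<psi> s i (h r)"
      | i where "i < lvl s" "x r = \<psi> s i (h r) + \<gamma> s i * (1 - h r)"
      using on by (auto simp: on_def)
    then show ?thesis
    proof cases
      case 2
      have g: "0 < \<gamma> s i" "\<psi> s i (h r) + \<gamma> s i \<le> \<psi> s (Suc i) (h r)"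
        using assms(1) 2 True h_range[of r] by (auto simp: ok_def)
      have "\<gamma> s i * (1 - h r) \<le> \<gamma> s i" using g h_range[of r] by (simp add: mult_left_le)
      then show ?thesis using 2(2) g le[of "Suc i"] 2(1) by linarith
    qed (use le in simp)
  qed (use on in \<open>simp add: on_def\<close>)
qed

lemma S_nonneg: "ok s \<Longrightarrow> i \<le> lvl s \<Longrightarrow> 0 \<le> S s i"
proof -
  assume a: "ok s" "i \<le> lvl s"
  then have "\<psi> s i 0 \<le> \<psi> s (lvl s) 0" "\<psi> s (lvl s) 0 \<le> \<psi> s i 0 + (S s i - S s (lvl s))" "S s (lvl s) = 0"
    unfolding ok_def by blast+
  then show ?thesis by linarith
qed

text \<open>By \<open>ok_below\<close> no placed point is further right than the last strand, so
  every coefficient is at most \<open>S s (\<kappa> s)\<close>, and \<open>lift_sum_le\<close>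
  extends this bound to the whole bent strand.\<close>

lemma M_props:
  assumes "ok s"
  shows "\<psi> s (\<kappa> s) y \<le> M s y" "M s y \<le> \<psi> s (\<kappa> s) y + S s (\<kappa> s)" "M s 0 = \<psi> s (\<kappa> s) 0"
    "M s 2 = 0" "r < s \<Longrightarrow> M s (h r) = max (\<psi> s (\<kappa> s) (h r)) (x r)" "continuous_on UNIV (M s)"
proof -
  let ?c = "\<lambda>r. max 0 (x r - \<psi> s (\<kappa> s) (h r))"
  have le: "?c r \<le> S s (\<kappa> s)" if "r < s" for r
  proof -
    have "\<psi> s (lvl s) (h r) \<le> \<psi> s (\<kappa> s) (h r) + S s (\<kappa> s)"
      using assms k_le_lvl[of s] unfolding ok_def by (metis diff_zero order_refl)
    then show ?thesis using ok_below[OF assms that] S_nonneg[OF assms k_le_lvl] by auto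
  qed
  show "\<psi> s (\<kappa> s) y \<le> M s y" using lift_sum_nonneg[of s ?c y] by (simp add: M_def)
  show "M s y \<le> \<psi> s (\<kappa> s) y + S s (\<kappa> s)"
    using lift_sum_le[of s ?c "S s (\<kappa> s)" y] le S_nonneg[OF assms k_le_lvl] by (simp add: M_def)
  show "M s 0 = \<psi> s (\<kappa> s) 0" "M s 2 = 0" using assms by (simp_all add: M_def lift_sum_ends ok_def)
  show "r < s \<Longrightarrow> M s (h r) = max (\<psi> s (\<kappa> s) (h r)) (x r)" by (simp add: M_def lift_sum_at)
  show "continuous_on UNIV (M s)" unfolding M_def[abs_def]
    using assms by (intro continuous_on_add lift_sum_cont) (simp add: ok_def)
qed

lemma strand_order:
  assumes "ok s" "i < j" "j \<le> lvl s" "0 \<le> y" "y \<le> 1"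
  shows "\<psi> s i y + \<gamma> s i \<le> \<psi> s j y"
proof -
  have "\<psi> s i y + \<gamma> s i \<le> \<psi> s (Suc i) y" using assms by (simp add: ok_def)
  also have "\<dots> \<le> \<psi> s j y" using assms by (simp add: ok_def)
  finally show ?thesis .
qed

text \<open>A point not left of strand \<open>\<kappa> s\<close> is caught by the bent strand; a
  point left of it lies on a strand or a descent that the step keeps. Old points thus use strands up
  to \<open>\<kappa> s\<close> only, and in this form the statement passes to the limit.\<close>

lemma on_old:
  assumes "ok s" "r < s" shows "on (Suc s) (\<kappa> s) r"
proof -
  have on: "on s (lvl s) r" using assms by (simp add: ok_def)
  have Mr: "M s (h r) = max (\<psi> s (\<kappa> s) (h r)) (x r)" using M_props(5)[OF assms] .
  show ?thesis
  proof (cases "h r < 1")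
    case True
    then consider i where "i < \<kappa> s" "x r = \<psi> s i (h r)"
      | i where "i < \<kappa> s" "i < lvl s" "x r = \<psi> s i (h r) + \<gamma> s i * (1 - h r)"
      | "\<psi> s (\<kappa> s) (h r) \<le> x r"
    proof -
      consider i where "i \<le> lvl s" "x r = \<psi> s i (h r)"
        | i where "i < lvl s" "x r = \<psi> s i (h r) + \<gamma> s i * (1 - h r)"
        using on True by (auto simp: on_def)
      then show thesis
      proof cases
        case 1
        then show thesis using that(1,3) assms(1) by (cases "i < \<kappa> s") (auto simp: ok_def)
      next
        case (2 i)
        have "\<psi> s (\<kappa> s) (h r) \<le> x r" if "\<not> i < \<kappa> s"
        proof -
          have "\<psi> s (\<kappa> s) (h r) \<le> \<psi> s i (h r)" using assms(1) that by (auto simp: ok_def)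
          moreover have "0 < \<gamma> s i" using assms(1) 2 by (simp add: ok_def)
          then have "0 \<le> \<gamma> s i * (1 - h r)" using True by simp
          ultimately show ?thesis using 2(2) by linarith
        qed
        then show thesis using that(2,3) 2 by blast
      qed
    qed
    then show ?thesis
    proof cases
      case 1
      then show ?thesis using True by (auto simp: on_def psi_Suc intro!: exI[of _ i])
    next
      case 2
      then show ?thesis using True by (auto simp: on_def psi_Suc gamma_Suc intro!: exI[of _ i])
    next
      case 3
      then have "x r = \<psi> (Suc s) (\<kappa> s) (h r)" using Mr by (simp add: psi_Suc)
      then show ?thesis using True by (auto simp: on_def)
    qed
  next
    case False
    then have "x r = \<psi> s (lvl s) (h r)" using on by (simp add: on_def)
    moreover have "\<psi> s (\<kappa> s) (h r) \<le> \<psi> s (lvl s) (h r)" using assms(1) k_le_lvl[of s] by (simp add: ok_def)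
    ultimately have "x r = \<psi> (Suc s) (\<kappa> s) (h r)" using Mr by (simp add: psi_Suc)
    then show ?thesis using False by (simp add: on_def)
  qed
qed

lemma on_old_top:
  assumes "ok s" "r < s" shows "on (Suc s) (Suc (\<kappa> s)) r"
proof -
  have o: "on (Suc s) (\<kappa> s) r" by (rule on_old[OF assms])
  show ?thesis
  proof (cases "h r < 1")
    case True then show ?thesis using o unfolding on_def by simp (meson le_SucI less_SucI)
  next
    case False
    \<comment> \<open>At every old height above 1 the ramp has come down to 0, so the new last
      strand passes through the same points as strand \<open>\<kappa> s\<close>.\<close>
    then have "1 + width s \<le> h r" using width(5)[OF assms(2)] by simp
    then have "ramp (width s) (h r) = 0" by (rule ramp_zero[OF width(1)])
    then show ?thesis using o False by (simp add: on_def psi_Suc)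
  qed
qed

lemma psi_beyond: "\<kappa> s < i \<Longrightarrow> \<psi> (Suc s) i = \<psi> (Suc s) (Suc (\<kappa> s))"
  by (simp add: psi_Suc fun_eq_iff)

lemma on_new: "on (Suc s) (Suc (\<kappa> s)) s"
proof (cases "h s < 1")
  case True
  show ?thesis
  proof (cases "J s div 2 \<le> \<kappa> s")
    case l: True
    show ?thesis
    proof (cases "odd (J s)")
      case o: True
      then have "x s = \<psi> (Suc s) (J s div 2) (h s) + \<gamma> (Suc s) (J s div 2) * (1 - h s)"
        using True l by (simp add: x_eq new_point_def)
      then show ?thesis using True l unfolding on_def by (meson le_imp_less_Suc)
    next
      case False
      then have "x s = \<psi> (Suc s) (J s div 2) (h s)" using True by (simp add: x_eq new_point_def)
      then show ?thesis using True l unfolding on_def by (meson le_SucI)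
    qed
  next
    case False
    then have "x s = \<psi> (Suc s) (Suc (\<kappa> s)) (h s)"
      using True psi_beyond[of s "J s div 2"] by (simp add: x_eq new_point_def)
    then show ?thesis using True by (auto simp: on_def)
  qed
next
  case False
  then have "1 < h s" using h_range[of s] by simp
  then show ?thesis by (simp add: on_def x_eq new_point_def)
qed

lemma ok_Suc:
  assumes I: "ok s" shows "ok (Suc s)"
proof -
  let ?k = "\<kappa> s" and ?g = "(1/2) ^ s :: real"
  note Mp = M_props[OF I]
  have mono: "\<psi> s j y \<le> \<psi> s i y" and bound: "\<psi> s i y \<le> \<psi> s j y + (S s j - S s i)" if "j \<le> i" for i j y
    using I that by (auto simp: ok_def)
  have g: "0 < ?g" by simp
  have gr: "0 \<le> ?g * ramp (width s) y" "?g * ramp (width s) y \<le> ?g" for y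
    using ramp_bounds[of "width s" y] g by (auto intro: mult_left_le)
  show ?thesis unfolding ok_def lvl_Suc
  proof (intro conjI allI impI)
    show "continuous_on UNIV (\<psi> (Suc s) i)" for i
    proof -
      have "\<psi> (Suc s) i = (if i < ?k then \<psi> s i else (\<lambda>y. M s y + (if i = ?k then 0 else ?g * ramp (width s) y)))"
        by (auto simp: psi_Suc fun_eq_iff)
      moreover have "continuous_on UNIV (\<psi> s i)" using I by (simp add: ok_def)
      moreover have "continuous_on UNIV (\<lambda>y. M s y + (if i = ?k then 0 else ?g * ramp (width s) y))"
        by (cases "i = ?k") (auto intro!: continuous_on_add continuous_on_mult continuous_on_const ramp_cont Mp(6))
      ultimately show ?thesis by simp
    qed
    show "\<psi> (Suc s) j y \<le> \<psi> (Suc s) i y" if "j \<le> i" for i j y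
      using mono[of j ?k y] mono[OF that, of y] Mp(1)[of y] gr[of y] that by (auto simp: psi_Suc)
    show "\<psi> (Suc s) i y \<le> \<psi> (Suc s) j y + (S (Suc s) j - S (Suc s) i)" if "j \<le> i" for i j y
    proof -
      obtain e where e: "?g * ramp (width s) y = e" "0 \<le> e" "e \<le> ?g" using gr by blast
      show ?thesis
        using bound[of j ?k y] bound[OF that, of y] Mp(2)[of y] e(2,3) that
        by (auto simp: psi_Suc S_Suc e(1))
    qed
    show "0 < \<gamma> (Suc s) i" if "i < Suc ?k" for i
      using I that k_le_lvl[of s] by (auto simp: gamma_Suc ok_def)
    show "\<psi> (Suc s) (Suc i) 0 = \<psi> (Suc s) i 0 + \<gamma> (Suc s) i" if "i < Suc ?k" for i
    proof -
      have "\<psi> s (Suc i) 0 = \<psi> s i 0 + \<gamma> s i" if "i < ?k" using I that k_le_lvl[of s] by (simp add: ok_def)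
      moreover have "ramp (width s) 0 = 1" by (rule ramp_one[OF width(1)]) simp
      ultimately show ?thesis using that Mp(3)
        by (cases "i = ?k"; cases "Suc i = ?k") (auto simp: psi_Suc gamma_Suc)
    qed
    show "\<psi> (Suc s) i y + \<gamma> (Suc s) i \<le> \<psi> (Suc s) (Suc i) y" if "i < Suc ?k" "0 \<le> y \<and> y \<le> 1" for i y
    proof -
      have "\<psi> s i y + \<gamma> s i \<le> \<psi> s (Suc i) y" if "i < ?k" using I that k_le_lvl[of s] \<open>0 \<le> y \<and> y \<le> 1\<close> by (simp add: ok_def)
      moreover have "ramp (width s) y = 1" using that by (intro ramp_one[OF width(1)]) simp
      ultimately show ?thesis using that Mp(1)[of y]
        by (cases "i = ?k"; cases "Suc i = ?k") (auto simp: psi_Suc gamma_Suc)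
    qed
    show "\<psi> (Suc s) i 2 = 0" for i
    proof -
      have "ramp (width s) 2 = 0" using width(2)[of s] by (intro ramp_zero[OF width(1)]) simp
      then show ?thesis using I Mp(4) by (simp add: psi_Suc ok_def)
    qed
    show "S (Suc s) i = 0" if "Suc ?k \<le> i" for i using that by (simp add: S_Suc)
    show "on (Suc s) (Suc ?k) r" if "r < Suc s" for r
      using that on_new on_old_top[OF I] by (cases "r = s") auto
  qed
qed

lemma ok: "ok s"
proof (induction s)
  case 0 then show ?case by (simp add: ok_def zero_state)
next
  case (Suc s) then show ?case by (rule ok_Suc)
qed

lemma stable:
  assumes "s \<le> t" "\<And>u. s \<le> u \<Longrightarrow> i < \<kappa> u" shows "\<psi> t i = \<psi> s i" "\<gamma> t i = \<gamma> s i"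
proof -
  have "\<psi> t i = \<psi> s i \<and> \<gamma> t i = \<gamma> s i"
    using assms(1)
  proof (induction rule: dec_induct)
    case (step u)
    then show ?case using assms(2)[of u] by (auto simp: psi_Suc gamma_Suc fun_eq_iff)
  qed simp
  then show "\<psi> t i = \<psi> s i" "\<gamma> t i = \<gamma> s i" by auto
qed

text \<open>Input 0 occurs in step 0 only, when there are no points yet through which strand 0 could
  be bent.\<close>

lemma psi_0: "\<psi> s 0 y = 0"
proof (induction s)
  case (Suc s)
  show ?case
  proof (cases s)
    case 0
    then show ?thesis using k0 by (simp add: psi_Suc M_def zero_state lift_sum_def)
  next
    case (Suc t)
    then show ?thesis using kpos[of t] \<open>\<psi> s 0 y = 0\<close> by (simp add: psi_Suc)
  qed
qed (simp add: zero_state)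

lemma S_0: "S s 0 = 2 - 2 * (1/2) ^ s"
proof (induction s)
  case (Suc s)
  show ?case
  proof (cases s)
    case 0 then show ?thesis using k0 by (simp add: S_Suc)
  next
    case (Suc t)
    then show ?thesis using kpos[of t] \<open>S s 0 = _\<close> by (simp add: S_Suc)
  qed
qed (simp add: zero_state)

lemma psi_range: "0 \<le> \<psi> s i y" "\<psi> s i y \<le> 2"
proof -
  have I: "\<psi> s 0 y \<le> \<psi> s i y" "\<psi> s i y \<le> \<psi> s 0 y + (S s 0 - S s i)" using ok[of s] by (auto simp: ok_def)
  moreover have "0 \<le> S s i"
    using S_nonneg[OF ok, of i s] ok[of s] by (cases "i \<le> lvl s") (auto simp: ok_def)
  moreover have "S s 0 \<le> 2" by (simp add: S_0)
  ultimately show "0 \<le> \<psi> s i y" "\<psi> s i y \<le> 2" using psi_0[of s y] by auto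
qed

lemma x_range: "0 \<le> x r" "x r \<le> 2"
proof -
  have o: "on (Suc r) (Suc (\<kappa> r)) r" by (rule on_new)
  have g: "0 \<le> \<gamma> (Suc r) i" if "i < Suc (\<kappa> r)" for i
    using ok[of "Suc r"] that by (simp add: ok_def less_imp_le)
  show "0 \<le> x r"
  proof (cases "h r < 1")
    case True
    then show ?thesis using o g psi_range(1)[of "Suc r"] h_range[of r]
      by (auto simp: on_def intro!: add_nonneg_nonneg mult_nonneg_nonneg)
  qed (use o psi_range(1)[of "Suc r"] in \<open>auto simp: on_def\<close>)
  show "x r \<le> 2"
    using ok_below[OF ok, of r "Suc r"] psi_range(2)[of "Suc r" "lvl (Suc r)" "h r"] by simp
qed

text \<open>Every strand and every descent is eventually final. As each point lies on the strands of
  all later states, none falls strictly between strand \<open>i\<close> and its descent, and these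
  gaps persist in the limit.\<close>

theorem spot_bad:
  assumes "\<And>k. finite {s. \<kappa> s \<le> k}"
  shows "\<exists>(\<psi> :: nat \<Rightarrow> real \<Rightarrow> real) \<gamma>. (\<forall>i. continuous_on UNIV (\<psi> i)) \<and> (\<forall>i. 0 < \<gamma> i) \<and>
     (\<forall>i j y. i < j \<longrightarrow> 0 \<le> y \<longrightarrow> y \<le> 1 \<longrightarrow> \<psi> i y + \<gamma> i \<le> \<psi> j y) \<and>
     (\<forall>i r. h r < 1 \<longrightarrow> x r \<le> \<psi> i (h r) \<or> \<psi> i (h r) + \<gamma> i * (1 - h r) \<le> x r) \<and>
     (\<forall>i. \<exists>r. 1/4 < h r \<and> h r < 3/4 \<and> x r = \<psi> i (h r))"
proof -
  have "\<exists>s. \<forall>u\<ge>s. i < \<kappa> u" for i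
  proof -
    obtain s where "\<forall>u\<in>{u. \<kappa> u \<le> i}. u < s" using assms[of i] finite_nat_set_iff_bounded by blast
    then show ?thesis by (meson leI mem_Collect_eq not_less)
  qed
  then obtain s where s: "\<And>i u. s i \<le> u \<Longrightarrow> i < \<kappa> u" by metis
  define P where "P = (\<lambda>i. \<psi> (s i) i)"
  define G where "G = (\<lambda>i. \<gamma> (s i) i)"
  have P: "\<psi> t i = P i" and G: "\<gamma> t i = G i" if "s i \<le> t" for i t
    using stable[OF that s] by (auto simp: P_def G_def)
  have tp: "i < lvl (Suc t)" if "s i \<le> t" for i t using s[OF that] by simp
  have ord: "P i y + G i \<le> P j y" if "i < j" "0 \<le> y" "y \<le> 1" for i j y
  proof -
    define t where "t = Suc (max (s i) (s j))"
    have "\<psi> t i y + \<gamma> t i \<le> \<psi> t j y"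
      using tp[of j "max (s i) (s j)"] that by (intro strand_order[OF ok]) (auto simp: t_def)
    then show ?thesis using P[of i t] P[of j t] G[of i t] by (simp add: t_def)
  qed
  have pos: "0 < G i" for i
  proof -
    have "0 < \<gamma> (Suc (s i)) i" using ok[of "Suc (s i)"] tp[of i "s i"] by (simp add: ok_def)
    then show ?thesis using G[of i "Suc (s i)"] by simp
  qed
  have apart: "x r \<le> P i (h r) \<or> P i (h r) + G i * (1 - h r) \<le> x r" if r: "h r < 1" for i r
  proof -
    define t where "t = Suc (max (s i) r)"
    have it: "i < lvl t" using tp[of i "max (s i) r"] by (simp add: t_def)
    have e: "P i = \<psi> t i" "G i = \<gamma> t i" using P[of i t] G[of i t] by (auto simp: t_def)
    have gl: "G i * (1 - h r) \<le> G i" using pos[of i] h_range[of r] by (simp add: mult_left_le)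
    have "on t (lvl t) r" using ok[of t] by (simp add: ok_def t_def)
    then consider j where "j \<le> lvl t" "x r = \<psi> t j (h r)"
      | j where "j < lvl t" "x r = \<psi> t j (h r) + \<gamma> t j * (1 - h r)"
      using r by (auto simp: on_def)
    then show ?thesis
    proof cases
      case 1
      show ?thesis
      proof (cases "i < j")
        case True
        have "\<psi> t i (h r) + \<gamma> t i \<le> \<psi> t j (h r)"
          using True 1 r h_range[of r] by (intro strand_order[OF ok]) auto
        then show ?thesis using 1 e gl by simp
      next
        case False
        then show ?thesis using 1 e ok[of t] by (simp add: ok_def)
      qed
    next
      case 2
      have gj: "0 < \<gamma> t j" using ok[of t] 2 by (simp add: ok_def)
      then have gjl: "0 \<le> \<gamma> t j * (1 - h r)" "\<gamma> t j * (1 - h r) \<le> \<gamma> t j"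
        using r h_range[of r] by (auto simp: mult_left_le)
      consider "i = j" | "i < j" | "j < i" by linarith
      then show ?thesis
      proof cases
        case 1 then show ?thesis using 2 e by simp
      next
        case 2
        have "\<psi> t i (h r) + \<gamma> t i \<le> \<psi> t j (h r)"
          using 2 \<open>j < lvl t\<close> r h_range[of r] by (intro strand_order[OF ok]) auto
        then show ?thesis using \<open>x r = _\<close> e gl gjl by simp
      next
        case 3
        have "\<psi> t j (h r) + \<gamma> t j \<le> \<psi> t i (h r)"
          using 3 it r h_range[of r] by (intro strand_order[OF ok]) auto
        then show ?thesis using \<open>x r = _\<close> e gl gjl by simp
      qed
    qed
  qed
  have ex: "\<exists>r. 1/4 < h r \<and> h r < 3/4 \<and> x r = P i (h r)" for i
  proof -
    \<comment> \<open>A request for strand \<open>i\<close> that comes after the strand has become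
      final; \<open>h_dense\<close> supplies it.\<close>
    obtain r where r: "s i \<le> r" "J r = 2 * i" "1/4 < h r" "h r < 3/4"
      using h_dense[of "1/4" "3/4" "s i" "2 * i"] by auto
    then have "x r = \<psi> (Suc r) i (h r)" by (simp add: x_eq new_point_def)
    then show ?thesis using r P[of i "Suc r"] by auto
  qed
  have "continuous_on UNIV (P i)" for i using ok[of "s i"] by (simp add: P_def ok_def)
  then show ?thesis using ord pos apart ex by (intro exI[of _ P] exI[of _ G]) auto
qed

end

section \<open>The limit of a spot whose input has a finite limit inferior\<close>

lemma graph_in_closure:
  fixes f :: "real \<Rightarrow> real"
  assumes f: "continuous_on UNIV f" and ab: "a < b" and y: "a \<le> y" "y \<le> b"
    and dense: "\<And>c d. a \<le> c \<Longrightarrow> c < d \<Longrightarrow> d \<le> b \<Longrightarrow> \<exists>t. c < t \<and> t < d \<and> (t, f t) \<in> P"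
  shows "(y, f y) \<in> closure P"
proof -
  have "\<exists>t. t \<in> {a..b} \<and> \<bar>t - y\<bar> < e \<and> (t, f t) \<in> P" if "0 < e" for e
  proof -
    define c d where "c = max a (y - e)" and "d = min b (y + e)"
    have "a \<le> c" "c < d" "d \<le> b" using that ab y by (auto simp: c_def d_def)
    then obtain t where "c < t" "t < d" "(t, f t) \<in> P" using dense by blast
    then show ?thesis by (intro exI[of _ t]) (auto simp: c_def d_def)
  qed
  then have "\<exists>t. \<bar>t - y\<bar> < 1 / Suc n \<and> (t, f t) \<in> P" for n by (metis zero_less_divide_1_iff of_nat_0_less_iff zero_less_Suc)
  then obtain t where t: "\<And>n. \<bar>t n - y\<bar> < 1 / Suc n" "\<And>n. (t n, f (t n)) \<in> P" by metis
  have "(\<lambda>n. t n - y) \<longlonglongrightarrow> 0"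
  proof (rule Lim_null_comparison)
    show "\<forall>\<^sub>F n in sequentially. norm (t n - y) \<le> 1 / Suc n" using t(1) by (intro always_eventually) (auto intro: less_imp_le)
    show "(\<lambda>n. 1 / real (Suc n)) \<longlonglongrightarrow> 0" using LIMSEQ_inverse_real_of_nat by (simp add: inverse_eq_divide)
  qed
  then have tl: "t \<longlonglongrightarrow> y" by (simp add: LIM_zero_iff)
  have "isCont f y" using f by (simp add: continuous_on_eq_continuous_at)
  then have "(\<lambda>n. f (t n)) \<longlonglongrightarrow> f y" using tl by (rule isCont_tendsto_compose)
  then have "(\<lambda>n. (t n, f (t n))) \<longlonglongrightarrow> (y, f y)" using tl by (intro tendsto_Pair)
  then show ?thesis unfolding closure_sequential using t(2)
    by (intro exI[of _ "\<lambda>n. (t n, f (t n))"]) simp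
qed

lemma mem_strands:
  "(y, z) \<in> strands K \<psi> \<gamma> \<longleftrightarrow>
     (\<exists>i<K. 0 \<le> y \<and> y \<le> 1 \<and> (z = \<psi> i y \<or> z = \<psi> i y + \<gamma> i * (1 - y))) \<or> (0 \<le> y \<and> y \<le> 2 \<and> z = \<psi> K y)"
  unfolding strands_def by (auto simp: image_iff)

context spot
begin

lemma liminf_level:
  assumes "infinite {s. \<kappa> s \<le> k}"
  shows "\<exists>K s0. (\<forall>s\<ge>s0. K \<le> \<kappa> s) \<and> (\<forall>N. \<exists>s\<ge>N. \<kappa> s = K)"
proof -
  define K where "K = (LEAST k. infinite {s. \<kappa> s \<le> k})"
  have K: "infinite {s. \<kappa> s \<le> K}" unfolding K_def using assms by (rule LeastI)
  have fin: "finite {s. \<kappa> s < K}"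
  proof (cases K)
    case (Suc k')
    then have "finite {s. \<kappa> s \<le> k'}" using not_less_Least[of k' "\<lambda>k. infinite {s. \<kappa> s \<le> k}"] by (auto simp: K_def)
    then show ?thesis using Suc by (simp add: less_Suc_eq_le)
  qed simp
  then obtain s0 where s0: "\<forall>s\<in>{s. \<kappa> s < K}. s < s0" using finite_nat_set_iff_bounded by blast
  have "{s. \<kappa> s \<le> K} = {s. \<kappa> s = K} \<union> {s. \<kappa> s < K}" by auto
  then have "infinite {s. \<kappa> s = K}" using K fin by (metis finite_Un)
  then have N: "\<exists>s\<ge>N. \<kappa> s = K" for N unfolding infinite_nat_iff_unbounded_le by auto
  have "K \<le> \<kappa> s" if "s0 \<le> s" for s using s0 that by (meson leI mem_Collect_eq not_less)
  then show ?thesis using N by (intro exI[of _ K] exI[of _ s0]) simp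
qed

text \<open>Let \<open>K\<close> be the limit inferior. Strands below \<open>K\<close> become final.
  Strand \<open>K\<close> only moves to the right, while the right edge \<open>Q\<close> of
  everything beyond it moves to the right by at most \<open>(1/2) ^ t\<close> in step
  \<open>t\<close>. Whenever \<open>K\<close> is attained, strand and edge are close together, which
  squeezes the strand to a limit \<open>R\<close>.\<close>

theorem spot_good:
  assumes "infinite {s. \<kappa> s \<le> k}"
  shows "\<exists>K (\<psi> :: nat \<Rightarrow> real \<Rightarrow> real) \<gamma>. (\<forall>i. continuous_on UNIV (\<psi> i)) \<and>
     (\<forall>i<K. 0 < \<gamma> i \<and> \<psi> (Suc i) 0 = \<psi> i 0 + \<gamma> i \<and> (\<forall>y. 0 \<le> y \<longrightarrow> y \<le> 1 \<longrightarrow> \<psi> i y + \<gamma> i \<le> \<psi> (Suc i) y)) \<and>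
     \<psi> 0 0 = 0 \<and> \<psi> K 2 = 0 \<and>
     (\<forall>r. (h r, x r) \<in> strands K \<psi> \<gamma>) \<and> strands K \<psi> \<gamma> \<subseteq> closure (range (\<lambda>r. (h r, x r)))"
proof -
  obtain K s0 where *: "(\<forall>s\<ge>s0. K \<le> \<kappa> s) \<and> (\<forall>N. \<exists>s\<ge>N. \<kappa> s = K)"
    using liminf_level[OF assms] by (elim exE)
  then have s0: "K \<le> \<kappa> s" if "s0 \<le> s" for s using that by simp
  from * have inf: "\<exists>s\<ge>N. \<kappa> s = K" for N by simp
  have low: "\<psi> t i = \<psi> s0 i" "\<gamma> t i = \<gamma> s0 i" if "i < K" "s0 \<le> t" for i t
    using stable[OF that(2), of i] s0 that(1) by (meson less_le_trans)+
  define Q where "Q t y = \<psi> t K y + S t K" for t y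
  have Kl: "K \<le> lvl t" if "s0 \<le> t" for t using s0[OF that] k_le_lvl[of t] by linarith
  have mono1: "\<psi> t K y \<le> \<psi> (Suc t) K y" and Q1: "Q (Suc t) y \<le> Q t y + (1/2) ^ t" if "s0 \<le> t" for t y
    using s0[OF that] M_props(1,2)[OF ok, of t y] by (auto simp: psi_Suc Q_def S_Suc)
  have mono: "\<psi> s K y \<le> \<psi> t K y" if "s0 \<le> s" "s \<le> t" for s t y
    using that(2)
  proof (induction rule: dec_induct)
    case (step t) then show ?case using mono1[of t y] that(1) by simp
  qed simp
  have Qle: "Q t y \<le> Q s y + 2 * (1/2) ^ s - 2 * (1/2) ^ t" if "s0 \<le> s" "s \<le> t" for s t y
    using that(2)
  proof (induction rule: dec_induct)
    case (step t) then show ?case using Q1[of t y] that(1) by simp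
  qed simp
  \<comment> \<open>After a step \<open>s\<close> with input \<open>K\<close> the room to the right
    of strand \<open>K\<close> is \<open>(1/2) ^ s\<close>, and all later steps together add at most
    another \<open>(1/2) ^ s\<close>.\<close>
  have tail: "\<bar>\<psi> t K y - \<psi> (Suc s) K y\<bar> \<le> 2 * (1/2) ^ s" if "s0 \<le> s" "\<kappa> s = K" "Suc s \<le> t" for s t y
  proof -
    have "0 \<le> S t K" using S_nonneg[OF ok Kl] that by simp
    moreover have "S (Suc s) K = (1/2) ^ s" using that(2) by (simp add: S_Suc)
    moreover have "Q t y \<le> Q (Suc s) y + 2 * (1/2) ^ Suc s - 2 * (1/2) ^ t" using that by (intro Qle) auto
    moreover have "0 < (1/2 :: real) ^ t" by simp
    ultimately have "\<psi> t K y \<le> \<psi> (Suc s) K y + 2 * (1/2) ^ s"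
      unfolding Q_def power_Suc by linarith
    then show ?thesis using mono[of "Suc s" t y] that by simp
  qed
  have small: "\<exists>s\<ge>N. s0 \<le> s \<and> \<kappa> s = K \<and> 2 * (1/2) ^ s < e" if "0 < e" for e :: real and N
  proof -
    obtain n where n: "(1/2) ^ n < e / 2" using real_arch_pow_inv[of "e/2" "1/2"] \<open>0 < e\<close> by auto
    obtain s where s: "max (max n N) s0 \<le> s" "\<kappa> s = K" using inf by blast
    have "(1/2 :: real) ^ s \<le> (1/2) ^ n" using s(1) by (intro power_decreasing) auto
    then have "2 * (1/2 :: real) ^ s < e" using n by linarith
    then show ?thesis using s by (intro exI[of _ s]) auto
  qed
  have conv: "convergent (\<lambda>t. \<psi> t K y)" for y
  proof (rule Cauchy_convergent, rule CauchyI')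
    fix e :: real assume "0 < e"
    then obtain s where s: "s0 \<le> s" "\<kappa> s = K" "2 * (1/2) ^ s < e / 2" using small[of "e/2" 0] half_gt_zero by blast
    have "dist (\<psi> m K y) (\<psi> n K y) < e" if "Suc s \<le> m" "Suc s \<le> n" for m n
      using tail[OF s(1,2) that(1), of y] tail[OF s(1,2) that(2), of y] s(3) unfolding dist_real_def by linarith
    then show "\<exists>M. \<forall>m\<ge>M. \<forall>n>m. dist (\<psi> m K y) (\<psi> n K y) < e" by (intro exI[of _ "Suc s"]) auto
  qed
  define R where "R y = lim (\<lambda>t. \<psi> t K y)" for y
  have R: "(\<lambda>t. \<psi> t K y) \<longlonglongrightarrow> R y" for y
    unfolding R_def using conv by (simp add: convergent_LIMSEQ_iff)
  have Rtail: "\<bar>R y - \<psi> (Suc s) K y\<bar> \<le> 2 * (1/2) ^ s" if "s0 \<le> s" "\<kappa> s = K" for s y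
  proof -
    have "(\<lambda>t. \<bar>\<psi> t K y - \<psi> (Suc s) K y\<bar>) \<longlonglongrightarrow> \<bar>R y - \<psi> (Suc s) K y\<bar>" by (intro tendsto_intros R)
    then show ?thesis by (rule LIMSEQ_le_const2) (use tail[OF that] in blast)
  qed
  have unif: "uniform_limit UNIV (\<lambda>t. \<psi> t K) R sequentially"
  proof (rule uniform_limitI)
    fix e :: real assume "0 < e"
    then obtain s where s: "s0 \<le> s" "\<kappa> s = K" "2 * (1/2) ^ s < e / 2" using small[of "e/2" 0] half_gt_zero by blast
    have "dist (\<psi> t K y) (R y) < e" if "Suc s \<le> t" for t y
      using tail[OF s(1,2) that, of y] Rtail[OF s(1,2), of y] s(3) unfolding dist_real_def by linarith
    then show "\<forall>\<^sub>F t in sequentially. \<forall>y\<in>UNIV. dist (\<psi> t K y) (R y) < e"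
      unfolding eventually_sequentially by blast
  qed
  have cont: "\<forall>\<^sub>F t in sequentially. continuous_on UNIV (\<psi> t K)" using ok by (simp add: ok_def)
  have Rcont: "continuous_on UNIV R" by (rule uniform_limit_theorem[OF cont unif]) simp
  define P where "P i = (if i < K then \<psi> s0 i else R)" for i
  define G where "G = \<gamma> s0"
  have Pc: "continuous_on UNIV (P i)" for i using Rcont ok[of s0] by (simp add: P_def ok_def)
  have Plim: "(\<lambda>t. \<psi> t i y) \<longlonglongrightarrow> P i y" if "i \<le> K" for i y
  proof (cases "i < K")
    case True
    have "\<psi> t i y = P i y" if "s0 \<le> t" for t
      using fun_cong[OF low(1)[OF True that], of y] True by (simp only: P_def if_True)
    then have "\<forall>\<^sub>F t in sequentially. \<psi> t i y = P i y"
      unfolding eventually_sequentially by blast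
    then show ?thesis by (rule tendsto_eventually)
  next
    case False
    then have "i = K" using that by simp
    then show ?thesis using R[of y] by (simp add: P_def)
  qed
  have gK: "i < lvl t" "\<gamma> t i = G i" if "i < K" "s0 \<le> t" for i t
    using low(2)[OF that] Kl[OF that(2)] that(1) by (auto simp: G_def)
  have gp: "0 < G i \<and> \<psi> t (Suc i) 0 = \<psi> t i 0 + G i \<and> (\<forall>y. 0 \<le> y \<and> y \<le> 1 \<longrightarrow> \<psi> t i y + G i \<le> \<psi> t (Suc i) y)"
    if "i < K" "s0 \<le> t" for i t
  proof -
    have A: "\<forall>i<lvl t. 0 < \<gamma> t i \<and> \<psi> t (Suc i) 0 = \<psi> t i 0 + \<gamma> t i \<and> (\<forall>y. 0 \<le> y \<and> y \<le> 1 \<longrightarrow> \<psi> t i y + \<gamma> t i \<le> \<psi> t (Suc i) y)"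
      using ok[of t] unfolding ok_def by blast
    show ?thesis using mp[OF spec[OF A, of i] gK(1)[OF that]] unfolding gK(2)[OF that] .
  qed
  have gaps: "0 < G i \<and> P (Suc i) 0 = P i 0 + G i \<and> (\<forall>y. 0 \<le> y \<longrightarrow> y \<le> 1 \<longrightarrow> P i y + G i \<le> P (Suc i) y)" if i: "i < K" for i
  proof (intro conjI allI impI)
    show "0 < G i" using gp[OF i order_refl] by blast
    have "(\<lambda>t. \<psi> t (Suc i) 0) \<longlonglongrightarrow> P i 0 + G i"
    proof (rule Lim_transform_eventually)
      show "(\<lambda>t. \<psi> t i 0 + G i) \<longlonglongrightarrow> P i 0 + G i" using i by (intro tendsto_intros Plim) simp
      show "\<forall>\<^sub>F t in sequentially. \<psi> t i 0 + G i = \<psi> t (Suc i) 0"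
        unfolding eventually_sequentially
      proof (intro exI allI impI)
        fix t assume "s0 \<le> t"
        then show "\<psi> t i 0 + G i = \<psi> t (Suc i) 0" using gp[OF i] by simp
      qed
    qed
    then show "P (Suc i) 0 = P i 0 + G i" using Plim[of "Suc i" 0] i LIMSEQ_unique by (meson Suc_leI)
    fix y :: real assume y: "0 \<le> y" "y \<le> 1"
    show "P i y + G i \<le> P (Suc i) y"
    proof (rule LIMSEQ_le)
      show "(\<lambda>t. \<psi> t i y + G i) \<longlonglongrightarrow> P i y + G i" using i by (intro tendsto_intros Plim) simp
      show "(\<lambda>t. \<psi> t (Suc i) y) \<longlonglongrightarrow> P (Suc i) y" using i by (intro Plim) simp
      show "\<exists>N. \<forall>t\<ge>N. \<psi> t i y + G i \<le> \<psi> t (Suc i) y"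
      proof (intro exI allI impI)
        fix t assume "s0 \<le> t"
        then show "\<psi> t i y + G i \<le> \<psi> t (Suc i) y" using gp[OF i] y by simp
      qed
    qed
  qed
  have ends: "P 0 0 = 0" "P K 2 = 0"
  proof -
    have "(\<lambda>t. 0) \<longlonglongrightarrow> P 0 0" using Plim[of 0 0] by (simp add: psi_0)
    then show "P 0 0 = 0" by (simp add: LIMSEQ_const_iff)
    have "\<psi> t K 2 = 0" for t using ok[of t] by (simp add: ok_def)
    then have "(\<lambda>t. 0) \<longlonglongrightarrow> P K 2" using Plim[of K 2] by simp
    then show "P K 2 = 0" by (simp add: LIMSEQ_const_iff)
  qed
  have onK: "on (Suc s) K r" if "r < s" "\<kappa> s = K" for r s using on_old[OF ok that(1)] that(2) by simp
  \<comment> \<open>A point that lies on strand \<open>K\<close> infinitely often, at times when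
    \<open>K\<close> is attained, lies on the limit, since the error of \<open>Rtail\<close> at
    these times tends to 0.\<close>
  have limit_pt: "x r = R (h r)" if often: "\<And>N. \<exists>s\<ge>N. s0 \<le> s \<and> \<kappa> s = K \<and> x r = \<psi> (Suc s) K (h r)" for r
  proof (rule ccontr)
    assume "x r \<noteq> R (h r)"
    then have "0 < \<bar>x r - R (h r)\<bar>" by simp
    then obtain n where n: "2 * (1/2) ^ n < \<bar>x r - R (h r)\<bar>" using small[of "\<bar>x r - R (h r)\<bar>" 0] by blast
    obtain s where s: "n \<le> s" "s0 \<le> s" "\<kappa> s = K" "x r = \<psi> (Suc s) K (h r)" using often by blast
    have "\<bar>R (h r) - x r\<bar> \<le> 2 * (1/2) ^ s" using Rtail[OF s(2,3), of "h r"] s(4) by simp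
    also have "\<dots> \<le> 2 * (1/2) ^ n" using s(1) by (simp add: power_decreasing)
    finally show False using n by linarith
  qed
  have high: "x r = R (h r)" if "1 < h r" for r
  proof (rule limit_pt)
    fix N
    obtain s where s: "Suc (max (max N s0) r) \<le> s" "\<kappa> s = K" using inf by blast
    then have "on (Suc s) K r" by (intro onK) auto
    then show "\<exists>s\<ge>N. s0 \<le> s \<and> \<kappa> s = K \<and> x r = \<psi> (Suc s) K (h r)"
      using s that by (intro exI[of _ s]) (auto simp: on_def)
  qed
  have pts: "(h r, x r) \<in> strands K P G" for r
  proof (cases "h r < 1")
    case False
    then have "x r = P K (h r)" using high[of r] h_range[of r] by (simp add: P_def)
    then show ?thesis using h_range[of r] by (auto simp: mem_strands)
  next
    case lt: True
    show ?thesis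
    proof (cases "\<forall>N. \<exists>s\<ge>N. s0 \<le> s \<and> \<kappa> s = K \<and> x r = \<psi> (Suc s) K (h r)")
      case True
      then have "x r = P K (h r)" using limit_pt by (simp add: P_def)
      then show ?thesis using h_range[of r] by (auto simp: mem_strands)
    next
      case False
      \<comment> \<open>From \<open>N\<close> on the point is off strand \<open>K\<close> whenever
        \<open>K\<close> is attained. At such a time \<open>on_old\<close> places it on a lower
        strand or descent, and these are already final.\<close>
      then obtain N where N: "\<And>s. N \<le> s \<Longrightarrow> s0 \<le> s \<Longrightarrow> \<kappa> s = K \<Longrightarrow> x r \<noteq> \<psi> (Suc s) K (h r)" by blast
      obtain s where s: "Suc (max (max N s0) r) \<le> s" "\<kappa> s = K" using inf by blast
      then have "on (Suc s) K r" by (intro onK) auto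
      moreover have "x r \<noteq> \<psi> (Suc s) K (h r)" using s by (intro N) auto
      ultimately consider i where "i < K" "x r = \<psi> (Suc s) i (h r)"
        | i where "i < K" "x r = \<psi> (Suc s) i (h r) + \<gamma> (Suc s) i * (1 - h r)"
        using lt by (auto simp: on_def le_less)
      then show ?thesis
      proof cases
        case 1
        then have "x r = P i (h r)" using low(1)[of i "Suc s"] s by (simp add: P_def)
        then show ?thesis using 1 lt h_range[of r] by (auto simp: mem_strands)
      next
        case 2
        then have "x r = P i (h r) + G i * (1 - h r)" using low[of i "Suc s"] s by (simp add: P_def G_def)
        then show ?thesis using 2 lt h_range[of r] by (auto simp: mem_strands)
      qed
    qed
  qed
  let ?P = "range (\<lambda>r. (h r, x r))"
  have inP: "(h r, v) \<in> ?P" if "x r = v" for r v using that by auto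
  have cl1: "(y, P i y) \<in> closure ?P" if "i < K" "0 \<le> y" "y \<le> 1" for i y
  proof (rule graph_in_closure[OF Pc, of 0 1])
    fix c d :: real assume "0 \<le> c" "c < d" "d \<le> 1"
    then obtain r where r: "s0 \<le> r" "J r = 2 * i" "c < h r" "h r < d" using h_dense[of c d s0 "2 * i"] by auto
    then have "x r = \<psi> (Suc r) i (h r)" using \<open>d \<le> 1\<close> by (simp add: x_eq new_point_def)
    then have "x r = P i (h r)" using low(1)[of i "Suc r"] that(1) r(1) by (simp add: P_def)
    then show "\<exists>t. c < t \<and> t < d \<and> (t, P i t) \<in> ?P" using r inP[of r "P i (h r)"] by blast
  qed (use that in auto)
  have cl2: "(y, P i y + G i * (1 - y)) \<in> closure ?P" if "i < K" "0 \<le> y" "y \<le> 1" for i y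
  proof (rule graph_in_closure[of "\<lambda>y. P i y + G i * (1 - y)" 0 1])
    show "continuous_on UNIV (\<lambda>y. P i y + G i * (1 - y))" by (intro continuous_intros Pc)
    fix c d :: real assume "0 \<le> c" "c < d" "d \<le> 1"
    then obtain r where r: "s0 \<le> r" "J r = 2 * i + 1" "c < h r" "h r < d" using h_dense[of c d s0 "2 * i + 1"] by auto
    then have "i \<le> \<kappa> r" using s0[of r] that(1) by simp
    then have "x r = \<psi> (Suc r) i (h r) + \<gamma> (Suc r) i * (1 - h r)" using \<open>d \<le> 1\<close> r by (simp add: x_eq new_point_def)
    then have "x r = P i (h r) + G i * (1 - h r)" using low[of i "Suc r"] that(1) r(1) by (simp add: P_def G_def)
    then show "\<exists>t. c < t \<and> t < d \<and> (t, P i t + G i * (1 - t)) \<in> ?P" using r inP[of r "P i (h r) + G i * (1 - h r)"] by blast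
  qed (use that in auto)
  \<comment> \<open>Points on strand \<open>K\<close> remain on it: a merge into strand
    \<open>K\<close> passes through the maximum of strand and point, which is the point, and merges
    into later strands leave strand \<open>K\<close> alone.\<close>
  have stay: "\<psi> t K (h r) = x r" if r: "s0 \<le> r" "\<psi> (Suc r) K (h r) = x r" "Suc r \<le> t" for r t
    using r(3)
  proof (induction rule: dec_induct)
    case (step t)
    show ?case
    proof (cases "\<kappa> t = K")
      case True
      then show ?thesis using M_props(5)[OF ok, of r t] step by (simp add: psi_Suc)
    next
      case False
      then show ?thesis using s0[of t] r(1) step by (simp add: psi_Suc)
    qed
  qed (rule r(2))
  have cl3: "(y, R y) \<in> closure ?P" if "0 \<le> y" "y \<le> 1" for y
  proof (rule graph_in_closure[OF Rcont, of 0 1])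
    fix c d :: real assume "0 \<le> c" "c < d" "d \<le> 1"
    then obtain r where r: "s0 \<le> r" "J r = 2 * K" "c < h r" "h r < d" using h_dense[of c d s0 "2 * K"] by auto
    then have e: "\<psi> (Suc r) K (h r) = x r" using \<open>d \<le> 1\<close> by (simp add: x_eq new_point_def)
    have "x r = R (h r)"
    proof (rule limit_pt)
      fix N
      obtain s where "max (max N s0) r \<le> s" "\<kappa> s = K" using inf by blast
      then show "\<exists>s\<ge>N. s0 \<le> s \<and> \<kappa> s = K \<and> x r = \<psi> (Suc s) K (h r)"
        using stay[OF r(1) e, of "Suc s"] by (intro exI[of _ s]) auto
    qed
    then show "\<exists>t. c < t \<and> t < d \<and> (t, R t) \<in> ?P" using r inP[of r "R (h r)"] by blast
  qed (use that in auto)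
  have cl4: "(y, R y) \<in> closure ?P" if "1 \<le> y" "y \<le> 2" for y
  proof (rule graph_in_closure[OF Rcont, of 1 2])
    fix c d :: real assume "1 \<le> c" "c < d" "d \<le> 2"
    then obtain r where r: "c < h r" "h r < d" using h_dense[of c d 0 0] by auto
    then have "x r = R (h r)" using \<open>1 \<le> c\<close> by (intro high) simp
    then show "\<exists>t. c < t \<and> t < d \<and> (t, R t) \<in> ?P" using r inP[of r "R (h r)"] by blast
  qed (use that in auto)
  have "strands K P G \<subseteq> closure ?P"
  proof -
    have "(y, P K y) \<in> closure ?P" if "0 \<le> y" "y \<le> 2" for y
      using cl3[of y] cl4[of y] that by (cases "y \<le> 1") (auto simp: P_def)
    then show ?thesis using cl1 cl2 by (auto simp: mem_strands)
  qed
  then show ?thesis using Pc gaps ends pts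
    by (intro exI[of _ K] exI[of _ P] exI[of _ G] conjI allI impI) simp_all
qed

end

section \<open>Gluing arcs to a circle\<close>

lemma strands_Suc:
  "strands (Suc K) \<psi> \<gamma> = (\<lambda>y. (y, \<psi> 0 y)) ` {0..1} \<union> (\<lambda>y. (y, \<psi> 0 y + \<gamma> 0 * (1 - y))) ` {0..1} \<union>
     strands K (\<lambda>i. \<psi> (Suc i)) (\<lambda>i. \<gamma> (Suc i))"
  unfolding strands_def lessThan_Suc_eq_insert_0 by auto

definition zigzag :: "nat \<Rightarrow> (nat \<Rightarrow> real \<Rightarrow> real) \<Rightarrow> (nat \<Rightarrow> real) \<Rightarrow> bool" where
  "zigzag K \<psi> \<gamma> \<longleftrightarrow> (\<forall>i. continuous_on UNIV (\<psi> i)) \<and>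
     (\<forall>i<K. 0 < \<gamma> i \<and> \<psi> (Suc i) 0 = \<psi> i 0 + \<gamma> i \<and> (\<forall>y. 0 \<le> y \<longrightarrow> y \<le> 1 \<longrightarrow> \<psi> i y + \<gamma> i \<le> \<psi> (Suc i) y))"

lemma zigzag_Suc: "zigzag (Suc K) \<psi> \<gamma> \<Longrightarrow> zigzag K (\<lambda>i. \<psi> (Suc i)) (\<lambda>i. \<gamma> (Suc i))"
  by (auto simp: zigzag_def)

lemma zigzag_lower:
  assumes "zigzag K \<psi> \<gamma>" "(y, z) \<in> strands K \<psi> \<gamma>" "y \<le> 1" shows "\<psi> 0 y \<le> z"
  using assms
proof (induction K arbitrary: \<psi> \<gamma>)
  case 0 then show ?case by (auto simp: mem_strands)
next
  case (Suc K)
  have g: "0 < \<gamma> 0" "\<And>y. 0 \<le> y \<Longrightarrow> y \<le> 1 \<Longrightarrow> \<psi> 0 y + \<gamma> 0 \<le> \<psi> (Suc 0) y" using Suc.prems(1) by (auto simp: zigzag_def)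
  have y0: "0 \<le> y" using Suc.prems(2) by (auto simp: mem_strands)
  consider "z = \<psi> 0 y" | "z = \<psi> 0 y + \<gamma> 0 * (1 - y)" | "(y, z) \<in> strands K (\<lambda>i. \<psi> (Suc i)) (\<lambda>i. \<gamma> (Suc i))"
    using Suc.prems(2) unfolding strands_Suc by auto
  then show ?case
  proof cases
    case 2 then show ?thesis using g Suc.prems(3) by simp
  next
    case 3
    then have "\<psi> (Suc 0) y \<le> z" using Suc.IH[OF zigzag_Suc[OF Suc.prems(1)]] Suc.prems(3) by blast
    then show ?thesis using g(1) g(2)[OF y0 Suc.prems(3)] by linarith
  qed simp
qed

text \<open>The induction splits off the initial ascent \<open>b\<close> and descent
  \<open>c\<close>. Up to height 1 all the rest lies at least \<open>\<gamma> 0\<close> to the right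
  of the first strand, so it misses \<open>b\<close> and meets \<open>c\<close> only at height 0,
  where it begins.\<close>

lemma strands_arc:
  assumes "zigzag K \<psi> \<gamma>"
  shows "\<exists>a. arc a \<and> pathstart a = (0, \<psi> 0 0) \<and> pathfinish a = (2, \<psi> K 2) \<and> path_image a = strands K \<psi> \<gamma>"
  using assms
proof (induction K arbitrary: \<psi> \<gamma>)
  case 0
  define a where "a t = (2 * t, \<psi> 0 (2 * t))" for t :: real
  have c: "continuous_on A (\<lambda>t. \<psi> 0 (2 * t))" for A
  proof (rule continuous_on_compose2[of UNIV "\<psi> 0" A "\<lambda>t. 2 * t"])
    show "continuous_on UNIV (\<psi> 0)" using 0 by (simp add: zigzag_def)
  qed (auto intro!: continuous_intros)
  have "arc a" unfolding arc_def path_def a_def[abs_def]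
    by (auto intro!: continuous_intros c inj_onI)
  moreover have "path_image a = strands 0 \<psi> \<gamma>"
  proof -
    have "(y, \<psi> 0 y) \<in> a ` {0..1}" if "0 \<le> y" "y \<le> 2" for y
      using that by (intro image_eqI[of _ _ "y / 2"]) (auto simp: a_def)
    then show ?thesis unfolding path_image_def by (auto simp: strands_def a_def)
  qed
  moreover have "pathstart a = (0, \<psi> 0 0)" "pathfinish a = (2, \<psi> 0 2)"
    by (simp_all add: a_def pathstart_def pathfinish_def)
  ultimately show ?case by blast
next
  case (Suc K)
  have g: "0 < \<gamma> 0" "\<psi> (Suc 0) 0 = \<psi> 0 0 + \<gamma> 0" "\<And>y. 0 \<le> y \<Longrightarrow> y \<le> 1 \<Longrightarrow> \<psi> 0 y + \<gamma> 0 \<le> \<psi> (Suc 0) y"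
    and cont: "continuous_on UNIV (\<psi> 0)" using Suc.prems by (auto simp: zigzag_def)
  note Z = zigzag_Suc[OF Suc.prems]
  obtain a where a: "arc a" "pathstart a = (0, \<psi> (Suc 0) 0)" "pathfinish a = (2, \<psi> (Suc K) 2)"
     "path_image a = strands K (\<lambda>i. \<psi> (Suc i)) (\<lambda>i. \<gamma> (Suc i))" using Suc.IH[OF Z] by blast
  have low: "\<psi> 0 y + \<gamma> 0 \<le> z" if "(y, z) \<in> path_image a" "0 \<le> y" "y \<le> 1" for y z
    using zigzag_lower[OF Z that(1)[unfolded a(4)] that(3)] g(3)[OF that(2,3)] by linarith
  define b where "b t = (t, \<psi> 0 t)" for t :: real
  define c where "c t = (1 - t, \<psi> 0 (1 - t) + \<gamma> 0 * t)" for t :: real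
  have cc: "continuous_on A (\<lambda>t. \<psi> 0 (1 - t))" "continuous_on A (\<psi> 0)" for A
  proof -
    show "continuous_on A (\<psi> 0)" using cont by (rule continuous_on_subset) simp
    show "continuous_on A (\<lambda>t. \<psi> 0 (1 - t))"
      by (rule continuous_on_compose2[OF cont, of A "\<lambda>t. 1 - t"]) (auto intro!: continuous_intros)
  qed
  have b: "arc b" "pathstart b = (0, \<psi> 0 0)" "pathfinish b = (1, \<psi> 0 1)" "path_image b = (\<lambda>y. (y, \<psi> 0 y)) ` {0..1}"
    unfolding arc_def path_def by (auto simp: b_def[abs_def] pathstart_def pathfinish_def path_image_def intro!: continuous_intros cc inj_onI)
  have c: "arc c" "pathstart c = (1, \<psi> 0 1)" "pathfinish c = (0, \<psi> (Suc 0) 0)"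
    unfolding arc_def path_def using g(2)
    by (auto simp: c_def[abs_def] pathstart_def pathfinish_def intro!: continuous_intros cc inj_onI)
  have c4: "path_image c = (\<lambda>y. (y, \<psi> 0 y + \<gamma> 0 * (1 - y))) ` {0..1}"
  proof -
    have "path_image c = c ` ((\<lambda>y. 1 - y) ` {0..1})" unfolding path_image_def by simp
    also have "\<dots> = (\<lambda>y. (y, \<psi> 0 y + \<gamma> 0 * (1 - y))) ` {0..1}" unfolding image_image c_def by simp
    finally show ?thesis .
  qed
  have d: "arc (c +++ a)"
  proof (rule arc_join[OF c(1) a(1)])
    show "path_image c \<inter> path_image a \<subseteq> {pathstart a}"
    proof
      fix p assume p: "p \<in> path_image c \<inter> path_image a"
      then obtain y where y: "0 \<le> y" "y \<le> 1" "p = (y, \<psi> 0 y + \<gamma> 0 * (1 - y))" unfolding c4 by auto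
      have "\<gamma> 0 * y \<le> 0" using low[of y "\<psi> 0 y + \<gamma> 0 * (1 - y)"] p y by (simp add: algebra_simps)
      then have "y = 0" using g(1) y(1) by (simp add: mult_le_0_iff)
      then show "p \<in> {pathstart a}" using y a(2) g(2) by simp
    qed
  qed (simp add: c a)
  have e: "arc (b +++ (c +++ a))"
  proof (rule arc_join[OF b(1) d])
    show "path_image b \<inter> path_image (c +++ a) \<subseteq> {pathstart (c +++ a)}"
    proof
      fix p assume p: "p \<in> path_image b \<inter> path_image (c +++ a)"
      then obtain y where y: "0 \<le> y" "y \<le> 1" "p = (y, \<psi> 0 y)" unfolding b(4) by auto
      have "p \<in> path_image c \<or> p \<in> path_image a" using p path_image_join[of c a] c(3) a(2) by auto
      then show "p \<in> {pathstart (c +++ a)}"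
      proof
        assume "p \<in> path_image c"
        then have "\<gamma> 0 * (1 - y) = 0" using y unfolding c4 by auto
        then have "y = 1" using g(1) by simp
        then show ?thesis using y c(2) by simp
      next
        assume "p \<in> path_image a"
        then show ?thesis using low[of y "\<psi> 0 y"] y g(1) by simp
      qed
    qed
  qed (simp add: b c)
  have "path_image (b +++ (c +++ a)) = strands (Suc K) \<psi> \<gamma>"
    unfolding strands_Suc using b c a c4 by (simp add: path_image_join Un_assoc)
  then show ?case using e b(2) a(3) by (intro exI[of _ "b +++ (c +++ a)"]) simp
qed

section \<open>Infinitely many arcs joined around a cylinder\<close>

definition dyadic :: "nat \<Rightarrow> real" where "dyadic n = 1 - (1/2) ^ n"

text \<open>Heights from 0 to 2 become angles, in turns, from \<open>dyadic n\<close> to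
  \<open>dyadic (Suc n)\<close>; dividing by 4 puts height 2 halfway between \<open>dyadic n\<close>
  and 1. Shrinking the abscissas by \<open>(1/2) ^ n\<close> makes the spots converge to a single
  point.\<close>

definition place :: "nat \<Rightarrow> real \<times> real \<Rightarrow> real \<times> real" where
  "place n z = (1 - (1/2) ^ n * (1 - fst z / 4), (1/2) ^ n * snd z)"

definition wrap :: "real \<times> real \<Rightarrow> complex \<times> real" where
  "wrap z = (cis (2 * pi * fst z), snd z)"

lemma wrap_cont: "continuous_on A wrap"
  unfolding wrap_def[abs_def] by (intro continuous_intros)

lemma place_cont: "continuous_on A (place n)"
  unfolding place_def[abs_def] by (intro continuous_intros) auto

lemma place_inj: "place n z = place n w \<Longrightarrow> z = w"
  by (auto simp: place_def prod_eq_iff)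

lemma dyadic_Suc: "dyadic (Suc n) = dyadic n + (1/2) ^ Suc n" "dyadic 0 = 0"
  by (simp_all add: dyadic_def)

lemma dyadic_mono: "m \<le> n \<Longrightarrow> dyadic m \<le> dyadic n"
  by (simp add: dyadic_def power_decreasing)

lemma dyadic_less_1: "dyadic n < 1"
  by (simp add: dyadic_def)

lemma dyadic_locate:
  assumes "0 \<le> t" "t < 1" shows "\<exists>n. dyadic n \<le> t \<and> t < dyadic (Suc n)"
proof -
  obtain m where "(1/2) ^ m < 1 - t" using real_arch_pow_inv[of "1 - t" "1/2"] assms by auto
  then have "t < dyadic m" by (simp add: dyadic_def)
  then show ?thesis
  proof (induction m)
    case 0 then show ?case using assms by (simp add: dyadic_Suc)
  next
    case (Suc m) then show ?case by (cases "t < dyadic m") (auto intro: exI[of _ m] simp: not_less)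
  qed
qed

lemma dyadic_unique:
  assumes "dyadic n \<le> t" "t < dyadic (Suc n)" "dyadic m \<le> t" "t < dyadic (Suc m)" shows "n = m"
proof (rule ccontr)
  assume "n \<noteq> m"
  then consider "Suc n \<le> m" | "Suc m \<le> n" by linarith
  then show False using dyadic_mono[of "Suc n" m] dyadic_mono[of "Suc m" n] assms by cases auto
qed

text \<open>A zigzag returns to height 0, so an arc may meet its initial angle repeatedly. It must
  reach height 2 only at its end: then the placed arcs occupy half-open angle intervals and meet
  only where they are joined.\<close>

locale arc_sequence =
  fixes a :: "nat \<Rightarrow> real \<Rightarrow> real \<times> real"
  assumes a_arc: "arc (a n)" and a_start: "a n 0 = (0, 0)" and a_end: "a n 1 = (2, 0)"
    and a_range: "t \<in> {0..1} \<Longrightarrow> 0 \<le> fst (a n t)" "t \<in> {0..1} \<Longrightarrow> fst (a n t) \<le> 2"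
      "t \<in> {0..1} \<Longrightarrow> \<bar>snd (a n t)\<bar> \<le> 2"
    and a_last: "t \<in> {0..1} \<Longrightarrow> fst (a n t) = 2 \<Longrightarrow> a n t = (2, 0)"
begin

definition piece :: "nat \<Rightarrow> real \<Rightarrow> real \<times> real" where
  "piece n t = place n (a n ((t - dyadic n) * 2 ^ Suc n))"

definition glued :: "real \<Rightarrow> real \<times> real" where
  "glued t = (if t < 1 then piece (SOME n. dyadic n \<le> t \<and> t < dyadic (Suc n)) t else (1, 0))"

lemma scaled: 
  assumes "dyadic n \<le> t" "t \<le> dyadic (Suc n)" shows "(t - dyadic n) * 2 ^ Suc n \<in> {0..1}"
proof -
  have "(t - dyadic n) * 2 ^ Suc n \<le> (1/2) ^ Suc n * 2 ^ Suc n"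
    using assms(2) unfolding dyadic_Suc(1) by (intro mult_right_mono) auto
  also have "\<dots> = 1" by (metis power_mult_distrib nonzero_eq_divide_eq power_one zero_neq_numeral)
  finally show ?thesis using assms(1) by simp
qed

lemma glued_eq:
  assumes "dyadic n \<le> t" "t < dyadic (Suc n)" shows "glued t = piece n t"
proof -
  have "(SOME n. dyadic n \<le> t \<and> t < dyadic (Suc n)) = n"
    using assms dyadic_unique by (intro some_equality) auto
  moreover have "t < 1" using assms(2) dyadic_less_1 by (rule less_trans)
  ultimately show ?thesis by (simp add: glued_def)
qed

lemma piece_ends: "piece n (dyadic n) = (dyadic n, 0)" "piece n (dyadic (Suc n)) = (dyadic (Suc n), 0)"
proof -
  show "piece n (dyadic n) = (dyadic n, 0)" by (simp add: piece_def a_start place_def dyadic_def)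
  have "(dyadic (Suc n) - dyadic n) * 2 ^ Suc n = (1/2) ^ Suc n * 2 ^ Suc n" by (simp add: dyadic_Suc(1))
  also have "\<dots> = 1" by (metis power_mult_distrib nonzero_eq_divide_eq power_one zero_neq_numeral)
  finally show "piece n (dyadic (Suc n)) = (dyadic (Suc n), 0)"
    unfolding piece_def by (simp add: a_end place_def dyadic_def)
qed

lemma glued_eq':
  assumes "dyadic n \<le> t" "t \<le> dyadic (Suc n)" shows "glued t = piece n t"
proof (cases "t < dyadic (Suc n)")
  case True then show ?thesis using glued_eq assms by blast
next
  case False
  then have "t = dyadic (Suc n)" using assms by simp
  moreover have "dyadic (Suc n) < dyadic (Suc (Suc n))" by (simp add: dyadic_Suc(1)[of "Suc n"])
  ultimately show ?thesis using glued_eq[of "Suc n" t] piece_ends(1)[of "Suc n"] piece_ends(2)[of n] by simp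
qed

lemma piece_cont: "continuous_on {dyadic n..dyadic (Suc n)} (piece n)"
proof -
  have "continuous_on {0..1} (a n)" using a_arc by (simp add: arc_def path_def)
  then have "continuous_on {dyadic n..dyadic (Suc n)} (\<lambda>t. a n ((t - dyadic n) * 2 ^ Suc n))"
    by (rule continuous_on_compose2) (use scaled in \<open>auto intro!: continuous_intros simp del: power_Suc\<close>)
  then show ?thesis unfolding piece_def[abs_def]
    by (intro continuous_on_compose2[OF place_cont[of UNIV]]) auto
qed

lemma glued_cont_below: "continuous_on {0..dyadic n} glued"
proof (induction n)
  case 0 then show ?case by (simp add: dyadic_def)
next
  case (Suc n)
  have "continuous_on {dyadic n..dyadic (Suc n)} glued"
    using piece_cont by (rule continuous_on_eq) (use glued_eq' in auto)
  with Suc have "continuous_on ({0..dyadic n} \<union> {dyadic n..dyadic (Suc n)}) glued"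
    by (intro continuous_on_closed_Un) auto
  moreover have "0 \<le> dyadic n" "dyadic n \<le> dyadic (Suc n)" using dyadic_mono[of 0 n] dyadic_mono[of n "Suc n"] by (auto simp: dyadic_Suc(2))
  ultimately show ?case by (simp add: ivl_disj_un_two_touch)
qed

lemma piece_bounds:
  assumes "dyadic n \<le> t" "t < dyadic (Suc n)"
  shows "dyadic n \<le> fst (glued t)" "fst (glued t) < dyadic (Suc n)" "\<bar>snd (glued t)\<bar> \<le> 2 * (1/2) ^ n"
proof -
  define v where "v = (t - dyadic n) * 2 ^ Suc n"
  have v: "v \<in> {0..1}" unfolding v_def using assms by (intro scaled) auto
  have "v \<noteq> 1"
  proof
    assume "v = 1"
    then have "t - dyadic n = 1 / 2 ^ Suc n" unfolding v_def by (simp add: field_simps)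
    then show False using assms(2) by (simp add: dyadic_Suc(1) power_one_over)
  qed
  have "fst (a n v) \<noteq> 2"
  proof
    assume "fst (a n v) = 2"
    then have "a n v = a n 1" using a_last[OF v] a_end by simp
    then have "v = 1" using a_arc[of n] v by (auto simp: arc_def inj_on_def)
    then show False using \<open>v \<noteq> 1\<close> by blast
  qed
  then have f: "0 \<le> fst (a n v)" "fst (a n v) < 2" using a_range[OF v, of n] by auto
  have g: "glued t = place n (a n v)" using glued_eq[OF assms] by (simp add: piece_def v_def)
  have p: "0 < (1/2 :: real) ^ n" by simp
  have "(1/2) ^ n * (1 - fst (a n v) / 4) \<le> (1/2) ^ n * (1::real)" using f by (intro mult_left_mono) auto
  then show "dyadic n \<le> fst (glued t)" by (simp add: g place_def dyadic_def)
  have "(1/2) ^ n * (1/2 :: real) < (1/2) ^ n * (1 - fst (a n v) / 4)" using f by (intro mult_strict_left_mono) auto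
  then show "fst (glued t) < dyadic (Suc n)" by (simp add: g place_def dyadic_def)
  have "(1/2) ^ n * \<bar>snd (a n v)\<bar> \<le> (1/2) ^ n * (2::real)" using a_range(3)[OF v] by (intro mult_left_mono) auto
  then show "\<bar>snd (glued t)\<bar> \<le> 2 * (1/2) ^ n" by (simp add: g place_def abs_mult)
qed

text \<open>On the \<open>n\<close>th interval \<open>(1/2) ^ n < 2 * (1 - t)\<close>, while angle
  and abscissa there differ from their limits by at most \<open>(1/2) ^ n\<close> and
  \<open>2 * (1/2) ^ n\<close>. This gives continuity at the accumulation point of the
  spots.\<close>

lemma glued_near_1:
  assumes "0 \<le> t" "t \<le> 1" shows "\<bar>fst (glued t) - 1\<bar> \<le> 2 * (1 - t)" "\<bar>snd (glued t)\<bar> \<le> 4 * (1 - t)"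
proof -
  have "\<bar>fst (glued t) - 1\<bar> \<le> 2 * (1 - t) \<and> \<bar>snd (glued t)\<bar> \<le> 4 * (1 - t)"
  proof (cases "t < 1")
    case True
    then obtain n where n: "dyadic n \<le> t" "t < dyadic (Suc n)" using dyadic_locate assms by blast
    then have "(1/2) ^ n < 2 * (1 - t)" by (simp add: dyadic_def)
    moreover have "fst (glued t) < 1" using piece_bounds(2)[OF n] dyadic_less_1[of "Suc n"] by linarith
    ultimately show ?thesis using piece_bounds(1,3)[OF n] by (simp add: dyadic_def)
  next
    case False then show ?thesis using assms by (simp add: glued_def)
  qed
  then show "\<bar>fst (glued t) - 1\<bar> \<le> 2 * (1 - t)" "\<bar>snd (glued t)\<bar> \<le> 4 * (1 - t)" by auto
qed

lemma glued_cont: "continuous_on {0..1} glued"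
  unfolding continuous_on_def
proof
  fix t :: real assume t: "t \<in> {0..1}"
  show "(glued \<longlongrightarrow> glued t) (at t within {0..1})"
  proof (cases "t < 1")
    case True
    then obtain n where n: "t < dyadic (Suc n)" using dyadic_locate t by auto
    have "(glued \<longlongrightarrow> glued t) (at t within {0..dyadic (Suc n)})"
      using glued_cont_below[of "Suc n"] n t by (auto simp: continuous_on_def)
    moreover have "at t within {0..dyadic (Suc n)} = at t within {0..1}"
      using n dyadic_less_1[of "Suc n"] by (intro at_within_nhd[of _ "{..<dyadic (Suc n)}"]) auto
    ultimately show ?thesis by simp
  next
    case False
    then have t1: "t = 1" using t by simp
    have ev: "\<forall>\<^sub>F s in at 1 within {0..1}. 0 \<le> s \<and> s \<le> (1::real)"
      by (auto simp: eventually_at_filter)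
    have "((\<lambda>s. fst (glued s) - 1) \<longlongrightarrow> 0) (at 1 within {0..1})"
    proof (rule Lim_null_comparison)
      show "\<forall>\<^sub>F s in at 1 within {0..1}. norm (fst (glued s) - 1) \<le> 2 * (1 - s)"
        using ev by eventually_elim (use glued_near_1(1) in auto)
      have "((\<lambda>s. 2 * (1 - s)) \<longlongrightarrow> 2 * (1 - 1)) (at 1 within {0..1::real})" by (intro tendsto_intros)
      then show "((\<lambda>s. 2 * (1 - s)) \<longlongrightarrow> 0) (at 1 within {0..1::real})" by simp
    qed
    then have 1: "((\<lambda>s. fst (glued s)) \<longlongrightarrow> 1) (at 1 within {0..1})" by (simp add: LIM_zero_iff)
    have 2: "((\<lambda>s. snd (glued s)) \<longlongrightarrow> 0) (at 1 within {0..1})"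
    proof (rule Lim_null_comparison)
      show "\<forall>\<^sub>F s in at 1 within {0..1}. norm (snd (glued s)) \<le> 4 * (1 - s)"
        using ev by eventually_elim (use glued_near_1(2) in auto)
      have "((\<lambda>s. 4 * (1 - s)) \<longlongrightarrow> 4 * (1 - 1)) (at 1 within {0..1::real})" by (intro tendsto_intros)
      then show "((\<lambda>s. 4 * (1 - s)) \<longlongrightarrow> 0) (at 1 within {0..1::real})" by simp
    qed
    have "((\<lambda>s. (fst (glued s), snd (glued s))) \<longlongrightarrow> (1, 0)) (at 1 within {0..1})"
      by (intro tendsto_Pair 1 2)
    moreover have "glued 1 = (1, 0)" by (simp add: glued_def)
    ultimately show ?thesis by (simp add: t1)
  qed
qed

lemma glued_inj:
  assumes "0 \<le> s" "s < 1" "0 \<le> t" "t < 1" "glued s = glued t" shows "s = t"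
proof -
  obtain n where n: "dyadic n \<le> s" "s < dyadic (Suc n)" using dyadic_locate assms by blast
  obtain m where m: "dyadic m \<le> t" "t < dyadic (Suc m)" using dyadic_locate assms by blast
  have "n = m" using piece_bounds(1,2)[OF n] piece_bounds(1,2)[OF m] assms(5) by (intro dyadic_unique[of n "fst (glued s)"]) auto
  then have "piece n s = piece n t" using glued_eq[OF n] glued_eq[OF m] assms(5) by simp
  then have "a n ((s - dyadic n) * 2 ^ Suc n) = a n ((t - dyadic n) * 2 ^ Suc n)"
    unfolding piece_def by (rule place_inj)
  moreover have "(s - dyadic n) * 2 ^ Suc n \<in> {0..1}" "(t - dyadic n) * 2 ^ Suc n \<in> {0..1}"
    using scaled[of n s] scaled[of n t] n m \<open>n = m\<close> less_imp_le by blast+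
  ultimately have "(s - dyadic n) * 2 ^ Suc n = (t - dyadic n) * 2 ^ Suc n"
    using a_arc[of n] unfolding arc_def inj_on_def by blast
  then show ?thesis by simp
qed

lemma glued_fst: "0 \<le> t \<Longrightarrow> t < 1 \<Longrightarrow> 0 \<le> fst (glued t) \<and> fst (glued t) < 1"
proof -
  assume "0 \<le> t" "t < 1"
  then obtain n where n: "dyadic n \<le> t" "t < dyadic (Suc n)" using dyadic_locate by blast
  then show ?thesis using piece_bounds[OF n] dyadic_mono[of 0 n] dyadic_less_1[of "Suc n"] by (simp add: dyadic_Suc(2))
qed

lemma wrap_eq:
  assumes "0 \<le> fst z" "fst z < 1" "0 \<le> fst w" "fst w < 1" "wrap z = wrap w" shows "z = w"
proof -
  have "cis (2 * pi * fst z) = cis (2 * pi * fst w)" using assms(5) by (simp add: wrap_def)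
  then obtain n :: int where n: "2 * pi * fst z = 2 * pi * fst w + 2 * pi * n"
    using sin_cos_eq_iff[of "2 * pi * fst z" "2 * pi * fst w"] by (auto simp: complex_eq_iff)
  then have "2 * pi * fst z = 2 * pi * (fst w + n)" by (simp add: distrib_left)
  then have "fst z = fst w + n" by simp
  moreover from this have "n = 0" using assms by linarith
  ultimately show ?thesis using assms(5) by (simp add: wrap_def prod_eq_iff)
qed

lemma glued_image: "wrap ` glued ` {0..1} = insert (1, 0) (\<Union>n. wrap ` place n ` path_image (a n))"
proof (rule subset_antisym)
  show "wrap ` glued ` {0..1} \<subseteq> insert (1, 0) (\<Union>n. wrap ` place n ` path_image (a n))"
  proof (rule subsetI)
    fix p assume "p \<in> wrap ` glued ` {0..1}"
    then obtain t where t: "t \<in> {0..1}" "p = wrap (glued t)" by blast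
    show "p \<in> insert (1, 0) (\<Union>n. wrap ` place n ` path_image (a n))"
    proof (cases "t < 1")
      case True
      then obtain n where n: "dyadic n \<le> t" "t < dyadic (Suc n)" using dyadic_locate[of t] t(1) by auto
      then have "(t - dyadic n) * 2 ^ Suc n \<in> {0..1}" by (intro scaled) auto
      then have "wrap (glued t) \<in> wrap ` place n ` path_image (a n)"
        unfolding glued_eq[OF n] piece_def path_image_def by blast
      then show ?thesis using t by blast
    qed (use t in \<open>auto simp: glued_def wrap_def\<close>)
  qed
  have "place n (a n v) \<in> glued ` {0..1}" if v: "v \<in> {0..1}" for n v
  proof (intro image_eqI[where x = "dyadic n + v * (1/2) ^ Suc n"])
    let ?t = "dyadic n + v * (1/2) ^ Suc n"
    have b: "dyadic n \<le> ?t" "?t \<le> dyadic (Suc n)"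
      using v unfolding dyadic_Suc(1) by (auto simp: mult_left_le_one_le)
    have "(?t - dyadic n) * 2 ^ Suc n = v * ((1/2) ^ Suc n * 2 ^ Suc n)" by simp
    also have "(1/2 :: real) ^ Suc n * 2 ^ Suc n = 1" by (metis power_mult_distrib nonzero_eq_divide_eq power_one zero_neq_numeral)
    finally have e: "(?t - dyadic n) * 2 ^ Suc n = v" by (simp only: mult_1_right)
    show "place n (a n v) = glued ?t" unfolding glued_eq'[OF b] piece_def e ..
    show "?t \<in> {0..1}" using b dyadic_mono[of 0 n] dyadic_less_1[of "Suc n"] by (simp add: dyadic_Suc(2))
  qed
  then have "wrap ` place n ` path_image (a n) \<subseteq> wrap ` glued ` {0..1}" for n
    unfolding path_image_def by (intro image_mono) auto
  moreover have "(1, 0) \<in> wrap ` glued ` {0..1}"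
  proof (rule image_eqI)
    show "(1, 0) = wrap (1, 0)" by (simp add: wrap_def)
    show "(1, 0) \<in> glued ` {0..1}" by (rule image_eqI[where x = 1]) (auto simp: glued_def)
  qed
  ultimately show "insert (1, 0) (\<Union>n. wrap ` place n ` path_image (a n)) \<subseteq> wrap ` glued ` {0..1}" by blast
qed

text \<open>The glued path runs from angle 0 to angle 1 with abscissa 0 at both ends, so wrapping
  closes it up. All other angles are below 1, hence wrapping identifies nothing else and the closed
  path is simple.\<close>

theorem glued_circle:
  "insert (1, 0) (\<Union>n. wrap ` place n ` path_image (a n)) homeomorphic sphere (0::complex) 1"
    "compact (insert (1, 0) (\<Union>n. wrap ` place n ` path_image (a n)))"
proof -
  define g where "g = wrap \<circ> glued"
  have cont: "continuous_on {0..1} g"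
    unfolding g_def by (rule continuous_on_compose[OF glued_cont wrap_cont])
  have p: "path g" unfolding path_def by (rule cont)
  have g0: "glued 0 = (0, 0)"
    using glued_eq'[of 0 0] piece_ends(1)[of 0] by (simp add: dyadic_def)
  have g1: "g 1 = (1, 0)" and g00: "g 0 = (1, 0)" using g0 by (auto simp: g_def glued_def wrap_def)
  have one: "s = 0" if "0 \<le> s" "s < 1" "g s = (1, 0)" for s
  proof -
    have "wrap (glued s) = wrap (glued 0)" using that g00 by (simp add: g_def)
    then have "glued s = glued 0" using glued_fst[of s] that by (intro wrap_eq) (auto simp: g0)
    then show ?thesis using glued_inj[of s 0] that by simp
  qed
  have "loop_free g" unfolding loop_free_def
  proof (intro ballI impI)
    fix s t :: real assume st: "s \<in> {0..1}" "t \<in> {0..1}" "g s = g t"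
    show "s = t \<or> s = 0 \<and> t = 1 \<or> s = 1 \<and> t = 0"
    proof (cases "s < 1 \<and> t < 1")
      case True
      then have "glued s = glued t" using st glued_fst[of s] glued_fst[of t] by (intro wrap_eq) (auto simp: g_def)
      then show ?thesis using glued_inj[of s t] st True by auto
    next
      case False
      then show ?thesis using one[of s] one[of t] st g1 by force
    qed
  qed
  then have sp: "simple_path g" using p by (simp add: simple_path_def)
  have img: "path_image g = insert (1, 0) (\<Union>n. wrap ` place n ` path_image (a n))"
  proof -
    have "path_image g = wrap ` glued ` {0..1}" by (simp add: path_image_def g_def image_comp)
    then show ?thesis using glued_image by simp
  qed
  have "path_image g homeomorphic sphere (0::complex) 1"
    by (rule homeomorphic_simple_path_image_circle[OF sp]) (auto simp: pathstart_def pathfinish_def g1 g00)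
  then show "insert (1, 0) (\<Union>n. wrap ` place n ` path_image (a n)) homeomorphic sphere (0::complex) 1"
    using img by simp
  show "compact (insert (1, 0) (\<Union>n. wrap ` place n ` path_image (a n)))"
    using compact_path_image[OF p] img by simp
qed

end

section \<open>The space of an input\<close>

text \<open>This recovers the height from the angle of a point of the \<open>n\<close>th spot,
  undoing \<open>place n\<close> and \<open>wrap\<close> in the first coordinate.\<close>

definition height :: "nat \<Rightarrow> complex \<times> real \<Rightarrow> real" where
  "height n z = 4 * (1 - 2 ^ n * (1 - Arg2pi (fst z) / (2 * pi)))"

lemma half_power: "(1/2 :: real) ^ n * 2 ^ n = 1"
  by (metis power_mult_distrib nonzero_eq_divide_eq power_one zero_neq_numeral)

lemma place_fst_bounds:
  assumes "0 < y" "y < 2"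
  shows "dyadic n < fst (place n (y, x))" "fst (place n (y, x)) < dyadic (Suc n)"
proof -
  have "(1/2) ^ n * (1 - y / 4) < (1/2) ^ n * (1::real)" "(1/2) ^ n * (1/2::real) < (1/2) ^ n * (1 - y / 4)"
    using assms by (auto intro!: mult_strict_left_mono)
  then show "dyadic n < fst (place n (y, x))" "fst (place n (y, x)) < dyadic (Suc n)"
    by (simp_all add: place_def dyadic_def)
qed

lemma height_site:
  assumes "0 < y" "y < 2"
  shows "height n (wrap (place n (y, x))) = y" "fst (wrap (place n (y, x))) \<notin> \<real>\<^sub>\<ge>\<^sub>0"
    "Arg2pi (fst (wrap (place n (y, x)))) = 2 * pi * fst (place n (y, x))"
proof -
  let ?u = "fst (place n (y, x))"
  have u: "0 < ?u" "?u < 1"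
    using place_fst_bounds[OF assms, of n x] dyadic_mono[of 0 n] dyadic_less_1[of "Suc n"] by (auto simp: dyadic_Suc(2))
  then show A: "Arg2pi (fst (wrap (place n (y, x)))) = 2 * pi * ?u"
    by (simp add: wrap_def Arg2pi_cis)
  have "height n (wrap (place n (y, x))) = 4 * (1 - 2 ^ n * (1 - ?u))" by (simp add: height_def A)
  also have "\<dots> = 4 * (1 - (1/2) ^ n * 2 ^ n * (1 - y / 4))" by (simp add: place_def)
  also have "\<dots> = y" unfolding half_power by simp
  finally show "height n (wrap (place n (y, x))) = y" .
  show "fst (wrap (place n (y, x))) \<notin> \<real>\<^sub>\<ge>\<^sub>0"
    using A u by (auto simp: Arg2pi_eq_0 complex_nonneg_Reals_iff complex_is_Real_iff
        dest: Arg2pi_eq_0[THEN iffD2, OF conjI, rotated])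
qed

lemma height_isCont:
  assumes "fst z \<notin> \<real>\<^sub>\<ge>\<^sub>0" shows "isCont (height n) z"
proof -
  have "isCont (\<lambda>z. Arg2pi (fst z)) z"
    by (rule isCont_o2[OF isCont_fst[OF continuous_ident] continuous_at_Arg2pi[OF assms]])
  then show ?thesis unfolding height_def[abs_def] divide_inverse by (intro continuous_intros)
qed

text \<open>A connected neighbourhood of \<open>l\<close> inside \<open>W\<close> contains
  \<open>p k\<close> and \<open>p (Suc k)\<close> for large \<open>k\<close>. There
  \<open>c k\<close> takes both signs, so it would have a zero.\<close>

lemma not_locally_connected_gaps:
  fixes X W :: "'a::metric_space set"
  assumes lc: "locally connected X" and W: "open W" "l \<in> X" "l \<in> W"
    and p: "\<And>k. p k \<in> X" "p \<longlonglongrightarrow> l"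
    and c: "\<And>k. continuous_on W (c k)" "\<And>k z. z \<in> X \<Longrightarrow> z \<in> W \<Longrightarrow> c k z \<noteq> (0::real)"
    and sign: "\<And>k. c k (p k) < 0" "\<And>k m. k < m \<Longrightarrow> 0 < c k (p m)"
  shows False
proof -
  have "openin (top_of_set X) (X \<inter> W)" using W(1) by (auto simp: openin_open)
  then obtain u v where uv: "openin (top_of_set X) u" "connected v" "l \<in> u" "u \<subseteq> v" "v \<subseteq> X \<inter> W"
    using lc W(2,3) unfolding locally_def by (metis IntI)
  obtain U where U: "open U" "u = X \<inter> U" using uv(1) by (auto simp: openin_open)
  have "\<forall>\<^sub>F k in sequentially. p k \<in> U" using p(2) U uv(3) by (intro topological_tendstoD) auto
  then obtain k where k: "\<And>m. k \<le> m \<Longrightarrow> p m \<in> U" unfolding eventually_sequentially by blast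
  then have in_v: "p k \<in> v" "p (Suc k) \<in> v" using U p(1) uv(4) by auto
  have "continuous_on v (c k)" using c(1) uv(5) by (meson continuous_on_subset le_inf_iff)
  then have con: "connected (c k ` v)" using uv(2) by (rule connected_continuous_image)
  have "0 \<in> c k ` v"
  proof (rule connectedD_interval[OF con])
    show "c k (p k) \<in> c k ` v" "c k (p (Suc k)) \<in> c k ` v" using in_v by auto
    show "c k (p k) \<le> 0" "0 \<le> c k (p (Suc k))" using sign(1)[of k] sign(2)[of k "Suc k"] by auto
  qed
  then show False using c(2) uv(5) by force
qed

context heights
begin

definition site :: "(nat \<Rightarrow> nat \<Rightarrow> nat) \<Rightarrow> nat \<Rightarrow> complex \<times> real" where
  "site \<kappa> m = (case prod_decode m of (n, r) \<Rightarrow> wrap (place n (h r, spot_x (\<kappa> n) r)))"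

lemma site_encode: "site \<kappa> (prod_encode (n, r)) = wrap (place n (h r, spot_x (\<kappa> n) r))"
  by (simp add: site_def)

lemma range_site: "range (site \<kappa>) = (\<Union>n. range (\<lambda>r. wrap (place n (h r, spot_x (\<kappa> n) r))))"
proof (rule subset_antisym)
  show "range (site \<kappa>) \<subseteq> (\<Union>n. range (\<lambda>r. wrap (place n (h r, spot_x (\<kappa> n) r))))"
  proof (rule subsetI)
    fix p assume "p \<in> range (site \<kappa>)"
    then obtain m where m: "p = site \<kappa> m" by blast
    obtain n r where "prod_decode m = (n, r)" by fastforce
    then have "p = wrap (place n (h r, spot_x (\<kappa> n) r))" by (simp add: m site_def)
    then show "p \<in> (\<Union>n. range (\<lambda>r. wrap (place n (h r, spot_x (\<kappa> n) r))))" by blast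
  qed
  show "(\<Union>n. range (\<lambda>r. wrap (place n (h r, spot_x (\<kappa> n) r)))) \<subseteq> range (site \<kappa>)"
  proof (rule subsetI)
    fix p assume "p \<in> (\<Union>n. range (\<lambda>r. wrap (place n (h r, spot_x (\<kappa> n) r))))"
    then obtain n r where "p = wrap (place n (h r, spot_x (\<kappa> n) r))" by blast
    then have "p = site \<kappa> (prod_encode (n, r))" by (simp only: site_encode)
    then show "p \<in> range (site \<kappa>)" by (rule range_eqI)
  qed
qed

lemma site_determines:
  assumes "wrap (place n (h r, x)) = wrap (place n' (y', x'))" "0 < y'" "y' < 2"
  shows "n = n' \<and> h r = y' \<and> x = x'"
proof -
  have f: "fst (place n (h r, x)) = fst (place n' (y', x'))"
    using height_site(3)[OF h_range(1,2), of n r x] height_site(3)[OF assms(2,3), of n' x'] assms(1) by simp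
  then have n: "n = n'"
    using place_fst_bounds[OF h_range(1,2), of n r x] place_fst_bounds[OF assms(2,3), of n' x']
    by (intro dyadic_unique[of n "fst (place n (h r, x))"]) auto
  have "place n (h r, x) = place n (y', x')" using f assms(1) n by (simp add: wrap_def prod_eq_iff)
  then have "(h r, x) = (y', x')" by (rule place_inj)
  then show ?thesis using n by simp
qed

lemma inj_site: "inj (site \<kappa>)"
proof (rule injI)
  fix a b assume e: "site \<kappa> a = site \<kappa> b"
  obtain n r where a: "a = prod_encode (n, r)" by (metis prod_decode_inverse prod.exhaust)
  obtain n' r' where b: "b = prod_encode (n', r')" by (metis prod_decode_inverse prod.exhaust)
  have "n = n' \<and> h r = h r' \<and> spot_x (\<kappa> n) r = spot_x (\<kappa> n') r'"
    using e h_range unfolding a b site_encode by (intro site_determines) auto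
  then show "a = b" using h_inj a b by (auto dest: injD)
qed

text \<open>The points of each spot lie on an arc in which they are dense, and the placed arcs
  together with the limit point of the spots form a compact, hence closed, set.\<close>

theorem good_circle:
  assumes spots: "\<And>n. spot h J (\<kappa> n)" and good: "\<And>n. \<exists>k. infinite {s. \<kappa> n s \<le> k}"
  shows "closure (range (site \<kappa>)) homeomorphic sphere (0::complex) 1"
proof -
  define Q where "Q n = range (\<lambda>r. (h r, spot_x (\<kappa> n) r))" for n
  have xr: "0 \<le> spot_x (\<kappa> n) r" "spot_x (\<kappa> n) r \<le> 2" for n r
    using spot.x_range[OF spots] spot.x_def[OF spots] by (metis, metis)
  have "\<exists>a. arc a \<and> pathstart a = (0, 0) \<and> pathfinish a = (2, 0) \<and> Q n \<subseteq> path_image a \<and>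
      path_image a \<subseteq> closure (Q n) \<and> (\<forall>z. (2, z) \<in> path_image a \<longrightarrow> z = 0)" for n
  proof -
    interpret spot h J "\<kappa> n" by (rule spots)
    obtain k where "infinite {s. \<kappa> n s \<le> k}" using good by blast
    from spot_good[OF this] obtain K \<psi> \<gamma> where S: "zigzag K \<psi> \<gamma>" "\<psi> 0 0 = 0" "\<psi> K 2 = 0"
       "\<And>r. (h r, x r) \<in> strands K \<psi> \<gamma>" "strands K \<psi> \<gamma> \<subseteq> closure (range (\<lambda>r. (h r, x r)))"
      unfolding zigzag_def by blast
    obtain a where a: "arc a" "pathstart a = (0, \<psi> 0 0)" "pathfinish a = (2, \<psi> K 2)" "path_image a = strands K \<psi> \<gamma>"
      using strands_arc[OF S(1)] by blast
    have Q: "Q n = range (\<lambda>r. (h r, x r))" by (simp add: Q_def x_def)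
    have "\<forall>z. (2, z) \<in> path_image a \<longrightarrow> z = 0" unfolding a(4) by (auto simp: mem_strands S(3))
    then show ?thesis using a S unfolding Q by (intro exI[of _ a]) auto
  qed
  then obtain a where a: "\<And>n. arc (a n)" "\<And>n. pathstart (a n) = (0, 0)" "\<And>n. pathfinish (a n) = (2, 0)"
     "\<And>n. Q n \<subseteq> path_image (a n)" "\<And>n. path_image (a n) \<subseteq> closure (Q n)"
     "\<And>n z. (2, z) \<in> path_image (a n) \<Longrightarrow> z = 0" by metis
  have box: "path_image (a n) \<subseteq> {0..2} \<times> {0..2}" for n
  proof -
    have "Q n \<subseteq> {0..2} \<times> {0..2}" unfolding Q_def using less_imp_le[OF h_range(1)] less_imp_le[OF h_range(2)] xr by auto
    then have "closure (Q n) \<subseteq> {0..2} \<times> {0..2}" by (intro closure_minimal closed_Times) auto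
    then show ?thesis using a(5) by blast
  qed
  interpret A: arc_sequence a
  proof
    show "arc (a n)" "a n 0 = (0, 0)" "a n 1 = (2, 0)" for n
      using a(1-3) by (auto simp: pathstart_def pathfinish_def)
    fix n and t :: real assume "t \<in> {0..1}"
    then have t: "a n t \<in> path_image (a n)" by (auto simp: path_image_def)
    then show "0 \<le> fst (a n t)" "fst (a n t) \<le> 2" "\<bar>snd (a n t)\<bar> \<le> 2" using box[of n] by (auto simp: mem_Times_iff)
    show "a n t = (2, 0)" if "fst (a n t) = 2"
      using a(6)[of "snd (a n t)" n] t that by (metis prod.collapse)
  qed
  have "closure (range (site \<kappa>)) = insert (1, 0) (\<Union>n. wrap ` place n ` path_image (a n))" (is "_ = ?Z")
  proof (rule subset_antisym)
    show "closure (range (site \<kappa>)) \<subseteq> ?Z"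
    proof (rule closure_minimal)
      show "range (site \<kappa>) \<subseteq> ?Z" unfolding range_site using a(4) unfolding Q_def by blast
      show "closed ?Z" by (rule compact_imp_closed[OF A.glued_circle(2)])
    qed
    have "wrap ` place n ` path_image (a n) \<subseteq> closure (range (site \<kappa>))" for n
    proof -
      have "wrap ` place n ` closure (Q n) \<subseteq> wrap ` closure (place n ` Q n)"
        by (intro image_mono image_closure_subset place_cont closure_subset) simp
      also have "\<dots> \<subseteq> closure (wrap ` place n ` Q n)"
        by (intro image_closure_subset wrap_cont closure_subset) simp
      also have "wrap ` place n ` Q n \<subseteq> range (site \<kappa>)" unfolding range_site Q_def by blast
      then have "closure (wrap ` place n ` Q n) \<subseteq> closure (range (site \<kappa>))" by (rule closure_mono)
      finally show ?thesis using a(5)[of n] by blast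
    qed
    moreover have "(1, 0) \<in> closure (range (site \<kappa>))"
    proof -
      define q where "q n = place n (h 0, spot_x (\<kappa> n) 0)" for n
      have z: "(\<lambda>n. (1/2::real) ^ n) \<longlonglongrightarrow> 0" by (rule LIMSEQ_realpow_zero) auto
      have "(\<lambda>n. 1 - (1/2) ^ n * (1 - h 0 / 4)) \<longlonglongrightarrow> 1 - 0 * (1 - h 0 / 4)" by (intro tendsto_intros z)
      moreover have "(\<lambda>n. (1/2) ^ n * spot_x (\<kappa> n) 0) \<longlonglongrightarrow> 0"
      proof (rule Lim_null_comparison)
        show "\<forall>\<^sub>F n in sequentially. norm ((1/2) ^ n * spot_x (\<kappa> n) 0) \<le> (1/2) ^ n * 2"
          using xr by (intro always_eventually allI) (simp add: abs_mult mult_left_mono)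
        show "(\<lambda>n. (1/2::real) ^ n * 2) \<longlonglongrightarrow> 0" using tendsto_mult_right[OF z, of 2] by simp
      qed
      ultimately have "q \<longlonglongrightarrow> (1, 0)"
        unfolding q_def[abs_def] place_def fst_conv snd_conv by (intro tendsto_Pair) auto
      moreover have "isCont wrap (1, 0)" using wrap_cont[of UNIV] by (simp add: continuous_on_eq_continuous_at)
      ultimately have "(\<lambda>n. wrap (q n)) \<longlonglongrightarrow> wrap (1, 0)" by (metis isCont_tendsto_compose)
      moreover have "wrap (q n) \<in> range (site \<kappa>)" for n using site_encode[of \<kappa> n 0] by (metis q_def rangeI)
      ultimately show ?thesis unfolding closure_sequential by (intro exI[of _ "\<lambda>n. wrap (q n)"]) (simp add: wrap_def)
    qed
    ultimately show "?Z \<subseteq> closure (range (site \<kappa>))" by blast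
  qed
  then show ?thesis using A.glued_circle(1) by simp
qed

text \<open>One point is taken on each strand at a height between 1/4 and 3/4. A subsequence
  converges to some \<open>l\<close>, and near \<open>l\<close> the gap after strand
  \<open>f k\<close> separates the \<open>k\<close>th point from all later ones, which a locally
  connected space does not allow.\<close>

theorem bad_not_circle:
  assumes spots: "spot h J (\<kappa> n)" and bad: "\<And>k. finite {s. \<kappa> n s \<le> k}"
  shows "\<not> closure (range (site \<kappa>)) homeomorphic sphere (0::complex) 1"
proof
  let ?X = "closure (range (site \<kappa>))"
  assume "?X homeomorphic sphere (0::complex) 1"
  then have "locally connected ?X = locally connected (sphere (0::complex) 1)"
    by (rule homeomorphic_locally) (rule homeomorphic_connectedness)
  then have lc: "locally connected ?X" by (simp add: locally_connected_sphere)
  interpret spot h J "\<kappa> n" by (rule spots)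
  obtain \<psi> :: "nat \<Rightarrow> real \<Rightarrow> real" and \<gamma> :: "nat \<Rightarrow> real" where cont: "\<And>i. continuous_on UNIV (\<psi> i)" and pos: "\<And>i. 0 < \<gamma> i"
    and ord: "\<And>i j y. i < j \<Longrightarrow> 0 \<le> y \<Longrightarrow> y \<le> 1 \<Longrightarrow> \<psi> i y + \<gamma> i \<le> \<psi> j y"
    and gap: "\<And>i r. h r < 1 \<Longrightarrow> x r \<le> \<psi> i (h r) \<or> \<psi> i (h r) + \<gamma> i * (1 - h r) \<le> x r"
    and ex: "\<And>i. \<exists>r. 1/4 < h r \<and> h r < 3/4 \<and> x r = \<psi> i (h r)"
    using spot_bad[OF bad] by blast
  obtain r where r: "\<And>i. 1/4 < h (r i)" "\<And>i. h (r i) < 3/4" "\<And>i. x (r i) = \<psi> i (h (r i))" using ex by metis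
  define p where "p i = wrap (place n (h (r i), x (r i)))" for i
  have pX: "p i \<in> ?X" for i
  proof -
    have "p i \<in> range (site \<kappa>)" using site_encode[of \<kappa> n "r i"] by (metis p_def x_def rangeI)
    then show ?thesis by (rule subsetD[OF closure_subset])
  qed
  define C where "C = wrap ` place n ` ({1/4..3/4} \<times> {0..2})"
  have "compact C" unfolding C_def
    by (intro compact_continuous_image wrap_cont place_cont compact_Times compact_Icc)
  moreover have "p i \<in> C" for i
    unfolding p_def C_def using r(1,2)[of i] x_range[of "r i"] by (intro imageI) auto
  ultimately obtain l f where l: "l \<in> C" and f: "strict_mono f" and lim: "(p \<circ> f) \<longlonglongrightarrow> l"
    unfolding compact_def by metis
  \<comment> \<open>The margins leave room around the heights of the chosen points, while
    \<open>W\<close> stays away from height 1, where the gaps close, and from the ray on which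
    \<open>Arg2pi\<close> jumps.\<close>
  define W where "W = {z :: complex \<times> real. fst z \<notin> \<real>\<^sub>\<ge>\<^sub>0 \<and> 1/8 < height n z \<and> height n z < 7/8}"
  define D where "D = {z :: complex \<times> real. fst z \<notin> \<real>\<^sub>\<ge>\<^sub>0}"
  have oD: "open D"
  proof -
    have "D = fst -` (- \<real>\<^sub>\<ge>\<^sub>0)" by (auto simp: D_def)
    then show ?thesis by (simp add: open_vimage_fst closed_nonneg_Reals_complex open_Compl)
  qed
  have hD: "continuous_on D (height n)"
    unfolding continuous_on_eq_continuous_at[OF oD] by (auto simp: D_def intro: height_isCont)
  have "W = D \<inter> height n -` {1/8<..<7/8}" by (auto simp: W_def D_def)
  then have oW: "open W" using continuous_open_preimage[OF hD oD, of "{1/8<..<7/8}"] by simp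
  have hW: "continuous_on W (height n)" using hD by (rule continuous_on_subset) (auto simp: W_def D_def)
  have lW: "l \<in> W"
  proof -
    obtain y z where "l = wrap (place n (y, z))" "1/4 \<le> y" "y \<le> 3/4" using l by (auto simp: C_def)
    then show ?thesis using height_site(1,2)[of y n z] by (simp add: W_def)
  qed
  have lX: "l \<in> ?X" using closed_sequentially[OF closed_closure _ lim] pX by (simp add: o_def)
  \<comment> \<open>Its zero set is the midline of the gap between strand \<open>i\<close> and the
    following descent; the factor \<open>2 ^ n\<close> undoes the scaling by
    \<open>place n\<close>.\<close>
  define c where "c i z = 2 ^ n * snd z - \<psi> i (height n z) - \<gamma> i * (1 - height n z) / 2" for i z
  have cc: "continuous_on W (c i)" for i
    unfolding c_def[abs_def]
    by (intro continuous_intros hW continuous_on_compose2[OF cont[of i] hW]) auto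
  have csite: "c i (wrap (place n (y, z))) = z - \<psi> i y - \<gamma> i * (1 - y) / 2" if "0 < y" "y < 2" for i y z
  proof -
    have "2 ^ n * snd (wrap (place n (y, z))) = (1/2) ^ n * 2 ^ n * z" by (simp add: wrap_def place_def)
    then have "2 ^ n * snd (wrap (place n (y, z))) = z" unfolding half_power by simp
    then show ?thesis by (simp add: c_def height_site(1)[OF that])
  qed
  have far: "\<gamma> i * (1 - height n z) / 2 \<le> \<bar>c i z\<bar>" if z: "z \<in> range (site \<kappa>)" "z \<in> W" for i z
  proof -
    obtain n' r' where n': "z = wrap (place n' (h r', spot_x (\<kappa> n') r'))" using z(1) unfolding range_site by blast
    define y where "y = height n z"
    have y: "1/8 < y" "y < 7/8" using z(2) by (auto simp: W_def y_def)
    have "Arg2pi (fst z) = 2 * pi * fst (place n (y, 0))"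
    proof -
      define A where "A = 2 ^ n * (1 - Arg2pi (fst z) / (2 * pi))"
      have "y = 4 * (1 - A)" unfolding y_def height_def A_def ..
      then have "A = 1 - y / 4" by (simp add: field_simps)
      then have "2 ^ n * (1 - Arg2pi (fst z) / (2 * pi)) = 1 - y / 4" unfolding A_def .
      then have "(1/2) ^ n * 2 ^ n * (1 - Arg2pi (fst z) / (2 * pi)) = (1/2) ^ n * (1 - y / 4)"
        by (simp only: mult.assoc)
      then have "1 - Arg2pi (fst z) / (2 * pi) = (1/2) ^ n * (1 - y / 4)" unfolding half_power by simp
      then have "Arg2pi (fst z) / (2 * pi) = fst (place n (y, 0))" by (simp add: place_def)
      then show ?thesis by (simp add: field_simps)
    qed
    moreover have "Arg2pi (fst z) = 2 * pi * fst (place n' (h r', spot_x (\<kappa> n') r'))"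
      unfolding n' by (rule height_site(3)[OF h_range(1,2)])
    ultimately have e: "fst (place n' (h r', spot_x (\<kappa> n') r')) = fst (place n (y, 0))" by simp
    have nn: "n' = n"
      using place_fst_bounds[OF h_range(1,2), of n' r' "spot_x (\<kappa> n') r'"] place_fst_bounds[of y n 0] y e
      by (intro dyadic_unique[of n' "fst (place n (y, 0))"]) auto
    have hr: "h r' = y" using n' nn height_site(1)[OF h_range(1,2), of n r'] by (simp add: y_def)
    have "x r' \<le> \<psi> i y \<or> \<psi> i y + \<gamma> i * (1 - y) \<le> x r'" using gap[of r' i] hr y by simp
    moreover have "c i z = x r' - \<psi> i y - \<gamma> i * (1 - y) / 2"
      using csite[of y i "spot_x (\<kappa> n) r'"] y n' nn hr by (simp add: x_def)
    ultimately have "\<gamma> i * (1 - y) / 2 \<le> \<bar>c i z\<bar>" by linarith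
    then show ?thesis by (simp add: y_def)
  qed
  \<comment> \<open>The weak bound \<open>far\<close> passes to limits of points in the open set
    \<open>W\<close>, and it is positive there because the height is below 1.\<close>
  have farX: "c i z \<noteq> 0" if z: "z \<in> ?X" "z \<in> W" for i z
  proof -
    have "z \<in> closure (range (site \<kappa>) \<inter> W)"
      using open_Int_closure_subset[OF oW, of "range (site \<kappa>)"] z by (auto simp: Int_commute)
    then obtain s where s: "\<And>k. s k \<in> range (site \<kappa>) \<inter> W" "s \<longlonglongrightarrow> z" unfolding closure_sequential by blast
    have ct: "isCont (c i) z" "isCont (height n) z"
      using cc[of i] hW oW z(2) by (auto simp: continuous_on_eq_continuous_at)
    have "\<gamma> i * (1 - height n z) / 2 \<le> \<bar>c i z\<bar>"
    proof (rule LIMSEQ_le)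
      show "(\<lambda>k. \<gamma> i * (1 - height n (s k)) / 2) \<longlonglongrightarrow> \<gamma> i * (1 - height n z) / 2"
        by (intro tendsto_intros isCont_tendsto_compose[OF ct(2) s(2)]) simp
      show "(\<lambda>k. \<bar>c i (s k)\<bar>) \<longlonglongrightarrow> \<bar>c i z\<bar>"
        by (intro tendsto_intros isCont_tendsto_compose[OF ct(1) s(2)])
      show "\<exists>N. \<forall>k\<ge>N. \<gamma> i * (1 - height n (s k)) / 2 \<le> \<bar>c i (s k)\<bar>" using far s(1) by blast
    qed
    moreover have "0 < \<gamma> i * (1 - height n z) / 2" using pos[of i] z(2) by (simp add: W_def)
    ultimately show ?thesis by auto
  qed
  have cp: "c i (p j) = x (r j) - \<psi> i (h (r j)) - \<gamma> i * (1 - h (r j)) / 2" for i j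
    unfolding p_def using r(1,2)[of j] by (intro csite) auto
  show False
  proof (rule not_locally_connected_gaps[OF lc oW lX lW, of "p \<circ> f" "\<lambda>k. c (f k)"])
    show "(p \<circ> f) k \<in> ?X" for k using pX by simp
    show "(p \<circ> f) \<longlonglongrightarrow> l" by (rule lim)
    show "continuous_on W (c (f k))" for k by (rule cc)
    show "c (f k) z \<noteq> 0" if "z \<in> ?X" "z \<in> W" for k z using farX that by blast
    show "c (f k) ((p \<circ> f) k) < 0" for k
      using cp[of "f k" "f k"] r[of "f k"] pos[of "f k"] by simp
    show "0 < c (f k) ((p \<circ> f) m)" if km: "k < m" for k m
    proof -
      let ?y = "h (r (f m))"
      have y: "1/4 < ?y" "?y < 3/4" using r by auto
      have "\<psi> (f k) ?y + \<gamma> (f k) \<le> \<psi> (f m) ?y" using y f km by (intro ord) (auto simp: strict_mono_def)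
      moreover have "\<gamma> (f k) * (1 - ?y) / 2 < \<gamma> (f k)"
      proof -
        have "\<gamma> (f k) * (1 - ?y) < \<gamma> (f k) * 1" using y pos[of "f k"] by (intro mult_strict_left_mono) auto
        then show ?thesis using pos[of "f k"] by simp
      qed
      ultimately show ?thesis using cp[of "f k" "f m"] r(3)[of "f m"] by simp
    qed
  qed
qed

end

section \<open>Reducing an arbitrary set\<close>

lemma homeomorphic_space_top_of_set:
  "top_of_set S homeomorphic_space top_of_set T \<longleftrightarrow> S homeomorphic T"
proof -
  have "homeomorphic_maps (top_of_set S) (top_of_set T) f g \<longleftrightarrow> homeomorphism S T f g" for f g
  proof
    assume "homeomorphic_maps (top_of_set S) (top_of_set T) f g"
    then have *: "continuous_on S f" "f \<in> S \<rightarrow> T" "continuous_on T g" "g \<in> T \<rightarrow> S"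
      "\<And>x. x \<in> S \<Longrightarrow> g (f x) = x" "\<And>y. y \<in> T \<Longrightarrow> f (g y) = y"
      by (auto simp: homeomorphic_maps_def continuous_map_in_subtopology)
    show "homeomorphism S T f g"
      by (rule homeomorphismI) (use * in auto)
  next
    assume h: "homeomorphism S T f g"
    then have "f ` S = T" "g ` T = S" by (auto simp: homeomorphism_def)
    then have "f \<in> S \<rightarrow> T" "g \<in> T \<rightarrow> S" by blast+
    then show "homeomorphic_maps (top_of_set S) (top_of_set T) f g"
      using h by (simp add: homeomorphic_maps_def homeomorphism_def continuous_map_in_subtopology)
  qed
  then show ?thesis unfolding homeomorphic_space_def homeomorphic_def by simp
qed

text \<open>A class of Cauchy sequences is sent to the limit of its image under \<open>e\<close>.
  This is an isometry onto the closure of the range, since both distances are limits of the same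
  sequence.\<close>

lemma completion_closure:
  fixes e :: "nat \<Rightarrow> 'a::complete_space"
  assumes "Metric_space UNIV d" and d: "\<And>a b. d a b = dist (e a) (e b)"
  shows "Metric_space.completion_topology UNIV d homeomorphic_space top_of_set (closure (range e))"
proof -
  interpret Metric_space UNIV d by fact
  interpret C: Metric_space completion_points completion_dist by (rule Metric_space_completion)
  let ?S = "closure (range e)"
  have MC: "MCauchy \<sigma> \<longleftrightarrow> Cauchy (\<lambda>n. e (\<sigma> n))" for \<sigma>
    by (simp add: MCauchy_def Cauchy_def d)
  have conv: "convergent (\<lambda>n. e (\<sigma> n))" if "MCauchy \<sigma>" for \<sigma>
    using that unfolding MC by (rule Cauchy_convergent)
  define F where "F A = lim (\<lambda>n. e ((SOME \<sigma>. MCauchy \<sigma> \<and> A = completion_rel `` {\<sigma>}) n))" for A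
  have F: "\<exists>\<sigma>. MCauchy \<sigma> \<and> A = completion_rel `` {\<sigma>} \<and> (\<lambda>n. e (\<sigma> n)) \<longlonglongrightarrow> F A" if A: "A \<in> completion_points" for A
  proof -
    have "\<exists>\<sigma>. MCauchy \<sigma> \<and> A = completion_rel `` {\<sigma>}" using completion_pointsE[OF A] by metis
    then have s: "MCauchy (SOME \<sigma>. MCauchy \<sigma> \<and> A = completion_rel `` {\<sigma>}) \<and>
        A = completion_rel `` {SOME \<sigma>. MCauchy \<sigma> \<and> A = completion_rel `` {\<sigma>}}" by (rule someI_ex)
    then show ?thesis
      using conv[of "SOME \<sigma>. MCauchy \<sigma> \<and> A = completion_rel `` {\<sigma>}"] unfolding F_def convergent_LIMSEQ_iff by blast
  qed
  have iso: "dist (F A) (F B) = completion_dist A B" if AB: "A \<in> completion_points" "B \<in> completion_points" for A B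
  proof -
    obtain \<sigma> where s: "MCauchy \<sigma>" "A = completion_rel `` {\<sigma>}" "(\<lambda>n. e (\<sigma> n)) \<longlonglongrightarrow> F A" using F[OF AB(1)] by blast
    obtain \<tau> where t: "MCauchy \<tau>" "B = completion_rel `` {\<tau>}" "(\<lambda>n. e (\<tau> n)) \<longlonglongrightarrow> F B" using F[OF AB(2)] by blast
    have "(\<lambda>n. d (\<sigma> n) (\<tau> n)) \<longlonglongrightarrow> dist (F A) (F B)" unfolding d by (intro tendsto_dist s t)
    moreover have "(\<lambda>n. d (\<sigma> n) (\<tau> n)) \<longlonglongrightarrow> completion_dist A B"
      unfolding s(2) t(2) by (rule completion_dist_tendsto[OF s(1) t(1)])
    ultimately show ?thesis by (rule LIMSEQ_unique)
  qed
  have im: "F ` completion_points = ?S"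
  proof (rule subset_antisym)
    show "F ` completion_points \<subseteq> ?S"
    proof (rule image_subsetI)
      fix A assume "A \<in> completion_points"
      then obtain \<sigma> where "(\<lambda>n. e (\<sigma> n)) \<longlonglongrightarrow> F A" using F by blast
      then show "F A \<in> ?S" unfolding closure_sequential by (intro exI[of _ "\<lambda>n. e (\<sigma> n)"]) simp
    qed
    show "?S \<subseteq> F ` completion_points"
    proof (rule subsetI)
      fix z assume "z \<in> ?S"
      then obtain w where w: "\<And>n. w n \<in> range e" "w \<longlonglongrightarrow> z" unfolding closure_sequential by blast
      then have "\<forall>n. \<exists>m. w n = e m" by blast
      then obtain \<sigma> where \<sigma>: "\<And>n. w n = e (\<sigma> n)" by metis
      then have w': "(\<lambda>n. e (\<sigma> n)) \<longlonglongrightarrow> z" using w(2) by (simp add: LIMSEQ_def)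
      then have M: "MCauchy \<sigma>" unfolding MC by (rule LIMSEQ_imp_Cauchy)
      let ?A = "completion_rel `` {\<sigma>}"
      have A: "?A \<in> completion_points" using M by (rule completion_pointsI)
      obtain \<tau> where t: "MCauchy \<tau>" "?A = completion_rel `` {\<tau>}" "(\<lambda>n. e (\<tau> n)) \<longlonglongrightarrow> F ?A" using F[OF A] by blast
      have "(\<sigma>, \<tau>) \<in> completion_rel"
        using eq_equiv_class_iff[OF equiv_completion_rel, of \<sigma> \<tau>] t M by simp
      then have "(\<lambda>n. dist (e (\<sigma> n)) (e (\<tau> n))) \<longlonglongrightarrow> 0" by (simp add: completion_rel_def d)
      moreover have "(\<lambda>n. dist (e (\<sigma> n)) (e (\<tau> n))) \<longlonglongrightarrow> dist z (F ?A)" by (intro tendsto_dist w' t)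
      ultimately have "dist z (F ?A) = 0" by (metis LIMSEQ_unique)
      then show "z \<in> F ` completion_points" using A by auto
    qed
  qed
  have "homeomorphic_map C.mtopology (top_of_set ?S) F"
  proof (rule bijective_open_imp_homeomorphic_map)
    show "continuous_map C.mtopology (top_of_set ?S) F"
      unfolding continuous_map_in_subtopology
    proof
      show "F \<in> topspace C.mtopology \<rightarrow> ?S" using im by auto
      show "continuous_map C.mtopology euclidean F" unfolding continuous_map_def
      proof (intro conjI allI impI)
        fix U :: "'a set" assume "openin euclidean U"
        then have U: "open U" using open_openin[THEN iffD2] by blast
        show "openin C.mtopology {A \<in> topspace C.mtopology. F A \<in> U}"
          unfolding C.openin_mtopology
        proof (intro conjI allI impI)
          fix A assume "A \<in> {A \<in> topspace C.mtopology. F A \<in> U}"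
          then have A: "A \<in> completion_points" "F A \<in> U" by auto
          then obtain r where r: "0 < r" "ball (F A) r \<subseteq> U" using U openE by blast
          have "C.mball A r \<subseteq> {A \<in> topspace C.mtopology. F A \<in> U}"
            using r(2) iso A(1) by (auto simp: subset_iff)
          then show "\<exists>r>0. C.mball A r \<subseteq> {A \<in> topspace C.mtopology. F A \<in> U}" using r(1) by blast
        qed auto
      qed auto
    qed
    show "open_map C.mtopology (top_of_set ?S) F" unfolding open_map_def
    proof (intro allI impI)
      fix U assume U: "openin C.mtopology U"
      show "openin (top_of_set ?S) (F ` U)"
        unfolding openin_euclidean_subtopology_iff
      proof (intro conjI ballI)
        have UM: "U \<subseteq> completion_points" using openin_subset[OF U] by simp
        then show "F ` U \<subseteq> ?S" using im by blast
        fix z assume "z \<in> F ` U"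
        then obtain A where A: "A \<in> U" "z = F A" by blast
        then obtain r where r: "0 < r" "C.mball A r \<subseteq> U" using U unfolding C.openin_mtopology by blast
        have "z' \<in> F ` U" if z': "z' \<in> ?S" "dist z' z < r" for z'
        proof -
          obtain B where B: "B \<in> completion_points" "z' = F B" using z'(1) im by blast
          then have "B \<in> C.mball A r" using iso[of A B] A UM z'(2) by (auto simp: dist_commute)
          then show ?thesis using r B by blast
        qed
        then show "\<exists>r>0. \<forall>z'\<in>?S. dist z' z < r \<longrightarrow> z' \<in> F ` U" using r(1) by blast
      qed
    qed
    show "F ` topspace C.mtopology = topspace (top_of_set ?S)" using im by simp
    show "inj_on F (topspace C.mtopology)"
    proof (rule inj_onI)
      fix A B assume "A \<in> topspace C.mtopology" "B \<in> topspace C.mtopology" "F A = F B"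
      then show "A = B" using iso[of A B] C.zero[of A B] by simp
    qed
  qed
  then show ?thesis unfolding completion_topology_def by (rule homeomorphic_map_imp_homeomorphic_space)
qed

section \<open>Rational presentations of subsets of metric spaces\<close>

definition dyadic_floor :: "real \<Rightarrow> nat \<Rightarrow> rat" where
  "dyadic_floor r k = of_int \<lfloor>r * 2 ^ (k + 2)\<rfloor> / 2 ^ (k + 2)"

text \<open>Rounding to multiples of \<open>1 / 2 ^ (k + 2)\<close> has an error below
  \<open>(1/2) ^ k / 4\<close>, which leaves ample room for the fast Cauchy condition.\<close>

lemma dyadic_floor_bounds:
  "real_of_rat (dyadic_floor r k) \<le> r" "r < real_of_rat (dyadic_floor r k) + (1/2) ^ k / 4"
proof -
  have e: "real_of_rat (dyadic_floor r k) = of_int \<lfloor>r * 2 ^ (k + 2)\<rfloor> / 2 ^ (k + 2)"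
    by (simp add: dyadic_floor_def of_rat_divide of_rat_power of_rat_mult)
  have p: "0 < (2::real) ^ (k + 2)" by simp
  have "of_int \<lfloor>r * 2 ^ (k + 2)\<rfloor> / 2 ^ (k + 2) \<le> r * 2 ^ (k + 2) / 2 ^ (k + 2)"
    by (rule divide_right_mono) auto
  then show "real_of_rat (dyadic_floor r k) \<le> r" using p unfolding e by simp
  have "r * 2 ^ (k + 2) / 2 ^ (k + 2) < (of_int \<lfloor>r * 2 ^ (k + 2)\<rfloor> + 1) / 2 ^ (k + 2)"
  proof (rule divide_strict_right_mono)
    show "r * 2 ^ (k + 2) < of_int \<lfloor>r * 2 ^ (k + 2)\<rfloor> + 1" by linarith
  qed simp
  moreover have "(1/2) ^ k / 4 = 1 / (2::real) ^ (k + 2)" by (simp add: power_add power_one_over)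
  ultimately show "r < real_of_rat (dyadic_floor r k) + (1/2) ^ k / 4"
    using p unfolding e by (simp add: add_divide_distrib)
qed

definition dist_presentation :: "(nat \<Rightarrow> 'a::metric_space) \<Rightarrow> nat \<Rightarrow> nat \<Rightarrow> nat \<Rightarrow> rat" where
  "dist_presentation e a b k = dyadic_floor (dist (e a) (e b)) k"

lemma dist_presentation:
  fixes e :: "nat \<Rightarrow> 'a::metric_space"
  assumes "inj e"
  shows "presented_dist (dist_presentation e) = (\<lambda>a b. dist (e a) (e b))" "presentation (dist_presentation e)"
proof -
  have fast: "fast_Cauchy (\<lambda>k. real_of_rat (dist_presentation e a b k))" for a b
    unfolding fast_Cauchy_def
  proof
    fix i
    let ?r = "dist (e a) (e b)"
    have "(1/2) ^ Suc i = (1/2) ^ i / (2::real)" "0 < (1/2::real) ^ i" "1 / 2 ^ i = (1/2::real) ^ i"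
      by (simp_all add: power_one_over)
    then show "dist (real_of_rat (dist_presentation e a b i)) (real_of_rat (dist_presentation e a b (Suc i))) < 1 / 2 ^ i"
      using dyadic_floor_bounds[of ?r i] dyadic_floor_bounds[of ?r "Suc i"]
      unfolding dist_presentation_def dist_real_def by linarith
  qed
  have "(\<lambda>k. real_of_rat (dist_presentation e a b k)) \<longlonglongrightarrow> dist (e a) (e b)" for a b
  proof (rule LIM_zero_cancel, rule Lim_null_comparison)
    show "\<forall>\<^sub>F k in sequentially. norm (real_of_rat (dist_presentation e a b k) - dist (e a) (e b)) \<le> (1/2) ^ k"
    proof (intro always_eventually allI)
      fix k
      have "0 < (1/2::real) ^ k" by simp
      then show "norm (real_of_rat (dist_presentation e a b k) - dist (e a) (e b)) \<le> (1/2) ^ k"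
        using dyadic_floor_bounds[of "dist (e a) (e b)" k] unfolding dist_presentation_def real_norm_def by linarith
    qed
    show "(\<lambda>k. (1/2::real) ^ k) \<longlonglongrightarrow> 0" by (rule LIMSEQ_realpow_zero) auto
  qed
  then have l: "presented_dist (dist_presentation e) a b = dist (e a) (e b)" for a b
    unfolding presented_dist_def by (rule limI)
  then show pd: "presented_dist (dist_presentation e) = (\<lambda>a b. dist (e a) (e b))" by blast
  have "Metric_space UNIV (\<lambda>a b. dist (e a) (e b))"
    using assms by unfold_locales (auto simp: dist_commute dist_triangle inj_eq)
  then show "presentation (dist_presentation e)" unfolding presentation_def pd using fast by blast
qed

lemma presentation_code_decode:
  "presentation_code q m \<longleftrightarrow> (\<exists>a b k. list_decode m = [a, b, k, rat_encode (q a b k)])"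
  unfolding presentation_code_def by (metis list_decode_inverse list_encode_inverse)

section \<open>Finite information about points of Baire space, and levels extracted from it\<close>

definition cylinder :: "(nat \<Rightarrow> nat) \<Rightarrow> nat \<Rightarrow> (nat \<Rightarrow> nat) set" where
  "cylinder x s = {y. \<forall>i<s. y i = x i}"

lemma open_cylinder: "open (cylinder x s)"
proof -
  have "open ((\<lambda>y::nat \<Rightarrow> nat. y i) -` {x i})" for i
    by (intro open_vimage continuous_on_product_coordinates) (simp add: open_discrete)
  then have "open (\<Inter>i\<in>{..<s}. (\<lambda>y::nat \<Rightarrow> nat. y i) -` {x i})" by (intro open_INT) auto
  moreover have "cylinder x s = (\<Inter>i\<in>{..<s}. (\<lambda>y. y i) -` {x i})" by (auto simp: cylinder_def)
  ultimately show ?thesis by simp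
qed

lemma cylinder_antimono: "s \<le> t \<Longrightarrow> cylinder x t \<subseteq> cylinder x s"
  by (auto simp: cylinder_def)

lemma self_in_cylinder: "x \<in> cylinder x s"
  by (simp add: cylinder_def)

lemma open_contains_cylinder:
  assumes "open U" "x \<in> U" shows "\<exists>s. cylinder x s \<subseteq> U"
proof -
  have "openin (product_topology (\<lambda>i. euclidean) UNIV) U" using assms(1) by (simp add: open_fun_def)
  then obtain X where X: "x \<in> Pi\<^sub>E UNIV X" "finite {i. X i \<noteq> UNIV}" "Pi\<^sub>E UNIV X \<subseteq> U"
    using product_topology_open_contains_basis[of "\<lambda>i. euclidean" UNIV U x] assms(2) by auto
  obtain s where s: "\<forall>i\<in>{i. X i \<noteq> UNIV}. i < s" using X(2) finite_nat_set_iff_bounded by blast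
  have "y i \<in> X i" if "y \<in> cylinder x s" for y i
  proof (cases "i < s")
    case True then show ?thesis using that X(1) by (auto simp: cylinder_def PiE_iff)
  next
    case False then have "X i = UNIV" using s by blast
    then show ?thesis by simp
  qed
  then have "cylinder x s \<subseteq> Pi\<^sub>E UNIV X" by (auto simp: PiE_iff)
  then show ?thesis using X(3) by blast
qed

lemma continuous_finite_dependence:
  fixes F :: "(nat \<Rightarrow> nat) \<Rightarrow> nat \<Rightarrow> bool"
  assumes "\<And>m. \<exists>N. \<forall>x y. (\<forall>i<N. x i = y i) \<longrightarrow> F x m = F y m"
  shows "continuous_on UNIV F"
proof (rule continuous_on_coordinatewise_then_product)
  fix m
  obtain N where N: "\<And>x y. (\<forall>i<N. x i = y i) \<Longrightarrow> F x m = F y m" using assms by metis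
  have "open ((\<lambda>x. F x m) -` B)" for B
  proof (subst open_subopen, intro ballI)
    fix x assume x: "x \<in> (\<lambda>x. F x m) -` B"
    have "cylinder x N \<subseteq> (\<lambda>x. F x m) -` B" using N x by (auto simp: cylinder_def)
    then show "\<exists>T. open T \<and> x \<in> T \<and> T \<subseteq> (\<lambda>x. F x m) -` B"
      by (intro exI[of _ "cylinder x N"] conjI open_cylinder self_in_cylinder)
  qed
  then show "continuous_on UNIV (\<lambda>x. F x m)" by (simp add: continuous_on_open_vimage)
qed

lemma infinite_increments_iff:
  fixes f :: "nat \<Rightarrow> nat"
  assumes "mono f" shows "infinite {s. f s < f (Suc s)} \<longleftrightarrow> (\<forall>L. \<exists>s. L \<le> f s)"
proof
  assume inf: "infinite {s. f s < f (Suc s)}"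
  show "\<forall>L. \<exists>s. L \<le> f s"
  proof
    fix L show "\<exists>s. L \<le> f s"
    proof (induction L)
      case (Suc L)
      then obtain s where s: "L \<le> f s" by blast
      obtain t where t: "s \<le> t" "f t < f (Suc t)" using inf unfolding infinite_nat_iff_unbounded_le by auto
      have "f s \<le> f t" using assms t(1) by (rule monoD)
      then show ?case using s t by (intro exI[of _ "Suc t"]) linarith
    qed simp
  qed
next
  assume unb: "\<forall>L. \<exists>s. L \<le> f s"
  show "infinite {s. f s < f (Suc s)}"
  proof
    assume "finite {s. f s < f (Suc s)}"
    then obtain N where N: "\<forall>s\<in>{s. f s < f (Suc s)}. s < N" using finite_nat_set_iff_bounded by blast
    have "f s \<le> f N" for s
    proof (cases "s \<le> N")
      case True then show ?thesis using assms by (rule monoD[rotated])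
    next
      case False
      then have "N \<le> s" by simp
      then show ?thesis
      proof (induction rule: dec_induct)
        case (step t)
        then have "\<not> f t < f (Suc t)" using N by auto
        then show ?case using step.IH by simp
      qed simp
    qed
    moreover obtain s where "Suc (f N) \<le> f s" using unb by blast
    ultimately show False by (metis Suc_n_not_le_n le_trans)
  qed
qed

context
  fixes V :: "nat \<Rightarrow> nat \<Rightarrow> (nat \<Rightarrow> nat) set"
  assumes open_V: "\<And>m l. open (V m l)"
begin

text \<open>
  The sequence \<open>level x\<close> has a finite limit inferior iff some row \<open>V m\<close> consists of sets that all contain \<open>x\<close>:
  row \<open>m\<close> becomes active whenever \<open>x\<close> is seen to lie in one more set of its initial segment. The bounds
  on the growth of \<open>level x\<close> are those required of the input of a spot.
\<close>

definition seen :: "(nat \<Rightarrow> nat) \<Rightarrow> nat \<Rightarrow> nat \<Rightarrow> nat" where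
  "seen x m s = card {l. l < s \<and> (\<forall>l'\<le>l. cylinder x s \<subseteq> V m l')}"

text \<open>The alternative \<open>m = s\<close> makes the least row exist at every stage; as it
  tends to infinity with \<open>s\<close>, it does not create a bounded subsequence.\<close>

definition active_row :: "(nat \<Rightarrow> nat) \<Rightarrow> nat \<Rightarrow> nat" where
  "active_row x s = (LEAST m. m = s \<or> seen x m s < seen x m (Suc s))"

primrec level :: "(nat \<Rightarrow> nat) \<Rightarrow> nat \<Rightarrow> nat" where
  "level x 0 = 0"
| "level x (Suc s) = min (max 1 (active_row x s)) (Suc (level x s))"

lemma mono_seen: "mono (seen x m)"
proof (rule monoI)
  fix s t :: nat assume st: "s \<le> t"
  have "{l. l < s \<and> (\<forall>l'\<le>l. cylinder x s \<subseteq> V m l')} \<subseteq> {l. l < t \<and> (\<forall>l'\<le>l. cylinder x t \<subseteq> V m l')}"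
    using st cylinder_antimono[OF st, of x] by auto
  then show "seen x m s \<le> seen x m t" unfolding seen_def by (intro card_mono) auto
qed

lemma seen_unbounded_iff: "(\<forall>L. \<exists>s. L \<le> seen x m s) \<longleftrightarrow> (\<forall>l. x \<in> V m l)"
proof
  assume unb: "\<forall>L. \<exists>s. L \<le> seen x m s"
  show "\<forall>l. x \<in> V m l"
  proof (rule ccontr)
    assume "\<not> (\<forall>l. x \<in> V m l)"
    then obtain l where l: "x \<notin> V m l" by blast
    have "seen x m s \<le> l" for s
    proof -
      have "{k. k < s \<and> (\<forall>l'\<le>k. cylinder x s \<subseteq> V m l')} \<subseteq> {..<l}"
        using l self_in_cylinder[of x s] by (auto simp: not_le[symmetric])
      then have "seen x m s \<le> card {..<l}" unfolding seen_def by (intro card_mono) auto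
      then show ?thesis by simp
    qed
    then show False using unb by (metis Suc_n_not_le_n le_trans)
  qed
next
  assume all: "\<forall>l. x \<in> V m l"
  show "\<forall>L. \<exists>s. L \<le> seen x m s"
  proof
    fix L
    have "\<exists>s. cylinder x s \<subseteq> V m l" for l using open_contains_cylinder[OF open_V] all by blast
    then obtain f where f: "\<And>l. cylinder x (f l) \<subseteq> V m l" by metis
    define s where "s = L + (\<Sum>l<L. f l)"
    have "cylinder x s \<subseteq> V m l" if "l < L" for l
    proof -
      have "f l \<le> (\<Sum>l<L. f l)" using that by (intro member_le_sum) auto
      then have "cylinder x s \<subseteq> cylinder x (f l)" by (intro cylinder_antimono) (simp add: s_def)
      then show ?thesis using f by blast
    qed
    then have "l < s \<and> (\<forall>l'\<le>l. cylinder x s \<subseteq> V m l')" if "l < L" for l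
      using that by (auto simp: s_def dest: le_less_trans intro: subsetD)
    then have "{..<L} \<subseteq> {l. l < s \<and> (\<forall>l'\<le>l. cylinder x s \<subseteq> V m l')}" by blast
    then have "card {..<L} \<le> seen x m s" unfolding seen_def by (intro card_mono) auto
    then show "\<exists>s. L \<le> seen x m s" by (intro exI[of _ s]) simp
  qed
qed

lemma events_iff: "infinite {s. seen x m s < seen x m (Suc s)} \<longleftrightarrow> (\<forall>l. x \<in> V m l)"
  by (simp add: infinite_increments_iff[OF mono_seen] seen_unbounded_iff)

lemma level_good:
  assumes "\<forall>l. x \<in> V m l" shows "\<exists>k. infinite {s. level x s \<le> k}"
proof -
  have "infinite {s. seen x m s < seen x m (Suc s)}" using assms events_iff by blast
  then have "infinite (Suc ` {s. seen x m s < seen x m (Suc s)})" by (simp add: finite_image_iff)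
  moreover have "Suc ` {s. seen x m s < seen x m (Suc s)} \<subseteq> {s. level x s \<le> max 1 m}"
  proof (rule image_subsetI)
    fix s assume "s \<in> {s. seen x m s < seen x m (Suc s)}"
    then have "active_row x s \<le> m" unfolding active_row_def by (intro Least_le) simp
    then show "Suc s \<in> {s. level x s \<le> max 1 m}" by auto
  qed
  ultimately have "infinite {s. level x s \<le> max 1 m}" using finite_subset by blast
  then show ?thesis by blast
qed

lemma level_bad:
  assumes "\<And>m. \<exists>l. x \<notin> V m l" shows "finite {s. level x s \<le> k}"
proof -
  have fin: "finite {s. seen x m s < seen x m (Suc s)}" for m using assms events_iff by blast
  have "{s. active_row x s \<le> k} \<subseteq> {..k} \<union> (\<Union>m\<le>k. {s. seen x m s < seen x m (Suc s)})"
  proof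
    fix s assume s: "s \<in> {s. active_row x s \<le> k}"
    have "active_row x s = s \<or> seen x (active_row x s) s < seen x (active_row x s) (Suc s)"
      unfolding active_row_def by (rule LeastI[of _ s]) simp
    then show "s \<in> {..k} \<union> (\<Union>m\<le>k. {s. seen x m s < seen x m (Suc s)})" using s by auto
  qed
  then have "finite {s. active_row x s \<le> k}" by (rule finite_subset) (use fin in auto)
  then obtain N where N: "\<forall>s\<in>{s. active_row x s \<le> k}. s < N" using finite_nat_set_iff_bounded by blast
  then have large: "k < active_row x s" if "N \<le> s" for s using that by (meson mem_Collect_eq not_le)
  \<comment> \<open>From stage \<open>N\<close> on all active rows exceed \<open>k\<close>, so the
    level climbs by one in every step until it is above \<open>k\<close>, and remains there.\<close>
  have "min (Suc k) j \<le> level x (N + j)" for j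
  proof (induction j)
    case (Suc j)
    have "Suc k \<le> max 1 (active_row x (N + j))" using large[of "N + j"] by simp
    then have "min (Suc k) (Suc j) \<le> min (max 1 (active_row x (N + j))) (Suc (level x (N + j)))"
      using Suc by arith
    then show ?case by simp
  qed simp
  from this have "k < level x s" if "N + Suc k \<le> s" for s
  proof -
    have "min (Suc k) (s - N) \<le> level x (N + (s - N))" by fact
    then show ?thesis using that by simp
  qed
  then have "{s. level x s \<le> k} \<subseteq> {..<N + Suc k}" by (auto simp: not_le[symmetric])
  then show ?thesis by (rule finite_subset) simp
qed

lemma level_bounds: "level x 0 = 0" "1 \<le> level x (Suc s)" "level x (Suc s) \<le> Suc (level x s)"
  by auto

lemma cylinder_cong: "(\<And>i. i < s \<Longrightarrow> x i = y i) \<Longrightarrow> cylinder x s = cylinder y s"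
  by (auto simp: cylinder_def)

lemma level_cong:
  assumes "\<And>i. i < s \<Longrightarrow> x i = y i" shows "level x s = level y s"
  using assms
proof (induction s)
  case (Suc s)
  have "seen x m t = seen y m t" if "t \<le> Suc s" for m t
    using Suc.prems that by (simp add: seen_def cylinder_cong[of t x y])
  then have "active_row x s = active_row y s" by (simp add: active_row_def)
  then show ?case using Suc by simp
qed simp

end

text \<open>The outer quantifier over \<open>n\<close> is distributed over the spots, and the inner
  condition on \<open>m\<close> and \<open>l\<close> is turned into the limit inferior of the
  \<open>n\<close>th level.\<close>

theorem Pi0_4_Wadge_reducible:
  assumes "B \<in> bPi0 4 (euclidean :: (nat \<Rightarrow> nat) topology)"
  shows "Wadge_reducible B (HCopies (top_of_set (sphere (0::complex) 1)))"
proof -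
  obtain U :: "nat \<Rightarrow> nat \<Rightarrow> nat \<Rightarrow> (nat \<Rightarrow> nat) set" where U: "\<And>n m l. openin euclidean (U n m l)"
    and B: "B = topspace euclidean \<inter> (\<Inter>n. \<Union>m. \<Inter>l. U n m l)"
    using assms unfolding bPi0_4_iff by blast
  have oU: "open (U n m l)" for n m l using open_openin[THEN iffD2] U by blast
  obtain h J where "heights h J" using heights_exist by blast
  then interpret heights h J .
  define \<kappa> where "\<kappa> x n = level (U n) x" for x n
  have spots: "spot h J (\<kappa> x n)" for x n
  proof unfold_locales
    show "\<kappa> x n 0 = 0" unfolding \<kappa>_def by (rule level_bounds(1)[OF oU])
    show "1 \<le> \<kappa> x n (Suc s)" "\<kappa> x n (Suc s) \<le> Suc (\<kappa> x n s)" for s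
      unfolding \<kappa>_def by (rule level_bounds(2)[OF oU], rule level_bounds(3)[OF oU])
  qed
  define F where "F x = presentation_code (dist_presentation (site (\<kappa> x)))" for x
  have TOP: "F x \<in> TOP" for x
    unfolding F_def TOP_def using dist_presentation(2)[OF inj_site] by blast
  \<comment> \<open>Point \<open>r\<close> of a spot is placed in step \<open>r\<close>, using
    inputs up to time \<open>r\<close>, which in turn depend on finitely many values of
    \<open>x\<close>.\<close>
  have loc: "\<exists>N. \<forall>x y. (\<forall>i<N. x i = y i) \<longrightarrow> site (\<kappa> x) a = site (\<kappa> y) a" for a
  proof -
    obtain n r where a: "a = prod_encode (n, r)" by (metis prod_decode_inverse prod.exhaust)
    have "site (\<kappa> x) a = site (\<kappa> y) a" if xy: "\<forall>i<Suc r. x i = y i" for x y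
    proof -
      have "\<kappa> x n t = \<kappa> y n t" if "t \<le> r" for t
        unfolding \<kappa>_def using xy that by (intro level_cong[OF oU]) auto
      then have "spot_x (\<kappa> x n) r = spot_x (\<kappa> y n) r" by (rule spot_x_cong)
      then show ?thesis by (simp add: a site_encode)
    qed
    then show ?thesis by blast
  qed
  have cont: "continuous_on UNIV F"
  proof (rule continuous_finite_dependence)
    fix m
    define a b where "a = list_decode m ! 0" and "b = list_decode m ! 1"
    obtain N where N: "\<And>x y. (\<forall>i<N. x i = y i) \<Longrightarrow> site (\<kappa> x) a = site (\<kappa> y) a" using loc by metis
    obtain N' where N': "\<And>x y. (\<forall>i<N'. x i = y i) \<Longrightarrow> site (\<kappa> x) b = site (\<kappa> y) b" using loc by metis
    have "F x m = F y m" if xy: "\<forall>i<max N N'. x i = y i" for x y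
    proof -
      have "site (\<kappa> x) a = site (\<kappa> y) a" "site (\<kappa> x) b = site (\<kappa> y) b" using xy by (auto intro!: N N')
      then have e: "dist_presentation (site (\<kappa> x)) a b k = dist_presentation (site (\<kappa> y)) a b k" for k
        by (simp add: dist_presentation_def)
      \<comment> \<open>Bit \<open>m\<close> of the code concerns the distance of just the two
        points \<open>a\<close> and \<open>b\<close> that are encoded in \<open>m\<close>.\<close>
      have "(list_decode m = [a', b', k, rat_encode (dist_presentation (site (\<kappa> x)) a' b' k)]) \<longleftrightarrow>
            (list_decode m = [a', b', k, rat_encode (dist_presentation (site (\<kappa> y)) a' b' k)])" for a' b' k
      proof (cases "a' = a \<and> b' = b")
        case True then show ?thesis using e by simp
      next
        case False then show ?thesis by (auto simp: a_def b_def)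
      qed
      then show ?thesis unfolding F_def presentation_code_decode by simp
    qed
    then show "\<exists>N. \<forall>x y. (\<forall>i<N. x i = y i) \<longrightarrow> F x m = F y m" by blast
  qed
  have red: "x \<in> B \<longleftrightarrow> F x \<in> HCopies (top_of_set (sphere (0::complex) 1))" for x
  proof -
    let ?e = "site (\<kappa> x)"
    have inv: "the_inv presentation_code (F x) = dist_presentation ?e"
      unfolding F_def by (rule the_inv_f_f[OF inj_presentation_code])
    have pd: "presented_dist (dist_presentation ?e) = (\<lambda>a b. dist (?e a) (?e b))"
      by (rule dist_presentation(1)[OF inj_site])
    have M: "Metric_space UNIV (presented_dist (dist_presentation ?e))"
      using dist_presentation(2)[OF inj_site] by (simp add: presentation_def)
    have PQ: "presented_space (F x) homeomorphic_space top_of_set (closure (range ?e))"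
      unfolding presented_space_def inv by (rule completion_closure[OF M]) (simp add: pd)
    have "presented_space (F x) homeomorphic_space top_of_set (sphere (0::complex) 1) \<longleftrightarrow>
        top_of_set (closure (range ?e)) homeomorphic_space top_of_set (sphere (0::complex) 1)"
      using homeomorphic_space_trans[OF PQ]
        homeomorphic_space_trans[OF homeomorphic_space_sym[THEN iffD1, OF PQ]] by (rule iffI[rotated])
    then have H: "F x \<in> HCopies (top_of_set (sphere (0::complex) 1)) \<longleftrightarrow> closure (range ?e) homeomorphic sphere (0::complex) 1"
      using TOP[of x] by (simp add: HCopies_def homeomorphic_space_top_of_set)
    have xB: "x \<in> B \<longleftrightarrow> (\<forall>n. \<exists>m. \<forall>l. x \<in> U n m l)" unfolding B by simp
    show ?thesis
    proof (cases "x \<in> B")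
      case True
      have "\<exists>k. infinite {s. \<kappa> x n s \<le> k}" for n
      proof -
        obtain m where "\<forall>l. x \<in> U n m l" using True xB by metis
        then show ?thesis unfolding \<kappa>_def by (rule level_good[OF oU])
      qed
      then have "closure (range ?e) homeomorphic sphere (0::complex) 1" by (rule good_circle[OF spots])
      then show ?thesis using H True by simp
    next
      case False
      then obtain n where n: "\<And>m. \<exists>l. x \<notin> U n m l" using xB by metis
      have "finite {s. \<kappa> x n s \<le> k}" for k unfolding \<kappa>_def by (rule level_bad[OF oU n])
      then have "\<not> closure (range ?e) homeomorphic sphere (0::complex) 1" by (rule bad_not_circle[OF spots])
      then show ?thesis using H False by simp
    qed
  qed
  have "continuous_map euclidean (top_of_set TOP) F"
    using cont TOP by (auto simp: continuous_map_in_subtopology)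
  then show ?thesis unfolding Wadge_reducible_def using red by blast
qed

theorem theorem1p2:
  shows "Pi0_Wadge_complete 4 (HCopies (top_of_set (sphere (0 :: complex) 1)))"
  unfolding Pi0_Wadge_complete_def using HCopies_circle_bPi0 Pi0_4_Wadge_reducible by blast

end
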